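(* Let $m\subset\mathbb{R}^2$ be a bounded domain. Let $(\lambda_k)_{k\in\mathbb{Z}}$ be i.i.d. real random variables on a probability space $(\Omega,\mathcal{F},\mathbb{P})$ with $-\infty<\operatorname{ess\,inf}_\omega\lambda_0(\omega)<\operatorname{ess\,sup}_\omega\lambda_0(\omega)<\infty$ and $\operatorname{ess\,inf}_\omega\lambda_0(\omega)^2=0$. Let $w\in C(\mathbb{R};\mathbb{R})$ satisfy $|w(s)|\le C(1+|s|)^{-\alpha}$, $s\in\mathbb{R}$, with some constants $C\in(0,\infty)$ and $\alpha\in(1,\infty)$, and set $\gamma(s;\omega)=\sum_{k\in\mathbb{Z}}\lambda_k(\omega)w(s-k)$. Then almost surely $$\sigma(H_\gamma)=[\mu_1,\infty).$$
   Context: Let $M:=m\times\mathbb{R}$, write $x=(x_t,x_3)$ with $x_t=(x_1,x_2)\in m$, $\nabla_t=(\partial_1,\partial_2)$, and $\partial_\tau:=x_1\partial_2-x_2\partial_1$. $H_\gamma$ is the self-adjoint operator in $L^2(M)$ generated by the closed quadratic form $Q_\gamma[u]=\int_M\left(|\nabla_t u|^2+|\gamma(x_3;\omega)\partial_\tau u+\partial_3u|^2\right)dx$, $u\in H^1_0(M)$. The number $\mu_1>0$ is the lowest eigenvalue of the Dirichlet Laplacian on $m$, i.e. of the self-adjoint operator in $L^2(m)$ generated by the closed quadratic form $\int_m|\nabla_t u|^2dx_t$, $u\in H^1_0(m)$. *)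

theory Defs
  imports "HOL-Probability.Probability"
begin

section \<open>Essential infimum\<close>

text \<open>Dual of the library's \<open>esssup\<close>; applied to \<open>ereal\<close>-valued functions.\<close>

definition essinf :: "'a measure \<Rightarrow> ('a \<Rightarrow> ereal) \<Rightarrow> ereal" where
  "essinf M f = (if f \<in> borel_measurable M then Liminf (ae_filter M) f else bot)"

section \<open>Unbounded operators in complex \<open>L\<^sup>2\<close> spaces\<close>

text \<open>
  Elements of \<open>L\<^sup>2(M)\<close> are represented by functions, with equality read as equality almost
  everywhere. An operator is given by its graph, a set of pairs of such representatives.
\<close>

definition L2_space :: "'a measure \<Rightarrow> ('a \<Rightarrow> complex) set" where
  "L2_space M = {u \<in> borel_measurable M. integrable M (\<lambda>x. (cmod (u x))\<^sup>2)}"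

definition L2_inner :: "'a measure \<Rightarrow> ('a \<Rightarrow> complex) \<Rightarrow> ('a \<Rightarrow> complex) \<Rightarrow> complex" where
  "L2_inner M u v = (\<integral>x. u x * cnj (v x) \<partial>M)"

definition L2_norm :: "'a measure \<Rightarrow> ('a \<Rightarrow> complex) \<Rightarrow> real" where
  "L2_norm M u = sqrt (\<integral>x. (cmod (u x))\<^sup>2 \<partial>M)"

type_synonym 'a operator_graph = "(('a \<Rightarrow> complex) \<times> ('a \<Rightarrow> complex)) set"

text \<open>
  \<open>z\<close> is in the resolvent set of \<open>A\<close> if \<open>A - z\<close> is a bijection from its domain onto \<open>L\<^sup>2(M)\<close>
  with bounded inverse. Injectivity is contained in the norm bound.
\<close>

definition resolvent_set :: "'a measure \<Rightarrow> 'a operator_graph \<Rightarrow> complex set" where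
  "resolvent_set M A =
    {z. (\<forall>f \<in> L2_space M. \<exists>(u, g) \<in> A. AE x in M. g x - z * u x = f x) \<and>
        (\<exists>C. \<forall>(u, g) \<in> A. L2_norm M u \<le> C * L2_norm M (\<lambda>x. g x - z * u x))}"

definition op_spectrum :: "'a measure \<Rightarrow> 'a operator_graph \<Rightarrow> complex set" where
  "op_spectrum M A = - resolvent_set M A"

definition op_eigenvalue :: "'a measure \<Rightarrow> 'a operator_graph \<Rightarrow> complex \<Rightarrow> bool" where
  "op_eigenvalue M A z \<longleftrightarrow>
    (\<exists>(u, g) \<in> A. (AE x in M. g x = z * u x) \<and> \<not> (AE x in M. u x = 0))"

text \<open>The sesquilinear form, linear in the first argument, with \<open>polar_form q u u = q u\<close>
  for a quadratic form \<open>q\<close>.\<close>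

definition polar_form ::
    "(('a \<Rightarrow> complex) \<Rightarrow> real) \<Rightarrow> ('a \<Rightarrow> complex) \<Rightarrow> ('a \<Rightarrow> complex) \<Rightarrow> complex" where
  "polar_form q u v =
    (\<Sum>k<4. \<i> ^ k * complex_of_real (q (\<lambda>x. u x + \<i> ^ k * v x))) / 4"

text \<open>
  The operator generated by a densely defined closed semibounded quadratic form \<open>q\<close> with
  domain \<open>D\<close>, as in the first representation theorem.
\<close>

definition form_operator ::
    "'a measure \<Rightarrow> ('a \<Rightarrow> complex) set \<Rightarrow> (('a \<Rightarrow> complex) \<Rightarrow> real) \<Rightarrow> 'a operator_graph" where
  "form_operator M D q =
    {(u, f). u \<in> D \<and> f \<in> L2_space M \<and> (\<forall>v \<in> D. polar_form q u v = L2_inner M f v)}"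

section \<open>Sobolev spaces\<close>

abbreviation leb_on :: "'a::euclidean_space set \<Rightarrow> 'a measure" where
  "leb_on S \<equiv> restrict_space lborel S"

definition dir_deriv ::
    "'a::euclidean_space \<Rightarrow> ('a \<Rightarrow> complex) \<Rightarrow> 'a \<Rightarrow> complex" where
  "dir_deriv b f x = frechet_derivative f (at x) b"

text \<open>\<open>C\<^sup>\<infinity>\<close> on the whole space: partial derivatives of every order exist and are
  (totally) differentiable, hence continuous.\<close>

definition smooth_fun :: "('a::euclidean_space \<Rightarrow> complex) \<Rightarrow> bool" where
  "smooth_fun f \<longleftrightarrow>
    (\<forall>bs. set bs \<subseteq> Basis \<longrightarrow> foldr dir_deriv bs f differentiable_on UNIV)"

definition test_functions :: "'a::euclidean_space set \<Rightarrow> ('a \<Rightarrow> complex) set" where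
  "test_functions S =
    {\<phi>. smooth_fun \<phi> \<and> compact (closure {x. \<phi> x \<noteq> 0}) \<and> closure {x. \<phi> x \<noteq> 0} \<subseteq> S}"

definition has_weak_deriv ::
    "'a::euclidean_space set \<Rightarrow> 'a \<Rightarrow> ('a \<Rightarrow> complex) \<Rightarrow> ('a \<Rightarrow> complex) \<Rightarrow> bool" where
  "has_weak_deriv S b u g \<longleftrightarrow> u \<in> L2_space (leb_on S) \<and> g \<in> L2_space (leb_on S) \<and>
    (\<forall>\<phi> \<in> test_functions S.
      (\<integral>x. u x * dir_deriv b \<phi> x \<partial>leb_on S) = - (\<integral>x. g x * \<phi> x \<partial>leb_on S))"

text \<open>Unique up to a null set when it exists and \<open>S\<close> is open; unspecified otherwise.\<close>

definition weak_deriv ::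
    "'a::euclidean_space set \<Rightarrow> 'a \<Rightarrow> ('a \<Rightarrow> complex) \<Rightarrow> 'a \<Rightarrow> complex" where
  "weak_deriv S b u = (SOME g. has_weak_deriv S b u g)"

definition H1_space :: "'a::euclidean_space set \<Rightarrow> ('a \<Rightarrow> complex) set" where
  "H1_space S = {u \<in> L2_space (leb_on S). \<forall>b\<in>Basis. \<exists>g. has_weak_deriv S b u g}"

definition H1_norm :: "'a::euclidean_space set \<Rightarrow> ('a \<Rightarrow> complex) \<Rightarrow> real" where
  "H1_norm S u =
    sqrt ((L2_norm (leb_on S) u)\<^sup>2 + (\<Sum>b\<in>Basis. (L2_norm (leb_on S) (weak_deriv S b u))\<^sup>2))"

text \<open>The closure of the test functions in \<open>H\<^sup>1(S)\<close>.\<close>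

definition H10_space :: "'a::euclidean_space set \<Rightarrow> ('a \<Rightarrow> complex) set" where
  "H10_space S = {u \<in> H1_space S.
    \<exists>\<phi>. (\<forall>n::nat. \<phi> n \<in> test_functions S) \<and>
        (\<lambda>n. H1_norm S (\<lambda>x. \<phi> n x - u x)) \<longlonglongrightarrow> 0}"

section \<open>The Dirichlet Laplacian on the cross-section\<close>

definition dirichlet_form :: "(real^2) set \<Rightarrow> (real^2 \<Rightarrow> complex) \<Rightarrow> real" where
  "dirichlet_form m u =
    (\<integral>x. (cmod (weak_deriv m (axis 1 1) u x))\<^sup>2 + (cmod (weak_deriv m (axis 2 1) u x))\<^sup>2
      \<partial>leb_on m)"

definition dirichlet_laplacian :: "(real^2) set \<Rightarrow> (real^2) operator_graph" where
  "dirichlet_laplacian m = form_operator (leb_on m) (H10_space m) (dirichlet_form m)"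

definition mu1 :: "(real^2) set \<Rightarrow> real" where
  "mu1 m = (LEAST \<mu>. op_eigenvalue (leb_on m) (dirichlet_laplacian m) (complex_of_real \<mu>))"

section \<open>The operator on the tube\<close>

definition tube :: "(real^2) set \<Rightarrow> ((real^2) \<times> real) set" where
  "tube m = m \<times> UNIV"

definition tube_d1 ::
    "(real^2) set \<Rightarrow> ((real^2) \<times> real \<Rightarrow> complex) \<Rightarrow> (real^2) \<times> real \<Rightarrow> complex" where
  "tube_d1 m = weak_deriv (tube m) (axis 1 1, 0)"

definition tube_d2 ::
    "(real^2) set \<Rightarrow> ((real^2) \<times> real \<Rightarrow> complex) \<Rightarrow> (real^2) \<times> real \<Rightarrow> complex" where
  "tube_d2 m = weak_deriv (tube m) (axis 2 1, 0)"

definition tube_d3 ::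
    "(real^2) set \<Rightarrow> ((real^2) \<times> real \<Rightarrow> complex) \<Rightarrow> (real^2) \<times> real \<Rightarrow> complex" where
  "tube_d3 m = weak_deriv (tube m) (0, 1)"

definition tube_dtau ::
    "(real^2) set \<Rightarrow> ((real^2) \<times> real \<Rightarrow> complex) \<Rightarrow> (real^2) \<times> real \<Rightarrow> complex" where
  "tube_dtau m u x =
    complex_of_real (fst x $ 1) * tube_d2 m u x - complex_of_real (fst x $ 2) * tube_d1 m u x"

definition Q_form ::
    "(real^2) set \<Rightarrow> (real \<Rightarrow> real) \<Rightarrow> ((real^2) \<times> real \<Rightarrow> complex) \<Rightarrow> real" where
  "Q_form m g u =
    (\<integral>x. (cmod (tube_d1 m u x))\<^sup>2 + (cmod (tube_d2 m u x))\<^sup>2 +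
         (cmod (complex_of_real (g (snd x)) * tube_dtau m u x + tube_d3 m u x))\<^sup>2
      \<partial>leb_on (tube m))"

definition H_op :: "(real^2) set \<Rightarrow> (real \<Rightarrow> real) \<Rightarrow> ((real^2) \<times> real) operator_graph" where
  "H_op m g = form_operator (leb_on (tube m)) (H10_space (tube m)) (Q_form m g)"

definition random_gamma :: "(int \<Rightarrow> 'w \<Rightarrow> real) \<Rightarrow> (real \<Rightarrow> real) \<Rightarrow> 'w \<Rightarrow> real \<Rightarrow> real" where
  "random_gamma lam w \<omega> s = (\<Sum>\<^sub>\<infinity>k\<in>UNIV. lam k \<omega> * w (s - real_of_int k))"

end

theory Submission
  imports Defs
begin

text \<open>
  Since \<open>\<gamma>\<close> and the cross-section are bounded, \<open>Q\<^sub>\<gamma>[u] + \<parallel>u\<parallel>\<^sup>2\<close> is equivalent to the square of the \<open>H\<^sup>1\<close> norm.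
  Slicing the tube gives \<open>Q\<^sub>\<gamma>[u] \<ge> \<mu>\<^sub>1 \<parallel>u\<parallel>\<^sup>2\<close>, where \<open>\<mu>\<^sub>1\<close> is attained because of Rellich's theorem, and for
  \<open>z \<notin> [\<mu>\<^sub>1, \<infinity>)\<close> a suitable rotation of the form of \<open>H\<^sub>\<gamma> - z\<close> is coercive, so that the Lax-Milgram theorem
  yields the bounded inverse.

  For \<open>\<mu>\<^sub>1 + k\<^sup>2\<close> take \<open>u = \<psi>(x\<^sub>t) \<zeta>((x\<^sub>3 - j)/N) exp(i k (x\<^sub>3 - j))\<close> with the ground state \<open>\<psi>\<close> of the cross-section and a
  cut-off \<open>\<zeta>\<close>. Almost surely there are arbitrarily long runs of indices on which all \<open>\<lambda>\<^sub>k\<close> are small, since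
  \<open>0\<close> lies in the essential range of \<open>\<lambda>\<^sub>0\<close> and disjoint blocks are independent; by the decay of \<open>w\<close> the twist
  \<open>\<gamma>\<close> is then small on arbitrarily long intervals. With \<open>j\<close> chosen there, the terms of the form that contain \<open>\<gamma>\<close>
  are negligible. All of this is measured in the form sense, as a functional on \<open>H\<^sup>1\<^sub>0\<close>, so no
  regularity of \<open>w\<close> is needed and \<open>u\<close> need not lie in the domain of \<open>H\<^sub>\<gamma>\<close>.
\<close>

section \<open>Positive Hermitian forms on spaces of functions\<close>

text \<open>Elements of L^2 and H^1 are functions, not classes modulo null sets. Hence every inner
  product is only positive semidefinite, and \<open>weak_deriv\<close>, an arbitrary choice of
  representative, is linear only almost everywhere. The Hilbert space theory is therefore carried
  out for semidefinite forms on spaces of functions: limits and solutions exist but are determined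
  only up to null vectors, and definiteness is replaced by the fact that null vectors are orthogonal
  to everything. One locale then covers the L^2, H^1, energy and twisted forms, and also the energy
  minus \<open>\<mu>\<close> times the L^2 form, whose null vectors satisfy the eigenvalue equation.
  Another constraint is that \<open>mu1\<close> is a LEAST over eigenvalues, so that it carries
  information only once a smallest eigenvalue has been exhibited. Compactness is therefore proved by
  hand, as an inequality with finitely many functionals, before the tube is considered.\<close>

locale pos_form =
  fixes V :: "('a \<Rightarrow> complex) set" and B :: "('a \<Rightarrow> complex) \<Rightarrow> ('a \<Rightarrow> complex) \<Rightarrow> complex"
  assumes lin: "u \<in> V \<Longrightarrow> v \<in> V \<Longrightarrow> (\<lambda>x. u x + c * v x) \<in> V"
    and zero_mem: "(\<lambda>_. 0) \<in> V"
    and B_lin: "u \<in> V \<Longrightarrow> v \<in> V \<Longrightarrow> w \<in> V \<Longrightarrow> B (\<lambda>x. u x + c * v x) w = B u w + c * B v w"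
    and B_herm: "u \<in> V \<Longrightarrow> v \<in> V \<Longrightarrow> B v u = cnj (B u v)"
    and B_pos: "u \<in> V \<Longrightarrow> 0 \<le> Re (B u u)"
begin

definition N :: "('a \<Rightarrow> complex) \<Rightarrow> real" where
  "N u = sqrt (Re (B u u))"

lemma scale: "u \<in> V \<Longrightarrow> (\<lambda>x. c * u x) \<in> V"
  using lin[OF zero_mem, of u c] by simp

lemma diff: "u \<in> V \<Longrightarrow> v \<in> V \<Longrightarrow> (\<lambda>x. u x - v x) \<in> V"
  using lin[of u v "-1"] by simp

lemma add: "u \<in> V \<Longrightarrow> v \<in> V \<Longrightarrow> (\<lambda>x. u x + v x) \<in> V"
  using lin[of u v 1] by simp

lemma N_nonneg: "u \<in> V \<Longrightarrow> 0 \<le> N u"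
  by (simp add: N_def B_pos)

lemma N_sq: "u \<in> V \<Longrightarrow> (N u)\<^sup>2 = Re (B u u)"
  by (simp add: N_def B_pos)

lemma B_diff: "u \<in> V \<Longrightarrow> v \<in> V \<Longrightarrow> w \<in> V \<Longrightarrow> B (\<lambda>x. u x - v x) w = B u w - B v w"
  using B_lin[of u v w "-1"] by simp

lemma B_lin2:
  assumes "u \<in> V" "v \<in> V" "w \<in> V"
  shows "B w (\<lambda>x. u x + c * v x) = B w u + cnj c * B w v"
  using assms B_herm[of "\<lambda>x. u x + c * v x" w] B_herm[of u w] B_herm[of v w]
  by (simp add: B_lin lin)

lemma B_self: "u \<in> V \<Longrightarrow> B u u = complex_of_real ((N u)\<^sup>2)"
  using B_herm[of u u] by (simp add: N_sq complex_eq_iff)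

text \<open>Cauchy-Schwarz, the triangle inequality, the parallelogram law and the variation of the
  functional in \<open>Riesz\<close> are all read off from this one expansion.\<close>

lemma N_lin_sq:
  assumes "u \<in> V" "v \<in> V"
  shows "(N (\<lambda>x. u x + c * v x))\<^sup>2 = (N u)\<^sup>2 + 2 * Re (cnj c * B u v) + (cmod c)\<^sup>2 * (N v)\<^sup>2"
proof -
  have "B (\<lambda>x. u x + c * v x) (\<lambda>x. u x + c * v x)
      = B u u + cnj c * B u v + c * cnj (B u v) + c * cnj c * B v v"
    using assms B_herm[of u v] by (simp add: B_lin B_lin2 lin algebra_simps)
  then have "Re (B (\<lambda>x. u x + c * v x) (\<lambda>x. u x + c * v x))
     = Re (B u u) + Re (cnj c * B u v) + Re (c * cnj (B u v)) + Re (c * cnj c * B v v)"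
    by simp
  moreover have "Re (c * cnj (B u v)) = Re (cnj c * B u v)" by simp
  moreover have "Re (c * cnj c * B v v) = (cmod c)\<^sup>2 * (N v)\<^sup>2"
    unfolding complex_norm_square[symmetric] B_self[OF assms(2)] by (simp flip: of_real_power of_real_mult)
  ultimately show ?thesis using assms by (simp add: N_sq lin)
qed

end

lemma cnj_mult_self: "cnj z * z = complex_of_real ((cmod z)\<^sup>2)"
  using complex_norm_square[of z] by (simp add: mult.commute)

text \<open>Along c = - t G with small t > 0 the negative term is of order t and the other one of
  order t^2. This is how stationarity of a minimiser becomes an equation.\<close>

lemma quadratic_nonneg_imp_zero:
  fixes G :: complex and b :: real
  assumes "\<And>c. 0 \<le> 2 * Re (cnj c * G) + (cmod c)\<^sup>2 * b"
  shows "G = 0"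
proof (rule ccontr)
  assume "G \<noteq> 0"
  \<comment> \<open>This makes t b < 1 for either sign of b, so that t b - 2 stays negative.\<close>
  define t where "t = 1 / (1 + \<bar>b\<bar>)"
  have t: "t > 0" "t * \<bar>b\<bar> < 1" by (simp_all add: t_def field_simps)
  have "cnj (complex_of_real (- t) * G) * G = complex_of_real (- t * (cmod G)\<^sup>2)"
    by (simp add: mult.assoc cnj_mult_self)
  then have "Re (cnj (complex_of_real (- t) * G) * G) = - t * (cmod G)\<^sup>2"
    by (simp only: Re_complex_of_real)
  then have "0 \<le> 2 * (- t * (cmod G)\<^sup>2) + t\<^sup>2 * (cmod G)\<^sup>2 * b"
    using assms[of "complex_of_real (- t) * G"] by (simp add: norm_mult power_mult_distrib)
  also have "\<dots> = t * (cmod G)\<^sup>2 * (t * b - 2)" by (simp add: power2_eq_square algebra_simps)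
  also have "\<dots> < 0"
  proof -
    have "t * b \<le> t * \<bar>b\<bar>" using t by (intro mult_left_mono) auto
    with t have "t * b - 2 < 0" by linarith
    then show ?thesis using t \<open>G \<noteq> 0\<close> by (intro mult_pos_neg) auto
  qed
  finally show False by simp
qed

context pos_form begin

text \<open>The substitute for definiteness: with \<open>N u = 0\<close> the quadratic term of u
  vanishes, and the mixed term cannot stay alone without changing sign. Applied to the energy minus
  \<open>\<mu>\<close> times the L^2 form it yields the eigenvalue equation.\<close>

lemma null_orthogonal:
  assumes "u \<in> V" "v \<in> V" "N u = 0"
  shows "B u v = 0"
proof (rule quadratic_nonneg_imp_zero)
  show "0 \<le> 2 * Re (cnj c * B u v) + (cmod c)\<^sup>2 * (N v)\<^sup>2" for c
    using zero_le_power2[of "N (\<lambda>x. u x + c * v x)"] by (simp add: N_lin_sq assms)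
qed

lemma CS:
  assumes "u \<in> V" "v \<in> V"
  shows "cmod (B u v) \<le> N u * N v"
proof (cases "N v = 0")
  case True
  with null_orthogonal[of v u] assms B_herm[of v u] have "B u v = 0"
    by simp
  then show ?thesis using True by simp
next
  case False
  then have p: "N v > 0" using N_nonneg[of v] assms by simp
  \<comment> \<open>The c that minimises \<open>N (\<lambda>x. u x + c * v x)\<close>.\<close>
  define c where "c = - B u v / complex_of_real ((N v)\<^sup>2)"
  have "cnj c * B u v = complex_of_real (- (cmod (B u v))\<^sup>2 / (N v)\<^sup>2)"
    unfolding c_def by (simp add: cnj_mult_self)
  then have "Re (cnj c * B u v) = - (cmod (B u v))\<^sup>2 / (N v)\<^sup>2"
    by (simp only: Re_complex_of_real)
  moreover have "(cmod c)\<^sup>2 * (N v)\<^sup>2 = (cmod (B u v))\<^sup>2 / (N v)\<^sup>2"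
    using p unfolding c_def by (simp add: norm_divide power2_eq_square field_simps norm_mult)
  ultimately have "0 \<le> (N u)\<^sup>2 - (cmod (B u v))\<^sup>2 / (N v)\<^sup>2"
    using N_lin_sq[OF assms, of c] zero_le_power2[of "N (\<lambda>x. u x + c * v x)"] by linarith
  then have "(cmod (B u v))\<^sup>2 \<le> (N u * N v)\<^sup>2"
    using p by (simp add: field_simps power_mult_distrib)
  then show ?thesis using N_nonneg assms by (meson mult_nonneg_nonneg power2_le_imp_le)
qed

lemma triangle:
  assumes "u \<in> V" "v \<in> V"
  shows "N (\<lambda>x. u x + c * v x) \<le> N u + cmod c * N v"
proof (rule power2_le_imp_le)
  have "Re (cnj c * B u v) \<le> cmod (cnj c * B u v)" by (rule complex_Re_le_cmod)
  also have "\<dots> \<le> cmod c * (N u * N v)"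
    using CS[OF assms] by (simp add: norm_mult mult_left_mono)
  finally show "(N (\<lambda>x. u x + c * v x))\<^sup>2 \<le> (N u + cmod c * N v)\<^sup>2"
    unfolding N_lin_sq[OF assms] by (simp add: power2_sum power_mult_distrib algebra_simps)
  show "0 \<le> N u + cmod c * N v" using N_nonneg assms by simp
qed

lemma triangle_diff: "u \<in> V \<Longrightarrow> v \<in> V \<Longrightarrow> N (\<lambda>x. u x - v x) \<le> N u + N v"
  using triangle[of u v "-1"] by simp

lemma triangle_add: "u \<in> V \<Longrightarrow> v \<in> V \<Longrightarrow> N (\<lambda>x. u x + v x) \<le> N u + N v"
  using triangle[of u v 1] by simp

lemma N_zero [simp]: "N (\<lambda>_. 0) = 0"
  using B_lin[OF zero_mem zero_mem zero_mem, of "-1"] by (simp add: N_def)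

lemma N_scale: "u \<in> V \<Longrightarrow> N (\<lambda>x. c * u x) = cmod c * N u"
proof (rule power2_eq_imp_eq)
  assume u: "u \<in> V"
  show "(N (\<lambda>x. c * u x))\<^sup>2 = (cmod c * N u)\<^sup>2"
    using N_lin_sq[OF zero_mem u, of c] null_orthogonal[OF zero_mem u]
    by (simp add: power_mult_distrib)
qed (auto simp: N_nonneg scale)

lemma N_commute: "u \<in> V \<Longrightarrow> v \<in> V \<Longrightarrow> N (\<lambda>x. u x - v x) = N (\<lambda>x. v x - u x)"
  using N_scale[of "\<lambda>x. u x - v x" "-1"] diff by simp

lemma triangle_mid: "u \<in> V \<Longrightarrow> v \<in> V \<Longrightarrow> w \<in> V \<Longrightarrow>
    N (\<lambda>x. u x - v x) \<le> N (\<lambda>x. u x - w x) + N (\<lambda>x. w x - v x)"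
  using triangle_add[of "\<lambda>x. u x - w x" "\<lambda>x. w x - v x"] by (simp add: diff)

lemma N_le_add_diff: "u \<in> V \<Longrightarrow> v \<in> V \<Longrightarrow> N u \<le> N v + N (\<lambda>x. u x - v x)"
  using triangle_add[of v "\<lambda>x. u x - v x"] by (simp add: diff)

lemma N_tendsto:
  assumes "\<And>n. U n \<in> V" "l \<in> V" "(\<lambda>n. N (\<lambda>x. U n x - l x)) \<longlonglongrightarrow> 0"
  shows "(\<lambda>n. N (U n)) \<longlonglongrightarrow> N l"
proof (rule tendsto_sandwich)
  show "(\<lambda>n. N l - N (\<lambda>x. U n x - l x)) \<longlonglongrightarrow> N l" "(\<lambda>n. N l + N (\<lambda>x. U n x - l x)) \<longlonglongrightarrow> N l"
    using tendsto_diff[OF tendsto_const assms(3), of "N l"] tendsto_add[OF tendsto_const assms(3), of "N l"]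
    by simp_all
  show "\<forall>\<^sub>F n in sequentially. N l - N (\<lambda>x. U n x - l x) \<le> N (U n)"
    using N_le_add_diff[OF assms(2) assms(1)] N_commute[OF assms(2) assms(1)]
    by (simp add: algebra_simps)
  show "\<forall>\<^sub>F n in sequentially. N (U n) \<le> N l + N (\<lambda>x. U n x - l x)"
    using N_le_add_diff[OF assms(1) assms(2)] by simp
qed

lemma B_tendsto:
  assumes "\<And>n. U n \<in> V" "l \<in> V" "(\<lambda>n. N (\<lambda>x. U n x - l x)) \<longlonglongrightarrow> 0" "v \<in> V"
  shows "(\<lambda>n. B (U n) v) \<longlonglongrightarrow> B l v"
proof (rule LIM_zero_cancel, rule Lim_null_comparison)
  show "\<forall>\<^sub>F n in sequentially. cmod (B (U n) v - B l v) \<le> N (\<lambda>x. U n x - l x) * N v"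
    using CS[OF diff[OF assms(1,2)] assms(4)] B_diff[OF assms(1,2,4)] by simp
  show "(\<lambda>n. N (\<lambda>x. U n x - l x) * N v) \<longlonglongrightarrow> 0"
    using tendsto_mult[OF assms(3) tendsto_const, of "N v"] by simp
qed

text \<open>In the sum over the powers c of the imaginary unit, c times the conjugate of c is 1
  while the sums of c and of c^2 vanish, so only \<open>B u v\<close> survives. This identifies the
  form in \<open>form_operator\<close>, which is built from a quadratic form, with an explicit
  sesquilinear one.\<close>

lemma polar_form_eq:
  assumes q: "\<And>u. u \<in> V \<Longrightarrow> q u = (N u)\<^sup>2" and uv: "u \<in> V" "v \<in> V"
  shows "polar_form q u v = B u v"
proof -
  have e: "complex_of_real (q (\<lambda>x. u x + c * v x)) =
     B u u + cnj c * B u v + c * cnj (B u v) + c * cnj c * B v v" for c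
    using uv B_herm[of u v] B_self[of "\<lambda>x. u x + c * v x"]
    by (simp add: q lin B_lin B_lin2 algebra_simps del: of_real_power)
  show ?thesis
    unfolding polar_form_def e
    by (simp add: eval_nat_numeral algebra_simps)
qed

end

section \<open>Riesz representation and the Lax-Milgram theorem\<close>

locale complete_pos_form = pos_form +
  assumes complete: "(\<And>n. U n \<in> V) \<Longrightarrow>
      (\<And>e. e > 0 \<Longrightarrow> \<exists>K. \<forall>m\<ge>K. \<forall>n\<ge>K. N (\<lambda>x. U m x - U n x) < e) \<Longrightarrow>
      \<exists>l\<in>V. (\<lambda>n. N (\<lambda>x. U n x - l x)) \<longlonglongrightarrow> 0"
begin

text \<open>Direct method: \<open>J\<close> is bounded below by completing a square, its minimising
  sequences are Cauchy by strict convexity, and the first variation at a minimiser is the equation.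
  \<open>F\<close> is conjugate linear because the form is so in its second argument.\<close>

lemma Riesz:
  assumes F_lin: "\<And>u v c. u \<in> V \<Longrightarrow> v \<in> V \<Longrightarrow> F (\<lambda>x. u x + c * v x) = F u + cnj c * F v"
    and F_bd: "\<And>v. v \<in> V \<Longrightarrow> cmod (F v) \<le> K * N v"
  shows "\<exists>u\<in>V. \<forall>v\<in>V. B u v = F v"
proof -
  define J where "J u = (N u)\<^sup>2 - 2 * Re (F u)" for u
  have J_lin: "J (\<lambda>x. u x + c * v x) = J u + 2 * Re (cnj c * (B u v - F v)) + (cmod c)\<^sup>2 * (N v)\<^sup>2"
    if "u \<in> V" "v \<in> V" for u v c
    using that by (simp add: J_def N_lin_sq F_lin algebra_simps)
  have ReF: "Re (F v) \<le> K * N v" if "v \<in> V" for v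
    using F_bd[OF that] complex_Re_le_cmod[of "F v"] by linarith
  have J_bd: "- (K\<^sup>2) \<le> J u" if "u \<in> V" for u
  proof -
    have "0 \<le> (N u - K)\<^sup>2" by simp
    then show ?thesis using ReF[OF that] by (simp add: J_def power2_diff mult.commute)
  qed
  define d where "d = Inf (J ` V)"
  have bb: "bdd_below (J ` V)" using J_bd by (auto intro!: bdd_belowI)
  have d_le: "d \<le> J u" if "u \<in> V" for u unfolding d_def using bb that by (auto intro: cInf_lower)
  have "\<exists>u\<in>V. J u < d + 1 / real (Suc n)" for n
    using cInf_lessD[of "J ` V" "d + 1 / real (Suc n)"] zero_mem unfolding d_def by fastforce
  then obtain U where U: "\<And>n. U n \<in> V" "\<And>n. J (U n) < d + 1 / real (Suc n)" by metis
  \<comment> \<open>Comparing \<open>J\<close> at two members of the sequence with its value at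
    their midpoint, which is at least d, isolates half of the squared distance.\<close>
  have cau: "(N (\<lambda>x. U m x - U n x))\<^sup>2 < 2 / real (Suc m) + 2 / real (Suc n)" for m n
  proof -
    let ?w = "\<lambda>x. U m x - U n x"
    have w: "?w \<in> V" using U diff by simp
    have "J (\<lambda>x. U n x + 1 * ?w x) = J (U n) + 2 * Re (B (U n) ?w - F ?w) + (N ?w)\<^sup>2"
      using J_lin[OF U(1) w, of n 1] by simp
    moreover have "(\<lambda>x. U n x + 1 * ?w x) = U m" by auto
    moreover have "J (\<lambda>x. U n x + (1/2) * ?w x) = J (U n) + Re (B (U n) ?w - F ?w) + (N ?w)\<^sup>2 / 4"
      using J_lin[OF U(1) w, of n "1/2"] by (simp add: power2_eq_square)
    moreover have "d \<le> J (\<lambda>x. U n x + (1/2) * ?w x)" using d_le lin U w by blast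
    ultimately show ?thesis using U(2)[of m] U(2)[of n] by simp
  qed
  obtain l where l: "l \<in> V" "(\<lambda>n. N (\<lambda>x. U n x - l x)) \<longlonglongrightarrow> 0"
  proof -
    have "\<exists>K. \<forall>m\<ge>K. \<forall>n\<ge>K. N (\<lambda>x. U m x - U n x) < e" if e: "e > 0" for e
    proof -
      obtain K where K: "4 / e\<^sup>2 < real K" using reals_Archimedean2 by blast
      have Kp: "0 < real K" using K by (smt (verit) divide_nonneg_nonneg zero_le_power2)
      have "N (\<lambda>x. U m x - U n x) < e" if "m \<ge> K" "n \<ge> K" for m n
      proof (rule power_less_imp_less_base)
        have a: "2 / real (Suc m) \<le> 2 / real K" "2 / real (Suc n) \<le> 2 / real K"
          using that Kp by (auto intro!: divide_left_mono)
        have "4 / real K < e\<^sup>2" using K Kp e by (simp add: field_simps)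
        then show "(N (\<lambda>x. U m x - U n x))\<^sup>2 < e\<^sup>2" using cau[of m n] a by linarith
      qed (use e in auto)
      then show ?thesis by blast
    qed
    from complete[OF U(1) this] show ?thesis using that by blast
  qed
  have Jl: "J l \<le> d"
  proof (rule LIMSEQ_le_const)
    let ?w = "\<lambda>n x. U n x - l x"
    have "J l \<le> d + 1 / real (Suc n) + (2 * (N (U n) * N (?w n) + K * N (?w n)) + (N (?w n))\<^sup>2)" for n
    proof -
      have w: "?w n \<in> V" using U l diff by simp
      have "J l = J (\<lambda>x. U n x + (-1) * ?w n x)" by (simp)
      also have "\<dots> = J (U n) - 2 * Re (B (U n) (?w n) - F (?w n)) + (N (?w n))\<^sup>2"
        using J_lin[OF U(1) w, of n "-1"] by simp
      finally have "J l \<le> J (U n) + 2 * (cmod (B (U n) (?w n)) + cmod (F (?w n))) + (N (?w n))\<^sup>2"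
        using abs_Re_le_cmod[of "B (U n) (?w n)"] abs_Re_le_cmod[of "F (?w n)"] by auto
      then show ?thesis using CS[OF U(1)[of n] w] F_bd[OF w] U(2)[of n] by (simp only: mult.assoc distrib_left)
    qed
    moreover have "(\<lambda>n. d + 1 / real (Suc n) + (2 * (N (U n) * N (?w n) + K * N (?w n)) + (N (?w n))\<^sup>2))
        \<longlonglongrightarrow> d + 0 + (2 * (N l * 0 + K * 0) + 0\<^sup>2)"
      by (intro tendsto_intros l N_tendsto U) (use LIMSEQ_inverse_real_of_nat in \<open>simp add: inverse_eq_divide\<close>)
    ultimately show "(\<lambda>n. d + 1 / real (Suc n) + (2 * (N (U n) * N (?w n) + K * N (?w n)) + (N (?w n))\<^sup>2))
        \<longlonglongrightarrow> d" "\<exists>K'. \<forall>n\<ge>K'. J l \<le> d + 1 / real (Suc n) + (2 * (N (U n) * N (?w n) + K * N (?w n)) + (N (?w n))\<^sup>2)"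
      by auto
  qed
  have "B l v = F v" if v: "v \<in> V" for v
  proof -
    have "0 \<le> 2 * Re (cnj c * (B l v - F v)) + (cmod c)\<^sup>2 * (N v)\<^sup>2" for c
      using J_lin[OF l(1) v, of c] d_le[OF lin[OF l(1) v, of c]] Jl by linarith
    then show ?thesis using quadratic_nonneg_imp_zero[of "B l v - F v"] by fastforce
  qed
  then show ?thesis using l by blast
qed

text \<open>With \<open>T u\<close> representing \<open>a u\<close> and f representing
  \<open>F\<close>, the equation is T u = f. It is solved by the iteration u - \<rho> (T u - f),
  whose residuals shrink geometrically because a is coercive and bounded.\<close>

theorem Lax_Milgram:
  fixes a :: "('a \<Rightarrow> complex) \<Rightarrow> ('a \<Rightarrow> complex) \<Rightarrow> complex"
  assumes a_lin: "\<And>u v w c. u \<in> V \<Longrightarrow> v \<in> V \<Longrightarrow> w \<in> V \<Longrightarrow> a (\<lambda>x. u x + c * v x) w = a u w + c * a v w"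
    and a_lin2: "\<And>u v w c. u \<in> V \<Longrightarrow> v \<in> V \<Longrightarrow> w \<in> V \<Longrightarrow> a w (\<lambda>x. u x + c * v x) = a w u + cnj c * a w v"
    and a_bd: "\<And>u v. u \<in> V \<Longrightarrow> v \<in> V \<Longrightarrow> cmod (a u v) \<le> K * N u * N v"
    and a_coercive: "\<And>u. u \<in> V \<Longrightarrow> k * (N u)\<^sup>2 \<le> Re (a u u)" and k: "k > 0"
    and F_lin: "\<And>u v c. u \<in> V \<Longrightarrow> v \<in> V \<Longrightarrow> F (\<lambda>x. u x + c * v x) = F u + cnj c * F v"
    and F_bd: "\<And>v. v \<in> V \<Longrightarrow> cmod (F v) \<le> L * N v"
  shows "\<exists>u\<in>V. \<forall>v\<in>V. a u v = F v"
proof -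
  \<comment> \<open>Enlarging the bound to at least 2 k keeps k / K' at most 1/2, so that the
    contraction factor q below is the root of a positive number.\<close>
  define K' where "K' = max K (2 * k)"
  have K'1: "0 < K'" "K' \<ge> 2 * k" and K': "cmod (a u v) \<le> K' * N u * N v" if "u \<in> V" "v \<in> V" for u v
  proof -
    have "K * (N u * N v) \<le> K' * (N u * N v)" using that N_nonneg
      by (intro mult_right_mono) (auto simp: K'_def)
    then show "cmod (a u v) \<le> K' * N u * N v" using a_bd[OF that] by (simp add: mult.assoc)
  qed (use k in \<open>auto simp: K'_def\<close>)
  note K'1 = K'1[OF zero_mem zero_mem]
  have "\<exists>t\<in>V. \<forall>v\<in>V. B t v = a u v" if u: "u \<in> V" for u
    by (rule Riesz[where K="K' * N u"]) (use u a_lin2 K' in auto)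
  then obtain T where T: "\<And>u. u \<in> V \<Longrightarrow> T u \<in> V" "\<And>u v. u \<in> V \<Longrightarrow> v \<in> V \<Longrightarrow> B (T u) v = a u v"
    by metis
  obtain f where f: "f \<in> V" "\<And>v. v \<in> V \<Longrightarrow> B f v = F v"
    using Riesz[OF F_lin F_bd] by blast
  have NT: "N (T u) \<le> K' * N u" if u: "u \<in> V" for u
  proof (cases "N (T u) = 0")
    case False
    then have p: "N (T u) > 0" using N_nonneg T u by (simp add: order_less_le)
    have "(N (T u))\<^sup>2 = cmod (a u (T u))" using B_self[OF T(1)[OF u]] T(2)[OF u T(1)[OF u]]
      by (metis norm_of_real abs_of_nonneg zero_le_power2)
    also have "\<dots> \<le> K' * N u * N (T u)" by (rule K') (use u T in auto)
    finally show ?thesis using p by (simp add: power2_eq_square)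
  qed (use K'1 N_nonneg u in auto)
  \<comment> \<open>The minimiser of 1 - 2 \<rho> k + \<rho>^2 K'^2; the minimum is the square of
    q.\<close>
  define \<rho> where "\<rho> = k / K'\<^sup>2"
  have \<rho>: "\<rho> > 0" using k K'1 by (simp add: \<rho>_def)
  define q where "q = sqrt (1 - k\<^sup>2 / K'\<^sup>2)"
  have le1: "k\<^sup>2 / K'\<^sup>2 \<le> 1/4"
  proof -
    have "(2 * k)\<^sup>2 \<le> K'\<^sup>2" using K'1 k by (intro power_mono) auto
    then show ?thesis using K'1 by (simp add: field_simps power2_eq_square)
  qed
  have q0: "0 \<le> q" "q < 1" "q\<^sup>2 = 1 - k\<^sup>2 / K'\<^sup>2"
    using le1 k K'1 by (auto simp: q_def)
  define S where "S r = (\<lambda>x. r x + (- complex_of_real \<rho>) * T r x)" for r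
  have S: "S r \<in> V" if "r \<in> V" for r unfolding S_def by (intro lin that T)
  have NS: "N (S r) \<le> q * N r" if r: "r \<in> V" for r
  proof (rule power2_le_imp_le)
    have "Re (B r (T r)) = Re (a r r)" using B_herm[OF T(1)[OF r] r] T(2)[OF r r] by simp
    then have "(N (S r))\<^sup>2 = (N r)\<^sup>2 - 2 * \<rho> * Re (a r r) + \<rho>\<^sup>2 * (N (T r))\<^sup>2"
      unfolding S_def N_lin_sq[OF r T(1)[OF r]] by simp
    also have "\<dots> \<le> (N r)\<^sup>2 - 2 * \<rho> * (k * (N r)\<^sup>2) + \<rho>\<^sup>2 * (K' * N r)\<^sup>2"
      using \<rho> a_coercive[OF r] NT[OF r] N_nonneg[OF T(1)[OF r]] N_nonneg[OF r]
      by (intro add_mono diff_mono mult_left_mono power_mono) auto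
    also have "\<dots> = (q * N r)\<^sup>2"
      using K'1 unfolding power_mult_distrib q0 \<rho>_def by (simp add: power2_eq_square field_simps)
    finally show "(N (S r))\<^sup>2 \<le> (q * N r)\<^sup>2" .
  qed (use q0 N_nonneg r in auto)
  \<comment> \<open>These play the role of the residuals T (U n) - f for the start U 0 = 0. Since
    \<open>T\<close> is only a choice of representing functions, it need not be linear as a map; the
    residuals are therefore iterated by themselves and tied to \<open>U\<close> only after pairing
    with v, in \<open>inv\<close>.\<close>
  define r where "r n = (S ^^ n) (\<lambda>x. - f x)" for n
  have r0: "r 0 \<in> V" using scale[OF f(1), of "-1"] by (simp add: r_def)
  have rV: "r n \<in> V" for n by (induction n) (use r0 S in \<open>auto simp: r_def\<close>)
  have rn: "N (r n) \<le> q ^ n * N (r 0)" for n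
  proof (induction n)
    case (Suc n)
    have "N (r (Suc n)) \<le> q * N (r n)" using NS[OF rV] by (simp add: r_def)
    also have "\<dots> \<le> q * (q ^ n * N (r 0))" using Suc q0 by (intro mult_left_mono) auto
    finally show ?case by (simp add: mult.assoc)
  qed simp
  define U where "U n = (\<lambda>x. \<Sum>i<n. (- complex_of_real \<rho>) * r i x)" for n
  have USuc: "U (Suc n) = (\<lambda>x. U n x + (- complex_of_real \<rho>) * r n x)" for n
    by (simp add: U_def)
  have UV: "U n \<in> V" for n
  proof (induction n)
    case (Suc n)
    then show ?case unfolding USuc by (intro lin rV)
  qed (use zero_mem in \<open>simp add: U_def\<close>)
  have inv: "B (r n) v = a (U n) v - F v" if v: "v \<in> V" for n v
  proof (induction n)
    case 0
    have "a (\<lambda>_. 0) v = 0" using a_lin[OF zero_mem zero_mem v, of "-1"] by simp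
    moreover have "B (\<lambda>x. - f x) v = - B f v"
      using B_diff[OF zero_mem f(1) v] null_orthogonal[OF zero_mem v] by simp
    ultimately show ?case using f v by (simp add: r_def U_def)
  next
    case (Suc n)
    have "B (r (Suc n)) v = B (r n) v + (- complex_of_real \<rho>) * a (r n) v"
      using B_lin[OF rV[of n] T(1)[OF rV[of n]] v, of "- complex_of_real \<rho>"] T(2)[OF rV[of n] v]
      by (simp add: r_def S_def)
    also have "\<dots> = a (U (Suc n)) v - F v"
      unfolding USuc a_lin[OF UV rV v] Suc by simp
    finally show ?case .
  qed
  \<comment> \<open>The sum of the geometric series that bounds the increments of
    \<open>U\<close>.\<close>
  define E where "E = \<rho> * N (r 0) / (1 - q)"
  have E0: "E \<ge> 0" using \<rho> q0 N_nonneg r0 by (simp add: E_def)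
  have tail: "N (\<lambda>x. U (n + j) x - U n x) \<le> E * q ^ n * (1 - q ^ j)" for n j
  proof (induction j)
    case (Suc j)
    have "N (\<lambda>x. U (n + Suc j) x - U n x)
        = N (\<lambda>x. (U (n + j) x - U n x) + (- complex_of_real \<rho>) * r (n + j) x)"
      by (simp add: USuc algebra_simps)
    also have "\<dots> \<le> N (\<lambda>x. U (n + j) x - U n x) + cmod (- complex_of_real \<rho>) * N (r (n + j))"
      by (intro triangle diff UV rV)
    also have "\<dots> \<le> E * q ^ n * (1 - q ^ j) + \<rho> * (q ^ (n + j) * N (r 0))"
      using \<rho> by (intro add_mono Suc) (simp add: rn)
    also have "\<rho> * (q ^ (n + j) * N (r 0)) = E * q ^ n * q ^ j * (1 - q)"
      using q0 by (simp add: E_def power_add)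
    finally show ?case by (simp add: algebra_simps)
  qed simp
  have tail': "N (\<lambda>x. U m x - U n x) \<le> E * q ^ n" if "m \<ge> n" for m n
  proof -
    have "N (\<lambda>x. U (n + (m - n)) x - U n x) \<le> E * q ^ n * (1 - q ^ (m - n))" by (rule tail)
    also have "\<dots> \<le> E * q ^ n * 1" using E0 q0 by (intro mult_left_mono) auto
    finally show ?thesis using that by simp
  qed
  have Eq: "(\<lambda>n. E * q ^ n) \<longlonglongrightarrow> 0"
    using tendsto_mult[OF tendsto_const LIMSEQ_realpow_zero[OF q0(1,2)], of E] by simp
  obtain l where l: "l \<in> V" "(\<lambda>n. N (\<lambda>x. U n x - l x)) \<longlonglongrightarrow> 0"
  proof -
    have "\<exists>K. \<forall>m\<ge>K. \<forall>n\<ge>K. N (\<lambda>x. U m x - U n x) < e" if e: "e > 0" for e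
    proof -
      obtain M where M: "\<And>n. n \<ge> M \<Longrightarrow> \<bar>E * q ^ n\<bar> < e"
        using LIMSEQ_D[OF Eq e] by auto
      have "N (\<lambda>x. U m x - U n x) < e" if "m \<ge> M" "n \<ge> M" for m n
      proof (cases "m \<ge> n")
        case True then show ?thesis using tail'[of n m] M[of n] that by fastforce
      next
        case False then show ?thesis
          using tail'[of m n] M[of m] that N_commute[OF UV UV, of m n] by fastforce
      qed
      then show ?thesis by blast
    qed
    from complete[OF UV this] show ?thesis using that by blast
  qed
  have "a l v = F v" if v: "v \<in> V" for v
  proof -
    have "cmod (a l v - F v) \<le> 0"
    proof (rule LIMSEQ_le_const)
      show "(\<lambda>n. K' * N (\<lambda>x. U n x - l x) * N v + q ^ n * N (r 0) * N v) \<longlonglongrightarrow> 0"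
        by (rule tendsto_eq_intros l LIMSEQ_realpow_zero[OF q0(1,2)] refl | simp)+
      have "cmod (a l v - F v) \<le> K' * N (\<lambda>x. U n x - l x) * N v + q ^ n * N (r 0) * N v" for n
      proof -
        have "a (U n) v = a (\<lambda>x. l x + 1 * (U n x - l x)) v" by simp
        also have "\<dots> = a l v + 1 * a (\<lambda>x. U n x - l x) v"
          by (rule a_lin) (use l UV diff v in auto)
        finally have "a l v - F v = B (r n) v - a (\<lambda>x. U n x - l x) v"
          using inv[OF v, of n] by simp
        then have "cmod (a l v - F v) \<le> cmod (B (r n) v) + cmod (a (\<lambda>x. U n x - l x) v)"
          by (simp add: norm_triangle_ineq4)
        moreover have "cmod (B (r n) v) \<le> q ^ n * N (r 0) * N v"
          using CS[OF rV v, of n] mult_right_mono[OF rn N_nonneg[OF v], of n] by linarith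
        ultimately show ?thesis using K'[OF diff[OF UV l(1)] v, of n] by linarith
      qed
      then show "\<exists>M. \<forall>n\<ge>M. cmod (a l v - F v) \<le> K' * N (\<lambda>x. U n x - l x) * N v + q ^ n * N (r 0) * N v"
        by blast
    qed
    then show ?thesis by simp
  qed
  then show ?thesis using l by blast
qed

end

section \<open>The space \<open>L\<^sup>2\<close>\<close>

lemma borel_measurable_cnj [measurable (raw)]:
  "f \<in> borel_measurable M \<Longrightarrow> (\<lambda>x. cnj (f x)) \<in> borel_measurable M"
  by (rule borel_measurable_continuous_on[where f=cnj]) (auto intro: continuous_intros)

lemma L2_spaceD:
  "u \<in> L2_space M \<Longrightarrow> u \<in> borel_measurable M"
  "u \<in> L2_space M \<Longrightarrow> integrable M (\<lambda>x. (cmod (u x))\<^sup>2)"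
  by (auto simp: L2_space_def)

lemma L2_spaceI:
  assumes "u \<in> borel_measurable M" "integrable M g" "\<And>x. x \<in> space M \<Longrightarrow> (cmod (u x))\<^sup>2 \<le> g x"
  shows "u \<in> L2_space M"
proof -
  have "integrable M (\<lambda>x. (cmod (u x))\<^sup>2)"
    using assms by (intro Bochner_Integration.integrable_bound[OF assms(2)]) (auto intro!: AE_I2 order_trans[OF _ abs_ge_self])
  then show ?thesis using assms by (simp add: L2_space_def)
qed

lemma L2_integrable_mult:
  assumes "u \<in> L2_space M" "v \<in> L2_space M"
  shows "integrable M (\<lambda>x. u x * cnj (v x))"
proof (rule Bochner_Integration.integrable_bound[where f="\<lambda>x. (cmod (u x))\<^sup>2 + (cmod (v x))\<^sup>2"])
  have "cmod a * cmod b \<le> (cmod a)\<^sup>2 + (cmod b)\<^sup>2" for a b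
    using sum_squares_bound[of "cmod a" "cmod b"] mult_nonneg_nonneg[of "cmod a" "cmod b"] by (simp add: mult.assoc del: mult_nonneg_nonneg)
  then show "AE x in M. norm (u x * cnj (v x)) \<le> norm ((cmod (u x))\<^sup>2 + (cmod (v x))\<^sup>2)"
    by (intro AE_I2) (simp add: norm_mult)
qed (use assms in \<open>auto dest: L2_spaceD intro!: borel_measurable_times borel_measurable_cnj\<close>)

lemma L2_pos_form: "pos_form (L2_space M) (L2_inner M)"
proof
  fix u v :: "'a \<Rightarrow> complex" and c
  assume uv: "u \<in> L2_space M" "v \<in> L2_space M"
  show "(\<lambda>x. u x + c * v x) \<in> L2_space M"
  proof (rule L2_spaceI)
    have "(cmod (a + c * b))\<^sup>2 \<le> 2 * (cmod a)\<^sup>2 + 2 * (cmod c)\<^sup>2 * (cmod b)\<^sup>2" for a b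
    proof -
      have "(cmod (a + c * b))\<^sup>2 \<le> (cmod a + cmod (c * b))\<^sup>2" by (intro power_mono norm_triangle_ineq) simp
      also have "\<dots> \<le> 2 * (cmod a)\<^sup>2 + 2 * (cmod (c * b))\<^sup>2"
        using sum_squares_bound[of "cmod a" "cmod (c * b)"] by (simp add: power2_sum)
      finally show ?thesis by (simp add: norm_mult power_mult_distrib)
    qed
    then show "(cmod (u x + c * v x))\<^sup>2 \<le> 2 * (cmod (u x))\<^sup>2 + 2 * (cmod c)\<^sup>2 * (cmod (v x))\<^sup>2" for x .
  qed (use uv[THEN L2_spaceD(1)] uv[THEN L2_spaceD(2)] in auto)
next
  show "(\<lambda>_. 0) \<in> L2_space M" by (simp add: L2_space_def)
next
  fix u v w :: "'a \<Rightarrow> complex" and c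
  assume "u \<in> L2_space M" "v \<in> L2_space M" "w \<in> L2_space M"
  then show "L2_inner M (\<lambda>x. u x + c * v x) w = L2_inner M u w + c * L2_inner M v w"
    by (simp add: L2_inner_def distrib_right mult.assoc L2_integrable_mult)
next
  fix u v :: "'a \<Rightarrow> complex"
  have "(\<lambda>x. v x * cnj (u x)) = (\<lambda>x. cnj (u x * cnj (v x)))" by (auto simp: mult.commute)
  then show "L2_inner M v u = cnj (L2_inner M u v)"
    unfolding L2_inner_def by (simp only: Bochner_Integration.integral_cnj)
next
  fix u :: "'a \<Rightarrow> complex"
  have "L2_inner M u u = complex_of_real (\<integral>x. (cmod (u x))\<^sup>2 \<partial>M)"
    unfolding L2_inner_def complex_norm_square[symmetric] by (rule integral_complex_of_real)
  then show "0 \<le> Re (L2_inner M u u)" by simp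
qed

lemma L2_norm_eq: "pos_form.N (L2_inner M) = L2_norm M"
proof
  fix u :: "'a \<Rightarrow> complex"
  have "L2_inner M u u = complex_of_real (\<integral>x. (cmod (u x))\<^sup>2 \<partial>M)"
    unfolding L2_inner_def complex_norm_square[symmetric] by (rule integral_complex_of_real)
  then show "pos_form.N (L2_inner M) u = L2_norm M u"
    by (simp add: pos_form.N_def[OF L2_pos_form] L2_norm_def)
qed

interpretation L2: pos_form "L2_space M" "L2_inner M"
  rewrites "pos_form.N (L2_inner M) = L2_norm M" for M :: "'a measure"
  by (rule L2_pos_form, rule L2_norm_eq)

lemma L2_norm_ge_0 [simp]: "0 \<le> L2_norm M u"
  by (simp add: L2_norm_def)

lemma L2_norm_sq: "(L2_norm M u)\<^sup>2 = (\<integral>x. (cmod (u x))\<^sup>2 \<partial>M)"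
  by (simp add: L2_norm_def)

lemma L2_norm_cong_AE:
  assumes "u \<in> borel_measurable M" "v \<in> borel_measurable M" "AE x in M. u x = v x"
  shows "L2_norm M u = L2_norm M v"
  unfolding L2_norm_def using assms by (intro arg_cong[where f=sqrt] integral_cong_AE) auto

lemma L2_inner_cong_AE:
  assumes "u \<in> borel_measurable M" "v \<in> borel_measurable M" "AE x in M. u x = v x"
    "u' \<in> borel_measurable M" "v' \<in> borel_measurable M" "AE x in M. u' x = v' x"
  shows "L2_inner M u u' = L2_inner M v v'"
  unfolding L2_inner_def using assms by (intro integral_cong_AE) auto

lemma L2_norm_zero_iff:
  assumes "u \<in> L2_space M"
  shows "L2_norm M u = 0 \<longleftrightarrow> (AE x in M. u x = 0)"
proof -
  have "L2_norm M u = 0 \<longleftrightarrow> (\<integral>x. (cmod (u x))\<^sup>2 \<partial>M) = 0" by (simp add: L2_norm_def)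
  also have "\<dots> \<longleftrightarrow> (AE x in M. (cmod (u x))\<^sup>2 = 0)"
    using assms by (intro integral_nonneg_eq_0_iff_AE) (auto dest: L2_spaceD)
  finally show ?thesis by simp
qed

lemma L2_mult_bounded:
  assumes "u \<in> L2_space M" "h \<in> borel_measurable M" "\<And>x. x \<in> space M \<Longrightarrow> cmod (h x) \<le> K"
  shows "(\<lambda>x. h x * u x) \<in> L2_space M" "L2_norm M (\<lambda>x. h x * u x) \<le> \<bar>K\<bar> * L2_norm M u"
proof -
  have le: "(cmod (h x * u x))\<^sup>2 \<le> K\<^sup>2 * (cmod (u x))\<^sup>2" if "x \<in> space M" for x
  proof -
    have "cmod (h x * u x) \<le> K * cmod (u x)" using assms(3)[OF that] by (simp add: norm_mult mult_right_mono)
    then have "(cmod (h x * u x))\<^sup>2 \<le> (K * cmod (u x))\<^sup>2" by (intro power_mono) auto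
    then show ?thesis by (simp add: power_mult_distrib)
  qed
  show 1: "(\<lambda>x. h x * u x) \<in> L2_space M"
    by (rule L2_spaceI[OF _ _ le]) (use assms in \<open>auto dest: L2_spaceD\<close>)
  have "(L2_norm M (\<lambda>x. h x * u x))\<^sup>2 \<le> (\<integral>x. K\<^sup>2 * (cmod (u x))\<^sup>2 \<partial>M)"
    unfolding L2_norm_sq by (rule integral_mono) (use 1 assms le in \<open>auto dest: L2_spaceD\<close>)
  also have "\<dots> = (\<bar>K\<bar> * L2_norm M u)\<^sup>2" by (simp add: L2_norm_sq power_mult_distrib)
  finally show "L2_norm M (\<lambda>x. h x * u x) \<le> \<bar>K\<bar> * L2_norm M u"
    by (rule power2_le_imp_le) simp
qed

text \<open>Weighting the squared increments of a fast Cauchy subsequence by \<open>2^k\<close> turns convergence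
  almost everywhere into a single application of monotone convergence.\<close>

lemma L2_Cauchy_convergent:
  fixes U :: "nat \<Rightarrow> 'a \<Rightarrow> complex"
  assumes U: "\<And>n. U n \<in> L2_space M"
    and C: "\<And>e. e > 0 \<Longrightarrow> \<exists>K. \<forall>m\<ge>K. \<forall>n\<ge>K. L2_norm M (\<lambda>x. U m x - U n x) < e"
  shows "\<exists>l\<in>L2_space M. (\<lambda>n. L2_norm M (\<lambda>x. U n x - l x)) \<longlonglongrightarrow> 0"
proof -
  have Um [measurable]: "U n \<in> borel_measurable M" for n using U by (auto dest: L2_spaceD)
  have "\<exists>K\<ge>k. \<forall>m\<ge>K. \<forall>n\<ge>K. L2_norm M (\<lambda>x. U m x - U n x) < (1/2)^k" for k :: nat
  proof -
    obtain K where "\<forall>m\<ge>K. \<forall>n\<ge>K. L2_norm M (\<lambda>x. U m x - U n x) < (1/2)^k" using C[of "(1/2)^k"] by auto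
    then show ?thesis by (intro exI[of _ "max k K"]) auto
  qed
  then obtain K where Kk: "\<And>k. K k \<ge> k"
    and K: "\<And>k m n. m \<ge> K k \<Longrightarrow> n \<ge> K k \<Longrightarrow> L2_norm M (\<lambda>x. U m x - U n x) < (1/2)^k"
    by metis
  \<comment> \<open>Partial sums make the indices monotone while keeping \<open>R k\<close> beyond
    \<open>K k\<close>, so that both ends of the k-th increment lie in the range where the k-th
    Cauchy bound holds.\<close>
  define R where "R k = (\<Sum>i\<le>k. K i)" for k
  have R: "R k \<ge> K k" "R (Suc k) \<ge> R k" for k
    by (auto simp: R_def intro: member_le_sum)
  define d where "d k x = U (R (Suc k)) x - U (R k) x" for k x
  have dL: "d k \<in> L2_space M" for k unfolding d_def by (intro L2.diff U)
  have dm [measurable]: "d k \<in> borel_measurable M" for k using dL by (auto dest: L2_spaceD)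
  \<comment> \<open>The squared norm of the increment is at most 4^(-k), so the weight 2^k still
    leaves a summable bound.\<close>
  have nn: "(\<integral>\<^sup>+x. ennreal (2^k * (cmod (d k x))\<^sup>2) \<partial>M) \<le> ennreal ((1/2)^k)" for k
  proof -
    have "L2_norm M (d k) \<le> (1/2)^k"
      using K[of k "R (Suc k)" "R k"] R[of k] unfolding d_def by simp
    then have "(L2_norm M (d k))\<^sup>2 \<le> ((1/2)^k)\<^sup>2" by (intro power_mono) auto
    then have "2^k * (L2_norm M (d k))\<^sup>2 \<le> 2^k * ((1/2)^k)\<^sup>2" by (intro mult_left_mono) auto
    also have "\<dots> = (1/2::real)^k" by (simp add: power2_eq_square power_divide)
    finally have "2^k * (L2_norm M (d k))\<^sup>2 \<le> (1/2)^k" .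
    moreover have "(\<integral>\<^sup>+x. ennreal (2^k * (cmod (d k x))\<^sup>2) \<partial>M) = ennreal (2^k * (L2_norm M (d k))\<^sup>2)"
      using dL[of k] by (subst nn_integral_eq_integral) (auto simp: L2_norm_sq dest: L2_spaceD)
    ultimately show ?thesis by (simp add: ennreal_leI)
  qed
  have "(\<integral>\<^sup>+x. (\<Sum>k. ennreal (2^k * (cmod (d k x))\<^sup>2)) \<partial>M) = (\<Sum>k. \<integral>\<^sup>+x. ennreal (2^k * (cmod (d k x))\<^sup>2) \<partial>M)"
    by (rule nn_integral_suminf) measurable
  also have "\<dots> \<le> (\<Sum>k. ennreal ((1/2)^k))" by (intro suminf_le nn) auto
  also have "\<dots> = ennreal (\<Sum>k. (1/2)^k)" by (intro suminf_ennreal2) auto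
  also have "\<dots> < \<infinity>" by simp
  finally have "(\<integral>\<^sup>+x. (\<Sum>k. ennreal (2^k * (cmod (d k x))\<^sup>2)) \<partial>M) \<noteq> \<infinity>" by simp
  then have "AE x in M. (\<Sum>k. ennreal (2^k * (cmod (d k x))\<^sup>2)) \<noteq> \<infinity>"
    by (intro nn_integral_noteq_infinite) auto
  then have conv: "AE x in M. convergent (\<lambda>k. U (R k) x)"
  proof eventually_elim
    case (elim x)
    define s where "s = (\<Sum>k. ennreal (2^k * (cmod (d k x))\<^sup>2))"
    obtain c where c: "0 \<le> c" "s = ennreal c"
      using elim unfolding s_def[symmetric] by (cases s rule: ennreal_cases) auto
    have "(\<Sum>j\<in>{k}. ennreal (2^j * (cmod (d j x))\<^sup>2)) \<le> s" for k
      unfolding s_def by (rule sum_le_suminf) auto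
    then have "ennreal (2^k * (cmod (d k x))\<^sup>2) \<le> ennreal c" for k
      unfolding c(2) by (simp only: sum.insert[OF finite.emptyI] sum.empty empty_iff not_False_eq_True add_0_right)
    then have le: "2^k * (cmod (d k x))\<^sup>2 \<le> c" for k
      using c(1) by (simp only: ennreal_le_iff)
    \<comment> \<open>Each term of the weighted sum is at most its finite value c, and removing the
      weight leaves a geometric bound on the increment itself.\<close>
    have "cmod (d k x) \<le> sqrt c * (sqrt (1/2))^k" for k
    proof (rule power2_le_imp_le)
      have "(cmod (d k x))\<^sup>2 \<le> c * (1/2)^k" using le[of k] by (simp add: field_simps power_divide)
      also have "\<dots> = (sqrt c * (sqrt (1/2))^k)\<^sup>2" using c
        unfolding power_mult_distrib power_even_eq[symmetric] by (simp add: power_mult flip: power_mult_distrib)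
      finally show "(cmod (d k x))\<^sup>2 \<le> (sqrt c * (sqrt (1/2))^k)\<^sup>2" .
    qed (use c in auto)
    note cle = this
    have "summable (\<lambda>k. sqrt c * (sqrt (1/2))^k)"
      by (intro summable_mult summable_geometric) (auto simp: real_sqrt_divide)
    then have "summable (\<lambda>k. d k x)"
      by (rule summable_comparison_test'[where N=0]) (rule cle)
    then have "convergent (\<lambda>n. \<Sum>k<n. d k x)" by (simp add: summable_iff_convergent)
    moreover have "(\<Sum>k<n. d k x) = U (R n) x - U (R 0) x" for n
      unfolding d_def by (rule sum_lessThan_telescope)
    ultimately have "convergent (\<lambda>n. U (R n) x - U (R 0) x)" by (simp only:)
    from convergent_add[OF this convergent_const[of "U (R 0) x"]] show ?case by (simp only: diff_add_cancel)
  qed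
  \<comment> \<open>Where the subsequence diverges, on a null set, \<open>lim\<close> has a fixed
    default value; measurability is thus not disturbed.\<close>
  define l where "l x = lim (\<lambda>k. U (R k) x)" for x
  have lm [measurable]: "l \<in> borel_measurable M" unfolding l_def by measurable
  \<comment> \<open>Norm convergence of the full sequence: n is held fixed while the other index
    runs to infinity along the subsequence \<open>R\<close>.\<close>
  have Fatou: "(\<integral>\<^sup>+x. ennreal ((cmod (U n x - l x))\<^sup>2) \<partial>M) \<le> ennreal (e\<^sup>2)"
    if e: "e > 0" and k0: "\<And>m n. m \<ge> k0 \<Longrightarrow> n \<ge> k0 \<Longrightarrow> L2_norm M (\<lambda>x. U m x - U n x) < e" and n: "n \<ge> k0"
    for n e k0
  proof -
    have "(\<integral>\<^sup>+x. ennreal ((cmod (U n x - l x))\<^sup>2) \<partial>M)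
        = (\<integral>\<^sup>+x. liminf (\<lambda>k. ennreal ((cmod (U n x - U (R k) x))\<^sup>2)) \<partial>M)"
    proof (rule nn_integral_cong_AE)
      show "AE x in M. ennreal ((cmod (U n x - l x))\<^sup>2) = liminf (\<lambda>k. ennreal ((cmod (U n x - U (R k) x))\<^sup>2))"
        using conv
      proof eventually_elim
        case (elim x)
        then have "(\<lambda>k. U (R k) x) \<longlonglongrightarrow> l x" by (simp add: l_def convergent_LIMSEQ_iff)
        then have "(\<lambda>k. ennreal ((cmod (U n x - U (R k) x))\<^sup>2)) \<longlonglongrightarrow> ennreal ((cmod (U n x - l x))\<^sup>2)"
          by (intro tendsto_intros)
        from lim_imp_Liminf[OF trivial_limit_sequentially this] show ?case by (rule sym)
      qed
    qed
    also have "\<dots> \<le> liminf (\<lambda>k. \<integral>\<^sup>+x. ennreal ((cmod (U n x - U (R k) x))\<^sup>2) \<partial>M)"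
      by (rule nn_integral_liminf) measurable
    also have "\<dots> \<le> ennreal (e\<^sup>2)"
    proof (rule Liminf_le)
      have le: "(\<integral>\<^sup>+x. ennreal ((cmod (U n x - U (R k) x))\<^sup>2) \<partial>M) \<le> ennreal (e\<^sup>2)" if k: "k \<ge> k0" for k
      proof -
        have "R k \<ge> k0" using R(1)[of k] Kk[of k] k by linarith
        then have "(L2_norm M (\<lambda>x. U n x - U (R k) x))\<^sup>2 \<le> e\<^sup>2"
          using k0[OF n, of "R k"] by (intro power_mono) auto
        moreover have "(\<integral>\<^sup>+x. ennreal ((cmod (U n x - U (R k) x))\<^sup>2) \<partial>M) = ennreal ((L2_norm M (\<lambda>x. U n x - U (R k) x))\<^sup>2)"
          using L2.diff[OF U U] by (subst nn_integral_eq_integral) (auto simp: L2_norm_sq dest: L2_spaceD)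
        ultimately show ?thesis by (simp add: ennreal_leI)
      qed
      show "\<forall>\<^sub>F k in sequentially. (\<integral>\<^sup>+x. ennreal ((cmod (U n x - U (R k) x))\<^sup>2) \<partial>M) \<le> ennreal (e\<^sup>2)"
        using eventually_ge_at_top[of k0] by eventually_elim (rule le)
    qed simp
    finally show ?thesis .
  qed
  have key: "(\<lambda>x. U n x - l x) \<in> L2_space M \<and> L2_norm M (\<lambda>x. U n x - l x) \<le> e"
    if e: "e > 0" and k0: "\<And>m n. m \<ge> k0 \<Longrightarrow> n \<ge> k0 \<Longrightarrow> L2_norm M (\<lambda>x. U m x - U n x) < e" and n: "n \<ge> k0"
    for n e k0
  proof -
    have F: "(\<integral>\<^sup>+x. ennreal ((cmod (U n x - l x))\<^sup>2) \<partial>M) \<le> ennreal (e\<^sup>2)" by (rule Fatou[OF e k0 n])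
    then have "integrable M (\<lambda>x. (cmod (U n x - l x))\<^sup>2)"
      by (intro integrableI_bounded) (auto intro: order_le_less_trans)
    then have 1: "(\<lambda>x. U n x - l x) \<in> L2_space M" by (simp add: L2_space_def)
    have "(L2_norm M (\<lambda>x. U n x - l x))\<^sup>2 \<le> e\<^sup>2"
      unfolding L2_norm_sq using F by (subst integral_eq_nn_integral) (auto intro!: enn2real_leI)
    with 1 e show ?thesis by (auto intro: power2_le_imp_le)
  qed
  obtain k1 where k1: "\<And>m n. m \<ge> k1 \<Longrightarrow> n \<ge> k1 \<Longrightarrow> L2_norm M (\<lambda>x. U m x - U n x) < 1"
    using C[of 1] by auto
  have "(\<lambda>x. U k1 x - (U k1 x - l x)) \<in> L2_space M"
  proof (rule L2.diff[OF U])
    show "(\<lambda>x. U k1 x - l x) \<in> L2_space M" using key[of 1 k1 k1] k1 by simp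
  qed
  then have "l \<in> L2_space M" by simp
  moreover have "(\<lambda>n. L2_norm M (\<lambda>x. U n x - l x)) \<longlonglongrightarrow> 0"
  proof (rule LIMSEQ_I)
    fix e :: real assume "e > 0"
    then have e2: "e / 2 > 0" by simp
    from C[OF this] obtain k0 where "\<And>m n. m \<ge> k0 \<Longrightarrow> n \<ge> k0 \<Longrightarrow> L2_norm M (\<lambda>x. U m x - U n x) < e / 2" by auto
    from key[OF e2 this] show "\<exists>k0. \<forall>n\<ge>k0. norm (L2_norm M (\<lambda>x. U n x - l x) - 0) < e"
      using \<open>e > 0\<close> by (intro exI[of _ k0]) fastforce
  qed
  ultimately show ?thesis by blast
qed

section \<open>Smooth functions\<close>

lemma dir_deriv_eqI: "(f has_derivative f') (at x) \<Longrightarrow> dir_deriv b f x = f' b"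
  unfolding dir_deriv_def by (metis frechet_derivative_at)

lemma dir_deriv_eqI_vector: "(f has_vector_derivative d) (at x) \<Longrightarrow> dir_deriv (1::real) f x = d"
  unfolding has_vector_derivative_def by (drule dir_deriv_eqI[where b=1]) simp

text \<open>Smoothness quantifies over all lists of directions. A class of differentiable functions
  that is closed under the \<open>Basis\<close> derivatives takes the place of an induction over
  such lists.\<close>

lemma smooth_fun_coinduct:
  assumes "f \<in> X"
    and diff: "\<And>f. f \<in> X \<Longrightarrow> f differentiable_on UNIV"
    and step: "\<And>f b. f \<in> X \<Longrightarrow> b \<in> Basis \<Longrightarrow> dir_deriv b f \<in> X"
  shows "smooth_fun f"
proof -
  have "foldr dir_deriv bs f \<in> X" if "set bs \<subseteq> Basis" for bs
    using that by (induction bs) (auto simp: assms)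
  then show ?thesis using diff by (auto simp: smooth_fun_def)
qed

lemma smooth_fun_differentiable_on: "smooth_fun f \<Longrightarrow> f differentiable_on UNIV"
  unfolding smooth_fun_def by (metis empty_subsetI foldr_Nil id_apply list.set(1))

lemma smooth_fun_has_derivative:
  "smooth_fun f \<Longrightarrow> (f has_derivative frechet_derivative f (at x)) (at x)"
  using smooth_fun_differentiable_on[of f] frechet_derivative_works
  by (auto simp: differentiable_on_def)

lemma smooth_fun_dir_deriv:
  fixes b :: "'a::euclidean_space"
  shows "smooth_fun f \<Longrightarrow> b \<in> Basis \<Longrightarrow> smooth_fun (dir_deriv b f)"
  unfolding smooth_fun_def
proof (intro allI impI)
  fix bs :: "'a list" assume *: "\<forall>bs. set bs \<subseteq> Basis \<longrightarrow> foldr dir_deriv bs f differentiable_on UNIV"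
    and "b \<in> Basis" "set bs \<subseteq> Basis"
  then have "foldr dir_deriv (bs @ [b]) f differentiable_on UNIV" by (intro *[rule_format]) auto
  then show "foldr dir_deriv bs (dir_deriv b f) differentiable_on UNIV" by simp
qed

lemma smooth_fun_continuous_on: "smooth_fun f \<Longrightarrow> continuous_on A f"
  using smooth_fun_differentiable_on[of f] differentiable_imp_continuous_on continuous_on_subset
  by blast

lemma dir_deriv_expand:
  assumes "smooth_fun f"
  shows "dir_deriv z f x = (\<Sum>b\<in>Basis. complex_of_real (z \<bullet> b) * dir_deriv b f x)"
proof -
  interpret linear "frechet_derivative f (at x)"
    using smooth_fun_has_derivative[OF assms] by (rule has_derivative_linear)
  have "dir_deriv z f x = frechet_derivative f (at x) (\<Sum>b\<in>Basis. (z \<bullet> b) *\<^sub>R b)"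
    by (simp add: dir_deriv_def euclidean_representation)
  then show ?thesis by (simp add: sum scale dir_deriv_def scaleR_conv_of_real)
qed

text \<open>Differentiating a product or a composition produces sums of products, so smoothness is shown
  simultaneously for the whole algebra generated by a set \<open>G\<close> whose derivatives stay in it.\<close>

inductive_set smooth_alg :: "('a::euclidean_space \<Rightarrow> complex) set \<Rightarrow> ('a \<Rightarrow> complex) set"
  for G where
  gen: "g \<in> G \<Longrightarrow> g \<in> smooth_alg G"
| const: "(\<lambda>_. c) \<in> smooth_alg G"
| add: "f \<in> smooth_alg G \<Longrightarrow> g \<in> smooth_alg G \<Longrightarrow> (\<lambda>x. f x + g x) \<in> smooth_alg G"
| mult: "f \<in> smooth_alg G \<Longrightarrow> g \<in> smooth_alg G \<Longrightarrow> (\<lambda>x. f x * g x) \<in> smooth_alg G"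

lemma smooth_alg_sum:
  "finite A \<Longrightarrow> (\<And>i. i \<in> A \<Longrightarrow> f i \<in> smooth_alg G) \<Longrightarrow> (\<lambda>x. \<Sum>i\<in>A. f i x) \<in> smooth_alg G"
  by (induction A rule: finite_induct) (auto intro: smooth_alg.intros)

text \<open>Derivatives of generators may land anywhere in the algebra. The chain rule requires
  this: a derivative of an affine composition is a combination of other compositions with constant
  coefficients.\<close>

lemma smooth_alg_smooth:
  assumes G: "\<And>g. g \<in> G \<Longrightarrow> g differentiable_on UNIV"
    and D: "\<And>g b. g \<in> G \<Longrightarrow> b \<in> Basis \<Longrightarrow> dir_deriv b g \<in> smooth_alg G"
    and f: "f \<in> smooth_alg G"
  shows "smooth_fun f"
proof (rule smooth_fun_coinduct[OF f])
  show d: "f differentiable_on UNIV" if "f \<in> smooth_alg G" for f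
    using that by induction (use G in \<open>auto intro!: differentiable_on_add differentiable_on_mult\<close>)
  show "dir_deriv b f \<in> smooth_alg G" if "f \<in> smooth_alg G" and b: "b \<in> Basis" for f b
    using that(1)
  proof induction
    case (const c)
    have "dir_deriv b (\<lambda>_. c) = (\<lambda>_. 0)"
      by (intro ext dir_deriv_eqI[where f'="\<lambda>_. 0", simplified]) auto
    then show ?case by (simp add: smooth_alg.const)
  next
    case (add f g)
    then have "(f has_derivative frechet_derivative f (at x)) (at x)"
      "(g has_derivative frechet_derivative g (at x)) (at x)" for x
      using d[of f] d[of g] frechet_derivative_works by (auto simp: differentiable_on_def)
    from has_derivative_add[OF this]
    have "dir_deriv b (\<lambda>x. f x + g x) = (\<lambda>x. dir_deriv b f x + dir_deriv b g x)"
      by (intro ext, subst dir_deriv_eqI) (auto simp: dir_deriv_def)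
    then show ?case using add by (simp add: smooth_alg.add)
  next
    case (mult f g)
    then have "(f has_derivative frechet_derivative f (at x)) (at x)"
      "(g has_derivative frechet_derivative g (at x)) (at x)" for x
      using d[of f] d[of g] frechet_derivative_works by (auto simp: differentiable_on_def)
    from has_derivative_mult[OF this]
    have "dir_deriv b (\<lambda>x. f x * g x) = (\<lambda>x. f x * dir_deriv b g x + dir_deriv b f x * g x)"
      by (intro ext, subst dir_deriv_eqI) (auto simp: dir_deriv_def)
    then show ?case using mult by (auto intro: smooth_alg.intros)
  qed (use D b in auto)
qed

lemma smooth_alg_smooth_fun: "f \<in> smooth_alg (Collect smooth_fun) \<Longrightarrow> smooth_fun f"
  by (rule smooth_alg_smooth)
     (auto intro: smooth_alg.gen smooth_fun_dir_deriv dest: smooth_fun_differentiable_on)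

lemma smooth_fun_const: "smooth_fun (\<lambda>_. c)"
  by (rule smooth_alg_smooth_fun) (rule smooth_alg.const)

lemma smooth_fun_add: "smooth_fun f \<Longrightarrow> smooth_fun g \<Longrightarrow> smooth_fun (\<lambda>x. f x + g x)"
  by (rule smooth_alg_smooth_fun) (auto intro: smooth_alg.intros)

lemma smooth_fun_mult: "smooth_fun f \<Longrightarrow> smooth_fun g \<Longrightarrow> smooth_fun (\<lambda>x. f x * g x)"
  by (rule smooth_alg_smooth_fun) (auto intro: smooth_alg.intros)

lemma smooth_fun_prod:
  "finite A \<Longrightarrow> (\<And>i. i \<in> A \<Longrightarrow> smooth_fun (f i)) \<Longrightarrow> smooth_fun (\<lambda>x. \<Prod>i\<in>A. f i x)"
  by (induction A rule: finite_induct) (auto intro: smooth_fun_mult smooth_fun_const)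

lemma dir_deriv_add:
  assumes "smooth_fun f" "smooth_fun g"
  shows "dir_deriv b (\<lambda>x. f x + g x) = (\<lambda>x. dir_deriv b f x + dir_deriv b g x)"
  using has_derivative_add[OF smooth_fun_has_derivative[OF assms(1)] smooth_fun_has_derivative[OF assms(2)]]
  by (intro ext, subst dir_deriv_eqI) (auto simp: dir_deriv_def)

lemma dir_deriv_mult:
  assumes "smooth_fun f" "smooth_fun g"
  shows "dir_deriv b (\<lambda>x. f x * g x) = (\<lambda>x. f x * dir_deriv b g x + dir_deriv b f x * g x)"
  using has_derivative_mult[OF smooth_fun_has_derivative[OF assms(1)] smooth_fun_has_derivative[OF assms(2)]]
  by (intro ext, subst dir_deriv_eqI) (auto simp: dir_deriv_def)

lemma dir_deriv_const: "dir_deriv b (\<lambda>_. c) = (\<lambda>_. 0)"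
  by (intro ext dir_deriv_eqI[where f'="\<lambda>_. 0", simplified]) auto

lemma dir_deriv_affine:
  assumes "smooth_fun f" "bounded_linear L"
  shows "dir_deriv b (\<lambda>x. f (L x + t)) = (\<lambda>x. dir_deriv (L b) f (L x + t))"
proof
  fix x
  have "((\<lambda>x. L x + t) has_derivative L) (at x)"
    using assms(2) by (auto intro!: derivative_eq_intros simp: bounded_linear_imp_has_derivative)
  from has_derivative_compose[OF this smooth_fun_has_derivative[OF assms(1)]]
  show "dir_deriv b (\<lambda>x. f (L x + t)) x = dir_deriv (L b) f (L x + t)"
    by (subst dir_deriv_eqI) (auto simp: dir_deriv_def)
qed

lemma smooth_fun_affine:
  assumes f: "smooth_fun f" and L: "bounded_linear L"
  shows "smooth_fun (\<lambda>x. f (L x + t))"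
proof -
  let ?G = "(\<lambda>f x. f (L x + t)) ` Collect smooth_fun"
  have mem: "(\<lambda>x. h (L x + t)) \<in> ?G" if "smooth_fun h" for h
    using that by (intro image_eqI[where x=h]) auto
  show ?thesis
  proof (rule smooth_alg_smooth[of ?G])
    fix g assume "g \<in> ?G"
    then obtain f where g: "g = (\<lambda>x. f (L x + t))" and f: "smooth_fun f" by auto
    have "((\<lambda>x. L x + t) has_derivative L) (at x)" for x
      using L by (auto intro!: derivative_eq_intros simp: bounded_linear_imp_has_derivative)
    from has_derivative_compose[OF this smooth_fun_has_derivative[OF f]]
    show "g differentiable_on UNIV"
      unfolding g differentiable_on_def differentiable_def by blast
    have "dir_deriv b g = (\<lambda>x. \<Sum>b'\<in>Basis. complex_of_real (L b \<bullet> b') * dir_deriv b' f (L x + t))" for b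
      unfolding g dir_deriv_affine[OF f L] using dir_deriv_expand[OF f, of "L b"] by auto
    then show "dir_deriv b g \<in> smooth_alg ?G" for b
      by (simp only:) (rule smooth_alg_sum[OF finite_Basis],
          rule smooth_alg.mult[OF smooth_alg.const smooth_alg.gen[OF mem[OF smooth_fun_dir_deriv[OF f]]]])
  next
    show "(\<lambda>x. f (L x + t)) \<in> smooth_alg ?G" by (intro smooth_alg.gen mem f)
  qed
qed

lemma dir_deriv_cnj:
  assumes "smooth_fun f"
  shows "dir_deriv b (\<lambda>x. cnj (f x)) = (\<lambda>x. cnj (dir_deriv b f x))"
  using has_derivative_cnj[OF smooth_fun_has_derivative[OF assms(1)]]
  by (intro ext, subst dir_deriv_eqI) (auto simp: dir_deriv_def)

lemma smooth_fun_cnj: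
  assumes "smooth_fun f"
  shows "smooth_fun (\<lambda>x. cnj (f x))"
proof (rule smooth_fun_coinduct[where X="{\<lambda>x. cnj (f x) | f. smooth_fun f}"])
  fix g assume "g \<in> {\<lambda>x. cnj (f x) | f. smooth_fun f}"
  then obtain f where g: "g = (\<lambda>x. cnj (f x))" and f: "smooth_fun f" by auto
  show "g differentiable_on UNIV"
    unfolding g differentiable_on_def differentiable_def
    using has_derivative_cnj[OF smooth_fun_has_derivative[OF f]] by blast
  show "dir_deriv b g \<in> {\<lambda>x. cnj (f x) | f. smooth_fun f}" if "b \<in> Basis" for b
    unfolding g dir_deriv_cnj[OF f] using smooth_fun_dir_deriv[OF f that] by blast
qed (use assms in auto)

lemma exp_ik_derivative:
  "((\<lambda>s::real. c * exp (\<i> * of_real (k * s))) has_vector_derivative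
     (c * \<i> * of_real k) * exp (\<i> * of_real (k * s))) (at s)"
proof -
  have "((\<lambda>z. c * exp (\<i> * (of_real k * z))) has_field_derivative
      (c * \<i> * of_real k) * exp (\<i> * of_real (k * s))) (at (complex_of_real s))"
    by (auto intro!: derivative_eq_intros)
  from has_vector_derivative_real_field[OF this] show ?thesis by (simp add: o_def)
qed

lemma smooth_fun_exp_ik: "smooth_fun (\<lambda>s::real. exp (\<i> * of_real (k * s)))"
proof (rule smooth_fun_coinduct[where X="{\<lambda>s::real. c * exp (\<i> * of_real (k * s)) | c. True}"])
  fix f :: "real \<Rightarrow> complex" and b :: real
  assume "f \<in> {\<lambda>s. c * exp (\<i> * of_real (k * s)) | c. True}"
  then obtain c where f: "f = (\<lambda>s. c * exp (\<i> * of_real (k * s)))" by auto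
  show "f differentiable_on UNIV" unfolding f differentiable_on_def differentiable_def
    using exp_ik_derivative[unfolded has_vector_derivative_def] by blast
  assume "b \<in> Basis"
  then have "dir_deriv b f = (\<lambda>s. (c * \<i> * of_real k) * exp (\<i> * of_real (k * s)))"
    using dir_deriv_eqI_vector[OF exp_ik_derivative] by (auto simp: f)
  then show "dir_deriv b f \<in> {\<lambda>s. c * exp (\<i> * of_real (k * s)) | c. True}" by auto
qed (auto intro: exI[of _ 1])

subsection \<open>Bump functions\<close>

text \<open>The functions \<open>flat p\<close> form a family closed under differentiation that contains \<open>bump\<close>.\<close>

definition flat :: "real poly \<Rightarrow> real \<Rightarrow> real" where
  "flat p t = (if t > 0 then poly p (1 / t) * exp (- 1 / t) else 0)"

lemma poly_times_exp_minus_tendsto: "((\<lambda>y. poly p y * exp (- y)) \<longlongrightarrow> (0::real)) at_top"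
proof -
  have "((\<lambda>y. \<Sum>i\<le>degree p. coeff p i * (y ^ i / exp y)) \<longlongrightarrow> (\<Sum>i\<le>degree p. coeff p i * 0)) at_top"
    by (intro tendsto_intros tendsto_power_div_exp_0)
  then show ?thesis
    by (simp add: poly_altdef sum_distrib_right exp_minus divide_inverse mult.assoc)
qed

text \<open>With y = 1 / t the derivative of p(y) exp(-y) is y^2 (p(y) - p'(y)) exp(-y), which
  explains the new polynomial. At 0 the right difference quotient is y p(y) exp(-y) with y tending
  to infinity.\<close>

lemma flat_derivative: "(flat p has_field_derivative flat ([:0,0,1:] * (p - pderiv p)) t) (at t)"
proof -
  consider "t > 0" | "t < 0" | "t = 0" by linarith
  then show ?thesis
  proof cases
    case 1
    have "((\<lambda>t. poly p (1 / t) * exp (- 1 / t)) has_field_derivative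
        flat ([:0,0,1:] * (p - pderiv p)) t) (at t)"
      using 1
      by (auto intro!: derivative_eq_intros simp: flat_def power2_eq_square field_simps)
    then show ?thesis
      by (rule has_field_derivative_transform_within_open[where S="{0<..}"]) (use 1 in \<open>auto simp: flat_def\<close>)
  next
    case 2
    have "((\<lambda>t. 0) has_field_derivative flat ([:0,0,1:] * (p - pderiv p)) t) (at t)"
      using 2 by (auto simp: flat_def)
    then show ?thesis
      by (rule has_field_derivative_transform_within_open[where S="{..<0}"]) (use 2 in \<open>auto simp: flat_def\<close>)
  next
    case 3
    have "((\<lambda>h. flat p h / h) \<longlongrightarrow> 0) (at 0)"
    proof (rule filterlim_split_at)
      show "((\<lambda>h. flat p h / h) \<longlongrightarrow> 0) (at_left 0)"
        by (rule tendsto_eventually) (auto simp: flat_def eventually_at_filter)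
      have "((\<lambda>h. poly ([:0,1:] * p) (inverse h) * exp (- inverse h)) \<longlongrightarrow> 0) (at_right (0::real))"
        by (rule filterlim_compose[OF poly_times_exp_minus_tendsto filterlim_inverse_at_top_right])
      then show "((\<lambda>h. flat p h / h) \<longlongrightarrow> 0) (at_right 0)"
        by (rule Lim_transform_eventually)
           (auto simp: flat_def eventually_at_filter field_simps intro!: always_eventually)
    qed
    then show ?thesis using 3 by (simp add: DERIV_def flat_def)
  qed
qed

definition bump :: "real \<Rightarrow> real" where
  "bump t = (if t > 0 then exp (- 1 / t) else 0)"

lemma smooth_fun_bump: "smooth_fun (\<lambda>t. complex_of_real (bump t))"
proof (rule smooth_fun_coinduct[where X="{\<lambda>t. complex_of_real (flat p t) | p. True}"])
  have "bump = flat 1" by (auto simp: bump_def flat_def)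
  then show "(\<lambda>t. complex_of_real (bump t)) \<in> {\<lambda>t. complex_of_real (flat p t) | p. True}"
    by (intro CollectI exI[of _ 1]) simp
next
  fix f :: "real \<Rightarrow> complex" and b :: real
  assume "f \<in> {\<lambda>t. complex_of_real (flat p t) | p. True}"
  then obtain p where f: "f = (\<lambda>t. complex_of_real (flat p t))" by auto
  have d: "(f has_vector_derivative complex_of_real (flat ([:0,0,1:] * (p - pderiv p)) t)) (at t)" for t
    unfolding f using flat_derivative[of p t]
    by (intro has_vector_derivative_of_real) (simp add: has_real_derivative_iff_has_vector_derivative)
  then show "f differentiable_on UNIV" unfolding differentiable_on_def differentiable_def has_vector_derivative_def
    by blast
  assume "b \<in> Basis"
  then have "dir_deriv b f = (\<lambda>t. complex_of_real (flat ([:0,0,1:] * (p - pderiv p)) t))"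
    using dir_deriv_eqI_vector[OF d] by auto
  then show "dir_deriv b f \<in> {\<lambda>t. complex_of_real (flat p t) | p. True}" by blast
qed

text \<open>The parameter n governs the steepness of the flanks only. For n > 0 the function is
  positive exactly on the open box, and along the positive integers n it tends to the indicator of
  that box, so that integrals over boxes become limits of integrals against test functions.\<close>

definition box_bump :: "'a::euclidean_space \<Rightarrow> 'a \<Rightarrow> real \<Rightarrow> 'a \<Rightarrow> real" where
  "box_bump a c n x = (\<Prod>b\<in>Basis. bump (n * ((x - a) \<bullet> b)) * bump (n * ((c - x) \<bullet> b)))"

lemma smooth_fun_box_bump: "smooth_fun (\<lambda>x. complex_of_real (box_bump a c n x))"
proof -
  have "smooth_fun (\<lambda>x. complex_of_real (bump ((n *\<^sub>R b) \<bullet> x + (- n * (a \<bullet> b)))) *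
          complex_of_real (bump ((- n *\<^sub>R b) \<bullet> x + n * (c \<bullet> b))))" for b
    by (intro smooth_fun_mult smooth_fun_affine[OF smooth_fun_bump] bounded_linear_inner_right)
  moreover have "(n *\<^sub>R b) \<bullet> x + (- n * (a \<bullet> b)) = n * ((x - a) \<bullet> b)"
     "(- n *\<^sub>R b) \<bullet> x + n * (c \<bullet> b) = n * ((c - x) \<bullet> b)" for b x
    by (simp_all add: inner_diff_left inner_commute algebra_simps)
  ultimately have "smooth_fun (\<lambda>x. complex_of_real (bump (n * ((x - a) \<bullet> b))) *
          complex_of_real (bump (n * ((c - x) \<bullet> b))))" for b
    by simp
  then show ?thesis unfolding box_bump_def of_real_prod of_real_mult
    by (intro smooth_fun_prod) auto
qed

lemma bump_bounds: "0 \<le> bump t" "bump t \<le> 1"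
  by (auto simp: bump_def)

lemma box_bump_bounds: "0 \<le> box_bump a c n x" "box_bump a c n x \<le> 1"
  unfolding box_bump_def using bump_bounds by (auto intro!: prod_nonneg prod_le_1 mult_le_one)

lemma box_bump_pos_iff: "n > 0 \<Longrightarrow> 0 < box_bump a c n x \<longleftrightarrow> x \<in> box a c"
proof -
  assume n: "n > 0"
  have p: "0 < bump t \<longleftrightarrow> 0 < t" for t by (simp add: bump_def)
  have "0 < box_bump a c n x \<longleftrightarrow> (\<forall>b\<in>Basis. bump (n * ((x - a) \<bullet> b)) * bump (n * ((c - x) \<bullet> b)) \<noteq> 0)"
    using box_bump_bounds(1)[of a c n x] unfolding box_bump_def by (auto simp: order_less_le)
  also have "\<dots> \<longleftrightarrow> (\<forall>b\<in>Basis. 0 < n * ((x - a) \<bullet> b) \<and> 0 < n * ((c - x) \<bullet> b))"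
    using p bump_bounds(1) by (metis mult_eq_0_iff order_less_le)
  also have "\<dots> \<longleftrightarrow> x \<in> box a c" using n by (auto simp: mem_box inner_diff_left zero_less_mult_iff)
  finally show ?thesis .
qed

lemma bump_scaled_tendsto: "(\<lambda>n. bump (real (Suc n) * t)) \<longlonglongrightarrow> indicator {0<..} t"
proof (cases "t > 0")
  case True
  have "(\<lambda>n. exp (- (inverse (real (Suc n)) * inverse t))) \<longlonglongrightarrow> exp (- (0 * inverse t))"
    by (intro tendsto_intros LIMSEQ_inverse_real_of_nat)
  then show ?thesis using True by (simp add: bump_def divide_inverse)
next
  case False
  then have "\<not> 0 < real (Suc n) * t" for n by (simp add: zero_less_mult_iff del: of_nat_Suc)
  then show ?thesis using False by (simp add: bump_def)
qed

lemma box_bump_tendsto: "(\<lambda>n. box_bump a c (real (Suc n)) x) \<longlonglongrightarrow> indicator (box a c) x"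
proof -
  have "(\<lambda>n. box_bump a c (real (Suc n)) x) \<longlonglongrightarrow>
     (\<Prod>b\<in>Basis. indicator {0<..} ((x - a) \<bullet> b) * indicator {0<..} ((c - x) \<bullet> b))"
    unfolding box_bump_def by (intro tendsto_intros bump_scaled_tendsto)
  also have "(\<Prod>b\<in>Basis. indicator {0<..} ((x - a) \<bullet> b) * indicator {0<..} ((c - x) \<bullet> b)) = (indicator (box a c) x :: real)"
  proof (cases "x \<in> box a c")
    case True
    then show ?thesis by (simp add: mem_box inner_diff_left)
  next
    case False
    then obtain b where "b \<in> Basis" "indicator {0<..} ((x - a) \<bullet> b) * indicator {0<..} ((c - x) \<bullet> b) = (0::real)"
      by (auto simp: mem_box inner_diff_left indicator_def)
    then show ?thesis using False by (auto intro!: prod_zero)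
  qed
  finally show ?thesis .
qed

subsection \<open>Test functions\<close>

lemma zero_outside_closure: "x \<notin> closure {x. f x \<noteq> 0} \<Longrightarrow> f x = 0"
  using closure_subset[of "{x. f x \<noteq> 0}"] by auto

lemma test_functionsD:
  assumes "\<phi> \<in> test_functions S"
  shows "smooth_fun \<phi>" "compact (closure {x. \<phi> x \<noteq> 0})" "closure {x. \<phi> x \<noteq> 0} \<subseteq> S"
  using assms by (auto simp: test_functions_def)

lemma test_functionsI:
  assumes "smooth_fun \<phi>" "compact K" "K \<subseteq> S" "\<And>x. x \<notin> K \<Longrightarrow> \<phi> x = 0"
  shows "\<phi> \<in> test_functions S"
proof -
  have 1: "closure {x. \<phi> x \<noteq> 0} \<subseteq> K" by (rule closure_minimal) (use assms compact_imp_closed in auto)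
  have "compact (K \<inter> closure {x. \<phi> x \<noteq> 0})" by (intro compact_Int_closed assms) simp
  moreover have "K \<inter> closure {x. \<phi> x \<noteq> 0} = closure {x. \<phi> x \<noteq> 0}" using 1 by blast
  ultimately show ?thesis using assms 1 by (simp add: test_functions_def)
qed

lemma test_function_zero: "\<phi> \<in> test_functions S \<Longrightarrow> x \<notin> S \<Longrightarrow> \<phi> x = 0"
  using closure_subset[of "{x. \<phi> x \<noteq> 0}"] by (auto simp: test_functions_def)

lemma test_functions_dir_deriv:
  assumes "\<phi> \<in> test_functions S" "b \<in> Basis"
  shows "dir_deriv b \<phi> \<in> test_functions S"
proof (rule test_functionsI)
  let ?K = "closure {x. \<phi> x \<noteq> 0}"
  show "dir_deriv b \<phi> x = 0" if "x \<notin> ?K" for x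
  proof -
    have "(\<phi> has_derivative (\<lambda>_. 0)) (at x)"
    proof (rule has_derivative_transform_within_open[OF has_derivative_const])
      show "open (- ?K)" "x \<in> - ?K" using that by auto
      show "0 = \<phi> y" if "y \<in> - ?K" for y using that zero_outside_closure[of y \<phi>] by simp
    qed
    from dir_deriv_eqI[OF this] show ?thesis .
  qed
qed (rule smooth_fun_dir_deriv test_functionsD assms)+

lemma test_functions_lin:
  assumes "\<phi> \<in> test_functions S" "\<psi> \<in> test_functions S"
  shows "(\<lambda>x. \<phi> x + c * \<psi> x) \<in> test_functions S"
proof (rule test_functionsI)
  show "smooth_fun (\<lambda>x. \<phi> x + c * \<psi> x)"
    by (rule smooth_fun_add smooth_fun_mult smooth_fun_const
        test_functionsD(1)[OF assms(1)] test_functionsD(1)[OF assms(2)])+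
  show "compact (closure {x. \<phi> x \<noteq> 0} \<union> closure {x. \<psi> x \<noteq> 0})"
    "closure {x. \<phi> x \<noteq> 0} \<union> closure {x. \<psi> x \<noteq> 0} \<subseteq> S"
    by (rule compact_Un Un_least test_functionsD[OF assms(1)] test_functionsD[OF assms(2)])+
  show "\<phi> x + c * \<psi> x = 0" if "x \<notin> closure {x. \<phi> x \<noteq> 0} \<union> closure {x. \<psi> x \<noteq> 0}" for x
  proof -
    have "\<phi> x = 0" "\<psi> x = 0" using that by (auto intro: zero_outside_closure)
    then show ?thesis by simp
  qed
qed

lemma test_functions_mult:
  assumes "\<phi> \<in> test_functions S" "smooth_fun f"
  shows "(\<lambda>x. \<phi> x * f x) \<in> test_functions S"
proof (rule test_functionsI)
  show "\<phi> x * f x = 0" if "x \<notin> closure {x. \<phi> x \<noteq> 0}" for x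
    using zero_outside_closure[OF that] by simp
qed (rule smooth_fun_mult test_functionsD(1)[OF assms(1)] test_functionsD(2)[OF assms(1)]
  test_functionsD(3)[OF assms(1)] assms)+

lemma test_functions_cnj:
  assumes "\<phi> \<in> test_functions S"
  shows "(\<lambda>x. cnj (\<phi> x)) \<in> test_functions S"
  using assms smooth_fun_cnj by (auto simp: test_functions_def)

lemma test_functions_box_bump:
  assumes "cbox a c \<subseteq> S" "n > 0"
  shows "(\<lambda>x. complex_of_real (box_bump a c n x)) \<in> test_functions S"
proof (rule test_functionsI[OF smooth_fun_box_bump compact_cbox assms(1)])
  fix x assume "x \<notin> cbox a c"
  then have "\<not> 0 < box_bump a c n x" using box_bump_pos_iff[OF assms(2)] box_subset_cbox by blast
  then show "complex_of_real (box_bump a c n x) = 0" using box_bump_bounds(1)[of a c n x] by simp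
qed

lemma test_functions_integrable:
  fixes \<phi> :: "'a::euclidean_space \<Rightarrow> complex"
  assumes "\<phi> \<in> test_functions S"
  shows "integrable lborel \<phi>"
proof -
  let ?K = "closure {x. \<phi> x \<noteq> 0}"
  have "integrable lborel (\<lambda>x. indicator ?K x *\<^sub>R \<phi> x)"
    using assms by (intro borel_integrable_compact smooth_fun_continuous_on) (auto dest: test_functionsD)
  moreover have "indicator ?K x *\<^sub>R \<phi> x = \<phi> x" for x
    using zero_outside_closure[of x \<phi>] by (cases "x \<in> ?K") simp_all
  ultimately show ?thesis by simp
qed

section \<open>Integration over open sets\<close>

lemma integral_leb_on:
  fixes f :: "'a::euclidean_space \<Rightarrow> 'b::{banach, second_countable_topology}"
  assumes "open S"
  shows "(\<integral>x. f x \<partial>leb_on S) = (\<integral>x. indicator S x *\<^sub>R f x \<partial>lborel)"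
  using assms by (simp add: integral_restrict_space)

lemma integrable_leb_on:
  fixes f :: "'a::euclidean_space \<Rightarrow> 'b::{banach, second_countable_topology}"
  assumes "open S"
  shows "integrable (leb_on S) f \<longleftrightarrow> integrable lborel (\<lambda>x. indicator S x *\<^sub>R f x)"
  using assms by (simp add: integrable_restrict_space)

lemma measurable_leb_on:
  fixes f :: "'a::euclidean_space \<Rightarrow> 'b::{real_normed_vector}"
  assumes "open S"
  shows "f \<in> borel_measurable (leb_on S) \<longleftrightarrow> (\<lambda>x. indicator S x *\<^sub>R f x) \<in> borel_measurable borel"
  using assms by (simp add: borel_measurable_restrict_space_iff)

lemma AE_leb_on:
  assumes "open S"
  shows "(AE x in leb_on S. Q x) \<longleftrightarrow> (AE x in lborel. x \<in> S \<longrightarrow> Q x)"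
  using assms by (simp add: AE_restrict_space_iff)

lemma L2_leb_on_iff:
  assumes "open S"
  shows "u \<in> L2_space (leb_on S) \<longleftrightarrow> (\<lambda>x. indicator S x *\<^sub>R u x) \<in> L2_space lborel"
proof -
  have "(cmod (indicator S x *\<^sub>R u x))\<^sup>2 = indicator S x *\<^sub>R (cmod (u x))\<^sup>2" for x
    by (cases "x \<in> S") auto
  then show ?thesis
    by (simp add: L2_space_def measurable_leb_on[OF assms] integrable_leb_on[OF assms])
qed

lemma integrable_translate:
  fixes f :: "'a::euclidean_space \<Rightarrow> 'b::{banach, second_countable_topology}"
  assumes "integrable lborel f"
  shows "integrable lborel (\<lambda>x. f (x + t))" "(\<integral>x. f (x + t) \<partial>lborel) = (\<integral>x. f x \<partial>lborel)"
proof -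
  have m: "f \<in> borel_measurable borel" using assms by simp
  have d: "distr lborel borel (\<lambda>x. x + t) = lborel"
    unfolding add.commute[of _ t] by (rule lborel_distr_plus)
  have "integrable (distr lborel borel (\<lambda>x. x + t)) f" using assms by (simp add: d)
  then show "integrable lborel (\<lambda>x. f (x + t))" by (subst (asm) integrable_distr_eq) (use m in auto)
  have "(\<integral>x. f x \<partial>distr lborel borel (\<lambda>x. x + t)) = (\<integral>x. f (x + t) \<partial>lborel)"
    by (rule integral_distr) (use m in auto)
  then show "(\<integral>x. f (x + t) \<partial>lborel) = (\<integral>x. f x \<partial>lborel)" by (simp add: d)
qed

text \<open>Translations preserve the integral, hence so does averaging over the translates along a
  segment. Combined with \<open>segment_FTC\<close> it trades increments of a function for its
  derivative under an integral over the whole space.\<close>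

lemma integral_segment_average:
  fixes f :: "'a::euclidean_space \<Rightarrow> 'b::{banach, second_countable_topology}" and t :: 'a
  assumes f: "integrable lborel f"
  defines "F \<equiv> \<lambda>(s::real) x. indicator {0..1} s *\<^sub>R f (x + s *\<^sub>R t)"
  shows "integrable lborel (\<lambda>x. \<integral>s. F s x \<partial>lborel)" (is ?int)
    and "(\<integral>x. (\<integral>s. F s x \<partial>lborel) \<partial>lborel) = (\<integral>x. f x \<partial>lborel)" (is ?eq)
proof -
  have [measurable]: "f \<in> borel_measurable borel" using f by simp
  have I: "integrable (lborel \<Otimes>\<^sub>M lborel) (case_prod F)"
  proof (rule lborel_pair.Fubini_integrable)
    show "case_prod F \<in> borel_measurable (lborel \<Otimes>\<^sub>M lborel)"
      unfolding F_def by measurable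
    have "(\<integral>x. norm (case_prod F (s, x)) \<partial>lborel) = indicator {0..1} s *\<^sub>R (\<integral>x. norm (f x) \<partial>lborel)" for s
      using integrable_translate(2)[OF integrable_norm[OF f], of "s *\<^sub>R t"] by (simp add: F_def)
    then show "integrable lborel (\<lambda>s. \<integral>x. norm (case_prod F (s, x)) \<partial>lborel)" by simp
    show "AE s in lborel. integrable lborel (\<lambda>x. case_prod F (s, x))"
      using integrable_translate(1)[OF f] by (auto simp: F_def)
  qed
  show ?int using lborel_pair.integrable_snd[OF I] .
  have "(\<integral>x. (\<integral>s. F s x \<partial>lborel) \<partial>lborel) = (\<integral>s. (\<integral>x. F s x \<partial>lborel) \<partial>lborel)"
    using lborel_pair.Fubini_integral[OF I] .
  also have "\<dots> = (\<integral>s. indicator {0..1::real} s *\<^sub>R (\<integral>x. f x \<partial>lborel) \<partial>lborel)"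
    by (simp add: F_def integrable_translate(2)[OF f])
  also have "\<dots> = (\<integral>x. f x \<partial>lborel)" by simp
  finally show ?eq .
qed

lemma segment_FTC:
  assumes "smooth_fun f"
  shows "f (x + t) - f x = (\<integral>s. indicator {0..1::real} s *\<^sub>R dir_deriv t f (x + s *\<^sub>R t) \<partial>lborel)"
proof -
  have 1: "((\<lambda>s. f (x + s *\<^sub>R t)) has_vector_derivative dir_deriv t f (x + s *\<^sub>R t)) (at s within {0..1})" for s :: real
  proof -
    have "((\<lambda>s. x + s *\<^sub>R t) has_derivative (\<lambda>s. s *\<^sub>R t)) (at s within {0..1})"
      by (auto intro!: derivative_eq_intros)
    from has_derivative_compose[OF this smooth_fun_has_derivative[OF assms]]
    have "((\<lambda>s. f (x + s *\<^sub>R t)) has_derivative (\<lambda>h. frechet_derivative f (at (x + s *\<^sub>R t)) (h *\<^sub>R t))) (at s within {0..1})" .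
    moreover have "frechet_derivative f (at (x + s *\<^sub>R t)) (h *\<^sub>R t) = h *\<^sub>R dir_deriv t f (x + s *\<^sub>R t)" for h
      unfolding dir_deriv_def using has_derivative_linear[OF smooth_fun_has_derivative[OF assms]] linear_scale by blast
    ultimately show ?thesis by (simp add: has_vector_derivative_def)
  qed
  have "continuous_on UNIV (dir_deriv t f)"
  proof -
    have "dir_deriv t f = (\<lambda>x. \<Sum>b\<in>Basis. complex_of_real (t \<bullet> b) * dir_deriv b f x)"
      using dir_deriv_expand[OF assms, of t] by auto
    moreover have "continuous_on UNIV (\<lambda>x. \<Sum>b\<in>Basis. complex_of_real (t \<bullet> b) * dir_deriv b f x)"
      by (intro continuous_intros smooth_fun_continuous_on smooth_fun_dir_deriv assms)
    ultimately show ?thesis by simp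
  qed
  then have 2: "continuous_on {0..1} (\<lambda>s. dir_deriv t f (x + s *\<^sub>R t))"
    by (rule continuous_on_compose2) (auto intro!: continuous_intros)
  show ?thesis using integral_FTC_Icc[OF _ 1 2] by simp
qed

text \<open>The average of the derivative along the segments from x to x + b is an increment, and
  the integral of an increment is a difference of two equal translates. Applied to a product this is
  integration by parts.\<close>

lemma integral_dir_deriv_zero:
  assumes "\<phi> \<in> test_functions S" "b \<in> Basis"
  shows "(\<integral>x. dir_deriv b \<phi> x \<partial>lborel) = 0"
proof -
  have i: "integrable lborel \<phi>" "integrable lborel (dir_deriv b \<phi>)"
    using test_functions_integrable test_functions_dir_deriv assms by blast+
  have "(\<integral>x. dir_deriv b \<phi> x \<partial>lborel)
     = (\<integral>x. (\<integral>s. indicator {0..1::real} s *\<^sub>R dir_deriv b \<phi> (x + s *\<^sub>R b) \<partial>lborel) \<partial>lborel)"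
    using integral_segment_average(2)[OF i(2), of b] by simp
  also have "\<dots> = (\<integral>x. \<phi> (x + b) - \<phi> x \<partial>lborel)"
    using segment_FTC[OF test_functionsD(1)[OF assms(1)], of _ b] by simp
  also have "\<dots> = 0" using integrable_translate[OF i(1), of b] i(1) by simp
  finally show ?thesis .
qed

text \<open>Open boxes form an intersection-stable generator of the Borel sets, and the sets over
  which f integrates to zero are closed under complements and countable disjoint unions.\<close>

lemma integral_zero_boxes_imp_AE_zero:
  fixes f :: "'a::euclidean_space \<Rightarrow> complex"
  assumes f: "integrable lborel f"
    and box: "\<And>a b. (\<integral>x. indicator (box a b) x *\<^sub>R f x \<partial>lborel) = 0"
  shows "AE x in lborel. f x = 0"
proof (rule sigma_finite_measure.density_zero[OF sigma_finite_lborel f])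
  fix A :: "'a set" assume "A \<in> sets lborel"
  then have A: "A \<in> sigma_sets UNIV (range (\<lambda>(a, b). box a b))" by (simp add: borel_eq_box)
  have "Int_stable (range (\<lambda>(a, b). box a b :: 'a set))"
    by (auto simp: Int_stable_def box_Int_box)
  moreover have "range (\<lambda>(a, b). box a b :: 'a set) \<subseteq> Pow UNIV" by auto
  ultimately show "set_lebesgue_integral lborel A f = 0"
    using A
  proof (induction rule: sigma_sets_induct_disjoint)
    case (basic A)
    then show ?case using box by (auto simp: set_lebesgue_integral_def)
  next
    case empty
    then show ?case by (simp add: set_lebesgue_integral_def)
  next
    case (compl A)
    then have A: "A \<in> sets borel" by (simp add: borel_eq_box)
    \<comment> \<open>Complements require that the integral over the whole space vanishes; it is the
      limit of the integrals over these exhausting boxes.\<close>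
    let ?B = "\<lambda>n::nat. box (- (real n *\<^sub>R One)) (real n *\<^sub>R One) :: 'a set"
    have "(\<lambda>n. set_lebesgue_integral lborel (?B n) f) \<longlonglongrightarrow> set_lebesgue_integral lborel (\<Union>n. ?B n) f"
    proof (rule set_integral_cont_up)
      show "incseq ?B" by (fastforce simp: incseq_def mem_box inner_minus_left)
      show "set_integrable lborel (\<Union>n. ?B n) f"
        unfolding UN_box_eq_UNIV using f by (simp add: set_integrable_def)
    qed auto
    then have "(\<integral>x. f x \<partial>lborel) = 0"
      unfolding UN_box_eq_UNIV using box by (simp add: set_lebesgue_integral_def LIMSEQ_const_iff)
    moreover have "(\<integral>x. indicator (UNIV - A) x *\<^sub>R f x \<partial>lborel) = (\<integral>x. f x - indicator A x *\<^sub>R f x \<partial>lborel)"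
      by (intro Bochner_Integration.integral_cong) (auto simp: indicator_def)
    moreover have "\<dots> = (\<integral>x. f x \<partial>lborel) - (\<integral>x. indicator A x *\<^sub>R f x \<partial>lborel)"
      by (intro Bochner_Integration.integral_diff f integrable_mult_indicator) (use A in auto)
    ultimately show ?case using compl by (simp add: set_lebesgue_integral_def)
  next
    case (union A)
    then have A: "A i \<in> sets borel" for i by (simp add: borel_eq_box subset_eq)
    have "set_integrable lborel (\<Union>i. A i) f"
      unfolding set_integrable_def by (intro integrable_mult_indicator f) (use A in auto)
    then have "set_lebesgue_integral lborel (\<Union>i. A i) f = (\<Sum>i. set_lebesgue_integral lborel (A i) f)"
      by (intro lebesgue_integral_countable_add) (use A union in \<open>auto simp: disjoint_family_on_def\<close>)
    then show ?case using union by simp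
  qed
qed

lemma integrable_L2_indicator:
  assumes S: "open S" and h: "h \<in> L2_space (leb_on S)" and K: "K \<subseteq> S" "K \<in> sets borel" "emeasure lborel K < \<infinity>"
  shows "integrable lborel (\<lambda>x. indicator K x *\<^sub>R h x)"
proof (rule Bochner_Integration.integrable_bound)
  let ?H = "\<lambda>x. indicator S x *\<^sub>R h x"
  have H: "?H \<in> L2_space lborel" using L2_leb_on_iff[OF S] h by simp
  show "integrable lborel (\<lambda>x. indicator K x + (cmod (?H x))\<^sup>2)"
    using L2_spaceD(2)[OF H] K by (intro Bochner_Integration.integrable_add) auto
  have m: "?H \<in> borel_measurable borel" using L2_spaceD(1)[OF H] by simp
  have "(\<lambda>x. indicator K x *\<^sub>R h x) = (\<lambda>x. indicator K x *\<^sub>R ?H x)"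
    using K(1) by (auto simp: fun_eq_iff indicator_def)
  then show "(\<lambda>x. indicator K x *\<^sub>R h x) \<in> borel_measurable lborel"
    using borel_measurable_scaleR[OF borel_measurable_indicator[OF K(2)] m] by simp
  have "norm (indicator K x *\<^sub>R h x) \<le> norm (indicator K x + (cmod (?H x))\<^sup>2)" for x
  proof (cases "x \<in> K")
    case True
    have "0 \<le> (cmod (h x) - 1)\<^sup>2" by simp
    then have "2 * cmod (h x) \<le> 1 + (cmod (h x))\<^sup>2" by (simp add: power2_diff)
    then have "cmod (h x) \<le> 1 + (cmod (h x))\<^sup>2" using norm_ge_zero[of "h x"] by linarith
    then show ?thesis using True K(1) by auto
  qed auto
  then show "AE x in lborel. norm (indicator K x *\<^sub>R h x) \<le> norm (indicator K x + (cmod (?H x))\<^sup>2)" by simp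
qed

text \<open>Bump functions turn the hypothesis into vanishing integrals over boxes whose closure
  lies in S. This determines h on each such box, and countably many of them cover S.\<close>

theorem fundamental_lemma_variations:
  assumes S: "open S" and h: "h \<in> L2_space (leb_on S)"
    and z: "\<And>\<phi>. \<phi> \<in> test_functions S \<Longrightarrow> (\<integral>x. h x * \<phi> x \<partial>leb_on S) = 0"
  shows "AE x in leb_on S. h x = 0"
proof -
  have box0: "(\<integral>x. indicator (box p q) x *\<^sub>R h x \<partial>lborel) = 0" if pq: "cbox p q \<subseteq> S" for p q
  proof -
    have hi: "integrable lborel (\<lambda>x. indicator (cbox p q) x *\<^sub>R h x)"
      by (rule integrable_L2_indicator[OF S h pq]) (use emeasure_lborel_cbox_finite[of p q] in auto)
    let ?b = "\<lambda>n x. complex_of_real (box_bump p q (real (Suc n)) x)"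
    have bz: "?b n x = 0" if "x \<notin> cbox p q" for n x
    proof -
      have "\<not> 0 < box_bump p q (real (Suc n)) x"
        using box_bump_pos_iff[of "real (Suc n)" p q x] that box_subset_cbox[of p q] by auto
      then show ?thesis using box_bump_bounds(1)[of p q "real (Suc n)" x] by simp
    qed
    have eq: "(\<integral>x. h x * ?b n x \<partial>leb_on S) = (\<integral>x. ?b n x * (indicator (cbox p q) x *\<^sub>R h x) \<partial>lborel)" for n
      unfolding integral_leb_on[OF S]
    proof (intro Bochner_Integration.integral_cong refl)
      fix x show "indicator S x *\<^sub>R (h x * ?b n x) = ?b n x * (indicator (cbox p q) x *\<^sub>R h x)"
        using bz[of x n] pq by (cases "x \<in> cbox p q") auto
    qed
    have bm: "?b n \<in> borel_measurable lborel" for n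
      using borel_measurable_continuous_onI[OF smooth_fun_continuous_on[OF smooth_fun_box_bump]]
      by (simp del: of_nat_Suc)
    have "(\<lambda>n. \<integral>x. ?b n x * (indicator (cbox p q) x *\<^sub>R h x) \<partial>lborel)
       \<longlonglongrightarrow> (\<integral>x. indicator (box p q) x *\<^sub>R (indicator (cbox p q) x *\<^sub>R h x) \<partial>lborel)"
    proof (rule integral_dominated_convergence)
      show "integrable lborel (\<lambda>x. norm (indicator (cbox p q) x *\<^sub>R h x))" using hi by (rule integrable_norm)
      have m: "(\<lambda>x. indicator (cbox p q) x *\<^sub>R h x) \<in> borel_measurable lborel" using hi by auto
      then show "(\<lambda>x. indicator (box p q) x *\<^sub>R indicator (cbox p q) x *\<^sub>R h x) \<in> borel_measurable lborel"
        by (rule borel_measurable_scaleR[OF borel_measurable_indicator, rotated]) simp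
      show "(\<lambda>x. ?b n x * (indicator (cbox p q) x *\<^sub>R h x)) \<in> borel_measurable lborel" for n
        using borel_measurable_times[OF bm[of n] m] .
      show "AE x in lborel. (\<lambda>n. ?b n x * (indicator (cbox p q) x *\<^sub>R h x))
          \<longlonglongrightarrow> indicator (box p q) x *\<^sub>R indicator (cbox p q) x *\<^sub>R h x"
        unfolding scaleR_conv_of_real by (intro AE_I2 tendsto_intros tendsto_of_real box_bump_tendsto)
      show "AE x in lborel. norm (?b n x * (indicator (cbox p q) x *\<^sub>R h x)) \<le> norm (indicator (cbox p q) x *\<^sub>R h x)" for n
        using box_bump_bounds[of p q "real (Suc n)"]
        unfolding norm_mult[of "complex_of_real _"] by (intro AE_I2 mult_left_le_one_le) auto
    qed
    moreover have "indicator (box p q) x *\<^sub>R (indicator (cbox p q) x *\<^sub>R h x) = indicator (box p q) x *\<^sub>R h x" for x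
      using box_subset_cbox[of p q] by (auto simp: indicator_def)
    moreover have "(\<integral>x. ?b n x * (indicator (cbox p q) x *\<^sub>R h x) \<partial>lborel) = 0" for n
      unfolding eq[symmetric] by (intro z test_functions_box_bump pq) simp
    ultimately have "(\<lambda>n::nat. 0) \<longlonglongrightarrow> (\<integral>x. indicator (box p q) x *\<^sub>R h x \<partial>lborel)"
      by (simp only:)
    then show ?thesis by (simp only: LIMSEQ_const_iff)
  qed
  have cb: "AE x in lborel. x \<in> cbox a b \<longrightarrow> h x = 0" if ab: "cbox a b \<subseteq> S" for a b
  proof -
    have bs: "box a b \<subseteq> S" using ab box_subset_cbox by blast
    have "AE x in lborel. indicator (box a b) x *\<^sub>R h x = 0"
    proof (rule integral_zero_boxes_imp_AE_zero)
      show "integrable lborel (\<lambda>x. indicator (box a b) x *\<^sub>R h x)"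
        by (rule integrable_L2_indicator[OF S h bs]) (use emeasure_lborel_box_finite[of a b] in auto)
      fix c d
      obtain p q where pq: "box c d \<inter> box a b = box p q" using box_Int_box[of c d a b] by blast
      have "(\<integral>x. indicator (box p q) x *\<^sub>R h x \<partial>lborel) = 0"
      proof (cases "box p q = {}")
        case False
        \<comment> \<open>Bump functions are supported in the closed box, so the closure of the
          intersection has to stay in S; for an empty intersection \<open>cbox p q\<close> could be
          unrelated to it.\<close>
        have "closure (box p q) \<subseteq> closure (box a b)" using pq by (intro closure_mono) auto
        then have "cbox p q \<subseteq> S" using False ab closure_box[of p q] closure_box[of a b]
          by (metis closure_empty empty_subsetI order_trans subset_empty)
        then show ?thesis by (rule box0)
      qed simp
      moreover have "indicator (box c d) x *\<^sub>R indicator (box a b) x *\<^sub>R h x = indicator (box p q) x *\<^sub>R h x" for x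
        unfolding pq[symmetric] by (auto simp: indicator_def)
      ultimately show "(\<integral>x. indicator (box c d) x *\<^sub>R indicator (box a b) x *\<^sub>R h x \<partial>lborel) = 0"
        by (simp only:)
    qed
    \<comment> \<open>The covering uses closed boxes, whereas h is known to vanish on open ones
      only; the faces are null sets.\<close>
    moreover have "AE x in lborel. x \<notin> cbox a b - box a b"
    proof (rule AE_not_in)
      have "emeasure lborel (cbox a b - box a b) = emeasure lborel (cbox a b) - emeasure lborel (box a b)"
        by (intro emeasure_Diff box_subset_cbox) (use emeasure_lborel_box_finite[of a b] in auto)
      also have "\<dots> = 0" by (simp add: emeasure_lborel_cbox_eq emeasure_lborel_box_eq)
      finally show "cbox a b - box a b \<in> null_sets lborel" by (simp add: null_sets_def)
    qed
    ultimately show ?thesis by eventually_elim (auto simp: indicator_def)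
  qed
  obtain \<D> where D: "countable \<D>" "\<D> \<subseteq> Pow S" "\<And>X. X \<in> \<D> \<Longrightarrow> \<exists>a b. X = cbox a b" "\<Union>\<D> = S"
    using open_countable_Union_open_cbox[OF S] by metis
  have "AE x in lborel. \<forall>X\<in>\<D>. x \<in> X \<longrightarrow> h x = 0"
    unfolding AE_ball_countable[OF D(1)] using D(2,3) cb by blast
  then show ?thesis unfolding AE_leb_on[OF S]
    by eventually_elim (use D(4) in auto)
qed

section \<open>Weak derivatives and Sobolev spaces\<close>

lemma test_functions_L2:
  assumes S: "open S" and "\<phi> \<in> test_functions T"
  shows "\<phi> \<in> L2_space (leb_on S)"
proof -
  have m: "\<phi> \<in> borel_measurable borel"
    by (intro borel_measurable_continuous_onI smooth_fun_continuous_on test_functionsD(1)[OF assms(2)])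
  have "(\<lambda>x. \<phi> x * cnj (\<phi> x)) \<in> test_functions T"
    using assms(2) test_functionsD(1) by (intro test_functions_mult smooth_fun_cnj) auto
  from test_functions_integrable[OF this] have "integrable lborel (\<lambda>x. cmod (\<phi> x * cnj (\<phi> x)))"
    by (rule integrable_norm)
  then have "integrable lborel (\<lambda>x. (cmod (\<phi> x))\<^sup>2)" by (simp add: norm_mult power2_eq_square)
  with m have "\<phi> \<in> L2_space lborel" by (simp add: L2_space_def)
  then have "(\<lambda>x. complex_of_real (indicator S x) * \<phi> x) \<in> L2_space lborel"
    by (rule L2_mult_bounded(1)[where K=1]) (use S in \<open>auto intro!: borel_measurable_of_real\<close>)
  then show ?thesis by (simp add: L2_leb_on_iff[OF S] scaleR_conv_of_real)
qed

lemma integral_leb_on_test: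
  fixes f :: "'a::euclidean_space \<Rightarrow> 'b::{banach, second_countable_topology}"
  assumes "open S" "\<And>x. x \<notin> S \<Longrightarrow> f x = 0"
  shows "(\<integral>x. f x \<partial>leb_on S) = (\<integral>x. f x \<partial>lborel)"
  unfolding integral_leb_on[OF assms(1)]
  by (intro Bochner_Integration.integral_cong) (use assms(2) in \<open>auto simp: indicator_def\<close>)

text \<open>The definition pairs without conjugation. Replacing test functions by their conjugates
  gives L^2 inner products, to which continuity and Cauchy-Schwarz apply.\<close>

lemma has_weak_deriv_iff:
  assumes S: "open S" and b: "b \<in> Basis"
  shows "has_weak_deriv S b u g \<longleftrightarrow> u \<in> L2_space (leb_on S) \<and> g \<in> L2_space (leb_on S) \<and>
    (\<forall>\<phi> \<in> test_functions S. L2_inner (leb_on S) u (dir_deriv b \<phi>) = - L2_inner (leb_on S) g \<phi>)"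
proof -
  have "(\<forall>\<phi> \<in> test_functions S. (\<integral>x. u x * dir_deriv b \<phi> x \<partial>leb_on S) = - (\<integral>x. g x * \<phi> x \<partial>leb_on S))
     \<longleftrightarrow> (\<forall>\<phi> \<in> test_functions S. (\<integral>x. u x * cnj (dir_deriv b \<phi> x) \<partial>leb_on S) = - (\<integral>x. g x * cnj (\<phi> x) \<partial>leb_on S))"
    (is "?L \<longleftrightarrow> ?R")
  proof (intro iffI ballI)
    fix \<phi> assume ?L "\<phi> \<in> test_functions S"
    from this(1)[rule_format, OF test_functions_cnj[OF this(2)]]
    show "(\<integral>x. u x * cnj (dir_deriv b \<phi> x) \<partial>leb_on S) = - (\<integral>x. g x * cnj (\<phi> x) \<partial>leb_on S)"
      by (simp add: dir_deriv_cnj[OF test_functionsD(1)[OF \<open>\<phi> \<in> test_functions S\<close>]])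
  next
    fix \<phi> assume ?R "\<phi> \<in> test_functions S"
    from this(1)[rule_format, OF test_functions_cnj[OF this(2)]]
    show "(\<integral>x. u x * dir_deriv b \<phi> x \<partial>leb_on S) = - (\<integral>x. g x * \<phi> x \<partial>leb_on S)"
      by (simp add: dir_deriv_cnj[OF test_functionsD(1)[OF \<open>\<phi> \<in> test_functions S\<close>]])
  qed
  then show ?thesis by (simp add: has_weak_deriv_def L2_inner_def)
qed

lemma has_weak_deriv_test:
  assumes S: "open S" and b: "b \<in> Basis" and \<phi>: "\<phi> \<in> test_functions S"
  shows "has_weak_deriv S b \<phi> (dir_deriv b \<phi>)"
  unfolding has_weak_deriv_def
proof (intro conjI ballI)
  fix \<psi> assume \<psi>: "\<psi> \<in> test_functions S"
  note [simp] = test_function_zero[OF \<phi>] test_function_zero[OF test_functions_dir_deriv[OF \<phi> b]]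
  have i: "integrable lborel (\<lambda>x. \<phi> x * dir_deriv b \<psi> x)" "integrable lborel (\<lambda>x. dir_deriv b \<phi> x * \<psi> x)"
    using \<phi> \<psi> b test_functionsD(1) smooth_fun_dir_deriv test_functions_dir_deriv
    by (blast intro: test_functions_integrable test_functions_mult)+
  have "0 = (\<integral>x. dir_deriv b (\<lambda>x. \<phi> x * \<psi> x) x \<partial>lborel)"
    using \<phi> \<psi> b by (intro integral_dir_deriv_zero[symmetric] test_functions_mult test_functionsD(1))
  also have "\<dots> = (\<integral>x. \<phi> x * dir_deriv b \<psi> x \<partial>lborel) + (\<integral>x. dir_deriv b \<phi> x * \<psi> x \<partial>lborel)"
    using dir_deriv_mult[OF test_functionsD(1)[OF \<phi>] test_functionsD(1)[OF \<psi>], of b] i by simp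
  finally show "(\<integral>x. \<phi> x * dir_deriv b \<psi> x \<partial>leb_on S) = - (\<integral>x. dir_deriv b \<phi> x * \<psi> x \<partial>leb_on S)"
    by (subst (1 2) integral_leb_on_test[OF S]) (auto simp: add_eq_0_iff)
qed (use test_functions_L2[OF S] \<phi> test_functions_dir_deriv[OF \<phi> b] in auto)

text \<open>The difference of the derivatives annihilates all test functions. This makes the
  arbitrary choice in \<open>weak_deriv\<close> harmless, also when u is changed on a null
  set.\<close>

lemma has_weak_deriv_unique:
  assumes S: "open S" and u: "has_weak_deriv S b u g" "has_weak_deriv S b u' g'"
    and eq: "AE x in leb_on S. u x = u' x" and b: "b \<in> Basis"
  shows "AE x in leb_on S. g x = g' x"
proof -
  have g: "g \<in> L2_space (leb_on S)" "g' \<in> L2_space (leb_on S)" "u \<in> L2_space (leb_on S)" "u' \<in> L2_space (leb_on S)"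
    using u by (auto simp: has_weak_deriv_def)
  have "AE x in leb_on S. g x - g' x = 0"
  proof (rule fundamental_lemma_variations[OF S L2.diff[OF g(1,2)]])
    fix \<phi> assume \<phi>: "\<phi> \<in> test_functions S"
    then have c: "(\<lambda>x. cnj (\<phi> x)) \<in> test_functions S" by (rule test_functions_cnj)
    have "L2_inner (leb_on S) u (dir_deriv b (\<lambda>x. cnj (\<phi> x))) = L2_inner (leb_on S) u' (dir_deriv b (\<lambda>x. cnj (\<phi> x)))"
      using g eq test_functions_L2[OF S test_functions_dir_deriv[OF c b]]
      by (intro L2_inner_cong_AE) (auto dest: L2_spaceD(1))
    then have "L2_inner (leb_on S) g (\<lambda>x. cnj (\<phi> x)) = L2_inner (leb_on S) g' (\<lambda>x. cnj (\<phi> x))"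
      using u c unfolding has_weak_deriv_iff[OF S b] by simp
    then have "L2_inner (leb_on S) (\<lambda>x. g x - g' x) (\<lambda>x. cnj (\<phi> x)) = 0"
      using L2.B_diff[OF g(1,2) test_functions_L2[OF S c]] by simp
    then show "(\<integral>x. (g x - g' x) * \<phi> x \<partial>leb_on S) = 0" by (simp add: L2_inner_def)
  qed
  then show ?thesis by simp
qed

lemma has_weak_deriv_lin:
  assumes S: "open S" and b: "b \<in> Basis" and u: "has_weak_deriv S b u g" "has_weak_deriv S b v h"
  shows "has_weak_deriv S b (\<lambda>x. u x + c * v x) (\<lambda>x. g x + c * h x)"
  unfolding has_weak_deriv_iff[OF S b]
proof (intro conjI ballI)
  have L: "u \<in> L2_space (leb_on S)" "g \<in> L2_space (leb_on S)" "v \<in> L2_space (leb_on S)" "h \<in> L2_space (leb_on S)"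
    using u by (auto simp: has_weak_deriv_def)
  then show "(\<lambda>x. u x + c * v x) \<in> L2_space (leb_on S)" "(\<lambda>x. g x + c * h x) \<in> L2_space (leb_on S)"
    by (auto intro: L2.lin)
  fix \<phi> assume \<phi>: "\<phi> \<in> test_functions S"
  show "L2_inner (leb_on S) (\<lambda>x. u x + c * v x) (dir_deriv b \<phi>) = - L2_inner (leb_on S) (\<lambda>x. g x + c * h x) \<phi>"
    using u \<phi> L2.B_lin[OF L(1,3) test_functions_L2[OF S test_functions_dir_deriv[OF \<phi> b]], of c]
      L2.B_lin[OF L(2,4) test_functions_L2[OF S \<phi>], of c]
    unfolding has_weak_deriv_iff[OF S b] by simp
qed

text \<open>Both sides of the defining identity are continuous in L^2, so the weak derivative is a
  closed operator. Completeness of the Sobolev space rests on this.\<close>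

lemma has_weak_deriv_limit:
  assumes S: "open S" and b: "b \<in> Basis" and U: "\<And>n. has_weak_deriv S b (U n) (G n)"
    and u: "u \<in> L2_space (leb_on S)" "(\<lambda>n. L2_norm (leb_on S) (\<lambda>x. U n x - u x)) \<longlonglongrightarrow> 0"
    and g: "g \<in> L2_space (leb_on S)" "(\<lambda>n. L2_norm (leb_on S) (\<lambda>x. G n x - g x)) \<longlonglongrightarrow> 0"
  shows "has_weak_deriv S b u g"
  unfolding has_weak_deriv_iff[OF S b]
proof (intro conjI ballI u g)
  fix \<phi> assume \<phi>: "\<phi> \<in> test_functions S"
  have UL: "U n \<in> L2_space (leb_on S)" "G n \<in> L2_space (leb_on S)" for n
    using U by (auto simp: has_weak_deriv_def)
  have "(\<lambda>n. L2_inner (leb_on S) (U n) (dir_deriv b \<phi>)) \<longlonglongrightarrow> L2_inner (leb_on S) u (dir_deriv b \<phi>)"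
    by (intro L2.B_tendsto UL u test_functions_L2[OF S test_functions_dir_deriv[OF \<phi> b]])
  moreover have "(\<lambda>n. - L2_inner (leb_on S) (G n) \<phi>) \<longlonglongrightarrow> - L2_inner (leb_on S) g \<phi>"
    by (intro tendsto_minus L2.B_tendsto UL g test_functions_L2[OF S \<phi>])
  moreover have "L2_inner (leb_on S) (U n) (dir_deriv b \<phi>) = - L2_inner (leb_on S) (G n) \<phi>" for n
    using U[of n] \<phi> unfolding has_weak_deriv_iff[OF S b] by simp
  ultimately show "L2_inner (leb_on S) u (dir_deriv b \<phi>) = - L2_inner (leb_on S) g \<phi>"
    by (simp add: LIMSEQ_unique)
qed

text \<open>Linearity of \<open>T\<close> is required almost everywhere only, because
  \<open>T\<close> will be built from \<open>weak_deriv\<close>; the inner product does not see the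
  exceptional null set.\<close>

lemma pos_form_pullback:
  assumes V: "\<And>u v c. u \<in> V \<Longrightarrow> v \<in> V \<Longrightarrow> (\<lambda>x. u x + c * v x) \<in> V" "(\<lambda>_. 0) \<in> V"
    and T: "\<And>u. u \<in> V \<Longrightarrow> T u \<in> L2_space M"
    and T_lin: "\<And>u v c. u \<in> V \<Longrightarrow> v \<in> V \<Longrightarrow> AE x in M. T (\<lambda>x. u x + c * v x) x = T u x + c * T v x"
  shows "pos_form V (\<lambda>u v. L2_inner M (T u) (T v))"
proof
  fix u v w :: "'a \<Rightarrow> complex" and c
  assume uvw: "u \<in> V" "v \<in> V" "w \<in> V"
  have "L2_inner M (T (\<lambda>x. u x + c * v x)) (T w) = L2_inner M (\<lambda>x. T u x + c * T v x) (T w)"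
    using T_lin[OF uvw(1,2)] T[OF V(1)[OF uvw(1,2)]] T[OF uvw(3)] L2.lin[OF T T, OF uvw(1,2)]
    by (intro L2_inner_cong_AE) (auto dest: L2_spaceD(1))
  then show "L2_inner M (T (\<lambda>x. u x + c * v x)) (T w) = L2_inner M (T u) (T w) + c * L2_inner M (T v) (T w)"
    using L2.B_lin[OF T T T, OF uvw] by simp
qed (rule V L2.B_herm L2.B_pos T | assumption)+

lemma pos_form_add:
  assumes "pos_form V B" "pos_form V B'"
  shows "pos_form V (\<lambda>u v. B u v + B' u v)"
proof -
  interpret A: pos_form V B by fact
  interpret C: pos_form V B' by fact
  show ?thesis
  proof
    fix u v assume "u \<in> V" "v \<in> V"
    then show "B v u + B' v u = cnj (B u v + B' u v)"
      using A.B_herm[of u v] C.B_herm[of u v] by simp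
  qed (auto simp: A.lin A.zero_mem A.B_lin C.B_lin A.B_pos C.B_pos algebra_simps)
qed

lemma pos_form_sum:
  assumes "finite I" "I \<noteq> {}" "\<And>i. i \<in> I \<Longrightarrow> pos_form V (B i)"
  shows "pos_form V (\<lambda>u v. \<Sum>i\<in>I. B i u v)"
  using assms
proof (induction rule: finite_ne_induct)
  case (insert i I)
  have "pos_form V (\<lambda>u v. B i u v + (\<Sum>i\<in>I. B i u v))"
    using insert by (intro pos_form_add) auto
  then show ?case using insert by simp
qed simp

lemma pos_form_subspace:
  assumes "pos_form V B" "W \<subseteq> V" "\<And>u v c. u \<in> W \<Longrightarrow> v \<in> W \<Longrightarrow> (\<lambda>x. u x + c * v x) \<in> W" "(\<lambda>_. 0) \<in> W"
  shows "pos_form W B"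
proof -
  interpret A: pos_form V B by fact
  show ?thesis
    by standard (rule assms A.B_lin A.B_herm A.B_pos | assumption | rule subsetD[OF assms(2)])+
qed

subsection \<open>The space \<open>H\<^sup>1\<close>\<close>

lemma has_weak_deriv_weak_deriv:
  "has_weak_deriv S b u g \<Longrightarrow> has_weak_deriv S b u (weak_deriv S b u)"
  unfolding weak_deriv_def by (rule someI[where P="has_weak_deriv S b u"])

lemma H1_spaceD:
  assumes "u \<in> H1_space S"
  shows "u \<in> L2_space (leb_on S)"
    and "b \<in> Basis \<Longrightarrow> has_weak_deriv S b u (weak_deriv S b u)"
    and "b \<in> Basis \<Longrightarrow> weak_deriv S b u \<in> L2_space (leb_on S)"
proof -
  show "u \<in> L2_space (leb_on S)" using assms by (simp add: H1_space_def)
  show 1: "has_weak_deriv S b u (weak_deriv S b u)" if "b \<in> Basis" for b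
  proof -
    from assms that have "\<exists>g. has_weak_deriv S b u g" by (simp add: H1_space_def)
    then obtain g where "has_weak_deriv S b u g" by (rule exE)
    then show ?thesis by (rule has_weak_deriv_weak_deriv)
  qed
  show "weak_deriv S b u \<in> L2_space (leb_on S)" if "b \<in> Basis"
    using 1[OF that] by (simp add: has_weak_deriv_def)
qed

lemma H1_spaceI:
  assumes "u \<in> L2_space (leb_on S)" "\<And>b. b \<in> Basis \<Longrightarrow> has_weak_deriv S b u (g b)"
  shows "u \<in> H1_space S"
  using assms by (auto simp: H1_space_def)

lemma weak_deriv_AE:
  assumes S: "open S" and b: "b \<in> Basis" and u: "has_weak_deriv S b u g"
  shows "AE x in leb_on S. weak_deriv S b u x = g x"
  using has_weak_deriv_unique[OF S has_weak_deriv_weak_deriv[OF u] u _ b] by simp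

lemma H1_lin:
  assumes S: "open S" and "u \<in> H1_space S" "v \<in> H1_space S"
  shows "(\<lambda>x. u x + c * v x) \<in> H1_space S"
  by (rule H1_spaceI[where g="\<lambda>b x. weak_deriv S b u x + c * weak_deriv S b v x"])
     (rule L2.lin H1_spaceD(1) has_weak_deriv_lin[OF S] H1_spaceD(2) assms | assumption)+

lemma weak_deriv_lin:
  assumes S: "open S" and "u \<in> H1_space S" "v \<in> H1_space S" and b: "b \<in> Basis"
  shows "AE x in leb_on S. weak_deriv S b (\<lambda>x. u x + c * v x) x = weak_deriv S b u x + c * weak_deriv S b v x"
  by (rule weak_deriv_AE[OF S b has_weak_deriv_lin[OF S b]]; rule H1_spaceD(2)[OF _ b]; fact)

lemma test_functions_zero: "(\<lambda>_. 0) \<in> test_functions S"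
  by (rule test_functionsI[where K="{}"]) (auto intro: smooth_fun_const)

lemma test_functions_H1:
  assumes S: "open S" and "\<phi> \<in> test_functions S"
  shows "\<phi> \<in> H1_space S"
  by (rule H1_spaceI[where g="\<lambda>b. dir_deriv b \<phi>"])
     (rule test_functions_L2[OF S assms(2)] has_weak_deriv_test[OF S _ assms(2)] | assumption)+

definition H1_inner :: "'a::euclidean_space set \<Rightarrow> ('a \<Rightarrow> complex) \<Rightarrow> ('a \<Rightarrow> complex) \<Rightarrow> complex" where
  "H1_inner S u v = L2_inner (leb_on S) u v +
     (\<Sum>b\<in>Basis. L2_inner (leb_on S) (weak_deriv S b u) (weak_deriv S b v))"

lemma H1_pos_form:
  assumes S: "open S"
  shows "pos_form (H1_space S) (H1_inner S)"
  unfolding H1_inner_def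
proof (intro pos_form_add pos_form_sum)
  have z: "(\<lambda>_. 0) \<in> H1_space S" using test_functions_H1[OF S test_functions_zero] .
  show "pos_form (H1_space S) (L2_inner (leb_on S))"
    by (rule pos_form_subspace[OF L2_pos_form]) (use z H1_lin[OF S] H1_spaceD(1) in auto)
  show "pos_form (H1_space S) (\<lambda>u v. L2_inner (leb_on S) (weak_deriv S b u) (weak_deriv S b v))" if "b \<in> Basis" for b
    by (rule pos_form_pullback[OF H1_lin[OF S] z]) (use H1_spaceD(3) weak_deriv_lin[OF S] that in auto)
qed auto

lemma H1_norm_eq:
  assumes S: "open S"
  shows "pos_form.N (H1_inner S) = H1_norm S"
proof
  fix u
  have e: "L2_inner M u u = complex_of_real ((L2_norm M u)\<^sup>2)" for u :: "'a \<Rightarrow> complex" and M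
    unfolding L2_inner_def complex_norm_square[symmetric] L2_norm_sq by (rule integral_complex_of_real)
  show "pos_form.N (H1_inner S) u = H1_norm S u"
    unfolding pos_form.N_def[OF H1_pos_form[OF S]] H1_inner_def H1_norm_def e by simp
qed

lemma H1_norm_sq: "(H1_norm S u)\<^sup>2 = (L2_norm (leb_on S) u)\<^sup>2 + (\<Sum>b\<in>Basis. (L2_norm (leb_on S) (weak_deriv S b u))\<^sup>2)"
  unfolding H1_norm_def by (simp add: sum_nonneg)

lemma H1_norm_nonneg [simp]: "0 \<le> H1_norm S u"
  unfolding H1_norm_def by (simp add: sum_nonneg)

lemma L2_norm_le_H1: "L2_norm (leb_on S) u \<le> H1_norm S u"
  by (rule power2_le_imp_le) (auto simp: H1_norm_sq sum_nonneg)

lemma L2_norm_deriv_le_H1: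
  assumes "b \<in> Basis"
  shows "L2_norm (leb_on S) (weak_deriv S b u) \<le> H1_norm S u"
proof (rule power2_le_imp_le)
  have "(L2_norm (leb_on S) (weak_deriv S b u))\<^sup>2 \<le> (\<Sum>b\<in>Basis. (L2_norm (leb_on S) (weak_deriv S b u))\<^sup>2)"
    using assms by (intro member_le_sum) auto
  then show "(L2_norm (leb_on S) (weak_deriv S b u))\<^sup>2 \<le> (H1_norm S u)\<^sup>2"
    unfolding H1_norm_sq by (simp add: add_increasing)
qed simp

lemma H1_norm_tendsto_0I:
  assumes "(\<lambda>n. L2_norm (leb_on S) (U n)) \<longlonglongrightarrow> 0"
    and "\<And>b. b \<in> Basis \<Longrightarrow> (\<lambda>n. L2_norm (leb_on S) (weak_deriv S b (U n))) \<longlonglongrightarrow> 0"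
  shows "(\<lambda>n. H1_norm S (U n)) \<longlonglongrightarrow> 0"
proof -
  have "(\<lambda>n. sqrt ((L2_norm (leb_on S) (U n))\<^sup>2 + (\<Sum>b\<in>Basis. (L2_norm (leb_on S) (weak_deriv S b (U n)))\<^sup>2)))
     \<longlonglongrightarrow> sqrt (0\<^sup>2 + (\<Sum>b\<in>(Basis::'a set). 0\<^sup>2))"
    by (intro tendsto_intros assms)
  then show ?thesis by (simp add: H1_norm_def)
qed

lemma H10_spaceD: "u \<in> H10_space S \<Longrightarrow> u \<in> H1_space S"
  by (simp add: H10_space_def)

lemma weak_deriv_test_AE:
  assumes "open S" "b \<in> Basis" "\<phi> \<in> test_functions S"
  shows "AE x in leb_on S. weak_deriv S b \<phi> x = dir_deriv b \<phi> x"
  by (rule weak_deriv_AE[OF assms(1,2) has_weak_deriv_test[OF assms]])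

lemma L2_norm_weak_deriv_diff:
  assumes S: "open S" and b: "b \<in> Basis" and u: "has_weak_deriv S b u g" and v: "has_weak_deriv S b v h"
  shows "L2_norm (leb_on S) (weak_deriv S b (\<lambda>x. u x - v x)) = L2_norm (leb_on S) (\<lambda>x. g x - h x)"
proof -
  have d: "has_weak_deriv S b (\<lambda>x. u x - v x) (\<lambda>x. g x - h x)"
    using has_weak_deriv_lin[OF S b u v, of "-1"] by simp
  then have "has_weak_deriv S b (\<lambda>x. u x - v x) (weak_deriv S b (\<lambda>x. u x - v x))"
    by (rule has_weak_deriv_weak_deriv)
  then have "weak_deriv S b (\<lambda>x. u x - v x) \<in> L2_space (leb_on S)" by (simp add: has_weak_deriv_def)
  moreover have "(\<lambda>x. g x - h x) \<in> L2_space (leb_on S)" using d by (simp add: has_weak_deriv_def)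
  ultimately show ?thesis using weak_deriv_AE[OF S b d]
    by (intro L2_norm_cong_AE) (auto dest: L2_spaceD(1))
qed

text \<open>Membership without prior knowledge of weak derivatives of u: L^2 limits of the test
  functions and of their classical derivatives produce them.\<close>

lemma H10_limitI:
  assumes S: "open S" and \<phi>: "\<And>n. \<phi> n \<in> test_functions S"
    and u: "u \<in> L2_space (leb_on S)" "(\<lambda>n. L2_norm (leb_on S) (\<lambda>x. \<phi> n x - u x)) \<longlonglongrightarrow> 0"
    and g: "\<And>b. b \<in> Basis \<Longrightarrow> g b \<in> L2_space (leb_on S)"
      "\<And>b. b \<in> Basis \<Longrightarrow> (\<lambda>n. L2_norm (leb_on S) (\<lambda>x. dir_deriv b (\<phi> n) x - g b x)) \<longlonglongrightarrow> 0"
  shows "u \<in> H10_space S" "\<And>b. b \<in> Basis \<Longrightarrow> has_weak_deriv S b u (g b)"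
proof -
  show w: "has_weak_deriv S b u (g b)" if "b \<in> Basis" for b
    by (rule has_weak_deriv_limit[OF S that has_weak_deriv_test[OF S that \<phi>] u g[OF that]])
  have "(\<lambda>n. H1_norm S (\<lambda>x. \<phi> n x - u x)) \<longlonglongrightarrow> 0"
  proof (rule H1_norm_tendsto_0I[OF u(2)])
    show "(\<lambda>n. L2_norm (leb_on S) (weak_deriv S b (\<lambda>x. \<phi> n x - u x))) \<longlonglongrightarrow> 0" if "b \<in> Basis" for b
      using g(2)[OF that] L2_norm_weak_deriv_diff[OF S that has_weak_deriv_test[OF S that \<phi>] w[OF that]]
      by simp
  qed
  moreover have "u \<in> H1_space S" by (rule H1_spaceI[OF u(1) w])
  ultimately show "u \<in> H10_space S" using \<phi> by (auto simp: H10_space_def)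
qed

lemma H10_approx:
  assumes S: "open S" and u: "u \<in> H10_space S"
  obtains \<phi> where "\<And>n. \<phi> n \<in> test_functions S" "(\<lambda>n. H1_norm S (\<lambda>x. \<phi> n x - u x)) \<longlonglongrightarrow> 0"
    "(\<lambda>n. L2_norm (leb_on S) (\<lambda>x. \<phi> n x - u x)) \<longlonglongrightarrow> 0"
    "\<And>b. b \<in> Basis \<Longrightarrow> (\<lambda>n. L2_norm (leb_on S) (\<lambda>x. dir_deriv b (\<phi> n) x - weak_deriv S b u x)) \<longlonglongrightarrow> 0"
proof -
  obtain \<phi> where \<phi>: "\<And>n. \<phi> n \<in> test_functions S" "(\<lambda>n. H1_norm S (\<lambda>x. \<phi> n x - u x)) \<longlonglongrightarrow> 0"
    using u unfolding H10_space_def by blast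
  have 1: "(\<lambda>n. L2_norm (leb_on S) (\<lambda>x. \<phi> n x - u x)) \<longlonglongrightarrow> 0"
    by (rule Lim_null_comparison[OF _ \<phi>(2)]) (simp add: L2_norm_le_H1)
  have "(\<lambda>n. L2_norm (leb_on S) (\<lambda>x. dir_deriv b (\<phi> n) x - weak_deriv S b u x)) \<longlonglongrightarrow> 0" if "b \<in> Basis" for b
  proof (rule Lim_null_comparison[OF _ \<phi>(2)])
    have "L2_norm (leb_on S) (\<lambda>x. dir_deriv b (\<phi> n) x - weak_deriv S b u x) \<le> H1_norm S (\<lambda>x. \<phi> n x - u x)" for n
      using L2_norm_deriv_le_H1[OF that, of S "\<lambda>x. \<phi> n x - u x"]
        L2_norm_weak_deriv_diff[OF S that has_weak_deriv_test[OF S that \<phi>(1)] H1_spaceD(2)[OF H10_spaceD[OF u] that]]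
      by simp
    then show "\<forall>\<^sub>F n in sequentially. norm (L2_norm (leb_on S) (\<lambda>x. dir_deriv b (\<phi> n) x - weak_deriv S b u x)) \<le> H1_norm S (\<lambda>x. \<phi> n x - u x)"
      by simp
  qed
  with \<phi> 1 show ?thesis using that by blast
qed

lemma test_functions_H10:
  assumes S: "open S" and "\<phi> \<in> test_functions S"
  shows "\<phi> \<in> H10_space S"
proof -
  interpret pos_form "H1_space S" "H1_inner S"
    rewrites "pos_form.N (H1_inner S) = H1_norm S"
    by (rule H1_pos_form[OF S], rule H1_norm_eq[OF S])
  have "(\<lambda>n::nat. H1_norm S (\<lambda>x. \<phi> x - \<phi> x)) \<longlonglongrightarrow> 0" by simp
  then show ?thesis using assms test_functions_H1
    unfolding H10_space_def by (auto intro!: exI[of _ "\<lambda>_. \<phi>"])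
qed

lemma H10_lin:
  assumes S: "open S" and u: "u \<in> H10_space S" and v: "v \<in> H10_space S"
  shows "(\<lambda>x. u x + c * v x) \<in> H10_space S"
proof -
  interpret pos_form "H1_space S" "H1_inner S"
    rewrites "pos_form.N (H1_inner S) = H1_norm S"
    by (rule H1_pos_form[OF S], rule H1_norm_eq[OF S])
  note uv = H10_spaceD[OF u] H10_spaceD[OF v]
  obtain \<phi> where \<phi>: "\<And>n. \<phi> n \<in> test_functions S" "(\<lambda>n. H1_norm S (\<lambda>x. \<phi> n x - u x)) \<longlonglongrightarrow> 0"
    using u unfolding H10_space_def by blast
  obtain \<psi> where \<psi>: "\<And>n. \<psi> n \<in> test_functions S" "(\<lambda>n. H1_norm S (\<lambda>x. \<psi> n x - v x)) \<longlonglongrightarrow> 0"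
    using v unfolding H10_space_def by blast
  have "(\<lambda>n. H1_norm S (\<lambda>x. \<phi> n x + c * \<psi> n x - (u x + c * v x))) \<longlonglongrightarrow> 0"
  proof (rule Lim_null_comparison)
    show "(\<lambda>n. H1_norm S (\<lambda>x. \<phi> n x - u x) + cmod c * H1_norm S (\<lambda>x. \<psi> n x - v x)) \<longlonglongrightarrow> 0"
      using tendsto_add[OF \<phi>(2) tendsto_mult[OF tendsto_const \<psi>(2)], of "cmod c"] by simp
    have "H1_norm S (\<lambda>x. (\<phi> n x - u x) + c * (\<psi> n x - v x)) \<le> H1_norm S (\<lambda>x. \<phi> n x - u x) + cmod c * H1_norm S (\<lambda>x. \<psi> n x - v x)" for n
      using uv \<phi> \<psi> test_functions_H1[OF S] by (intro triangle diff) auto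
    moreover have "(\<phi> n x - u x) + c * (\<psi> n x - v x) = \<phi> n x + c * \<psi> n x - (u x + c * v x)" for n x
      by (simp add: algebra_simps)
    ultimately show "\<forall>\<^sub>F n in sequentially. norm (H1_norm S (\<lambda>x. \<phi> n x + c * \<psi> n x - (u x + c * v x)))
        \<le> H1_norm S (\<lambda>x. \<phi> n x - u x) + cmod c * H1_norm S (\<lambda>x. \<psi> n x - v x)" by simp
  qed
  moreover have "(\<lambda>x. \<phi> n x + c * \<psi> n x) \<in> test_functions S" for n
    using \<phi> \<psi> by (intro test_functions_lin)
  ultimately show ?thesis using H1_lin[OF S uv] unfolding H10_space_def
    by (intro CollectI conjI exI[of _ "\<lambda>n x. \<phi> n x + c * \<psi> n x"]) auto
qed

lemma H10_pos_form:
  assumes S: "open S"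
  shows "pos_form (H10_space S) (H1_inner S)"
  by (rule pos_form_subspace[OF H1_pos_form[OF S]])
     (use H10_spaceD H10_lin[OF S] test_functions_H10[OF S test_functions_zero] in auto)

theorem H10_complete:
  assumes S: "open S"
  shows "complete_pos_form (H10_space S) (H1_inner S)"
proof -
  interpret H: pos_form "H10_space S" "H1_inner S"
    rewrites "pos_form.N (H1_inner S) = H1_norm S"
    by (rule H10_pos_form[OF S], rule H1_norm_eq[OF S])
  have "\<exists>l\<in>H10_space S. (\<lambda>n. H1_norm S (\<lambda>x. U n x - l x)) \<longlonglongrightarrow> 0"
    if U: "\<And>n. U n \<in> H10_space S"
      and C: "\<And>e. e > 0 \<Longrightarrow> \<exists>K. \<forall>m\<ge>K. \<forall>n\<ge>K. H1_norm S (\<lambda>x. U m x - U n x) < e" for U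
  proof -
    note UH = H10_spaceD[OF U]
    have UL: "U n \<in> L2_space (leb_on S)" for n using H1_spaceD(1)[OF UH] .
    have "\<exists>l\<in>L2_space (leb_on S). (\<lambda>n. L2_norm (leb_on S) (\<lambda>x. U n x - l x)) \<longlonglongrightarrow> 0"
    proof (rule L2_Cauchy_convergent[OF UL])
      fix e :: real assume "e > 0"
      from C[OF this] show "\<exists>K. \<forall>m\<ge>K. \<forall>n\<ge>K. L2_norm (leb_on S) (\<lambda>x. U m x - U n x) < e"
        using L2_norm_le_H1 by (meson le_less_trans)
    qed
    then obtain u where u: "u \<in> L2_space (leb_on S)" "(\<lambda>n. L2_norm (leb_on S) (\<lambda>x. U n x - u x)) \<longlonglongrightarrow> 0"
      by blast
    have "\<exists>l\<in>L2_space (leb_on S). (\<lambda>n. L2_norm (leb_on S) (\<lambda>x. weak_deriv S b (U n) x - l x)) \<longlonglongrightarrow> 0"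
      if b: "b \<in> Basis" for b
    proof (rule L2_Cauchy_convergent[OF H1_spaceD(3)[OF UH b]])
      fix e :: real assume "e > 0"
      have "L2_norm (leb_on S) (\<lambda>x. weak_deriv S b (U m) x - weak_deriv S b (U n) x) \<le> H1_norm S (\<lambda>x. U m x - U n x)" for m n
        using L2_norm_deriv_le_H1[OF b, of S "\<lambda>x. U m x - U n x"]
          L2_norm_weak_deriv_diff[OF S b H1_spaceD(2)[OF UH b] H1_spaceD(2)[OF UH b], of m n] by simp
      then show "\<exists>K. \<forall>m\<ge>K. \<forall>n\<ge>K. L2_norm (leb_on S) (\<lambda>x. weak_deriv S b (U m) x - weak_deriv S b (U n) x) < e"
        using C[OF \<open>e > 0\<close>] by (meson le_less_trans)
    qed
    then have "\<forall>b\<in>Basis. \<exists>l. l \<in> L2_space (leb_on S) \<and>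
        (\<lambda>n. L2_norm (leb_on S) (\<lambda>x. weak_deriv S b (U n) x - l x)) \<longlonglongrightarrow> 0"
      unfolding Bex_def by (rule ballI)
    from bchoice[OF this] obtain g where g0: "\<forall>b\<in>Basis. g b \<in> L2_space (leb_on S) \<and>
        (\<lambda>n. L2_norm (leb_on S) (\<lambda>x. weak_deriv S b (U n) x - g b x)) \<longlonglongrightarrow> 0" by (rule exE)
    have g: "g b \<in> L2_space (leb_on S)"
      "(\<lambda>n. L2_norm (leb_on S) (\<lambda>x. weak_deriv S b (U n) x - g b x)) \<longlonglongrightarrow> 0" if "b \<in> Basis" for b
      using bspec[OF g0 that] by simp_all
    \<comment> \<open>A diagonal choice: test functions within 1 / (n + 1) of \<open>U n\<close>
      have the same limits, and \<open>H10_limitI\<close> applies to test functions.\<close>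
    have "\<exists>\<phi>\<in>test_functions S. H1_norm S (\<lambda>x. \<phi> x - U n x) < 1 / real (Suc n)" for n
    proof -
      obtain \<phi> where \<phi>: "\<And>k. \<phi> k \<in> test_functions S" "(\<lambda>k. H1_norm S (\<lambda>x. \<phi> k x - U n x)) \<longlonglongrightarrow> 0"
        using U[of n] unfolding H10_space_def by blast
      have "\<forall>\<^sub>F k in sequentially. H1_norm S (\<lambda>x. \<phi> k x - U n x) < 1 / real (Suc n)"
        by (rule order_tendstoD(2)[OF \<phi>(2)]) simp
      then have "\<exists>k. H1_norm S (\<lambda>x. \<phi> k x - U n x) < 1 / real (Suc n)"
        by (rule eventually_happens'[OF sequentially_bot])
      then show ?thesis using \<phi>(1) by (elim exE) (rule bexI)
    qed
    then obtain \<phi> where \<phi>: "\<And>n. \<phi> n \<in> test_functions S" "\<And>n. H1_norm S (\<lambda>x. \<phi> n x - U n x) < 1 / real (Suc n)"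
      by metis
    have z: "(\<lambda>n. 1 / real (Suc n)) \<longlonglongrightarrow> 0" using LIMSEQ_inverse_real_of_nat by (simp add: inverse_eq_divide)
    have \<phi>L: "\<phi> n \<in> L2_space (leb_on S)" for n using test_functions_L2[OF S \<phi>(1)] .
    have 1: "(\<lambda>n. L2_norm (leb_on S) (\<lambda>x. \<phi> n x - u x)) \<longlonglongrightarrow> 0"
    proof (rule Lim_null_comparison)
      show "(\<lambda>n. 1 / real (Suc n) + L2_norm (leb_on S) (\<lambda>x. U n x - u x)) \<longlonglongrightarrow> 0"
        using tendsto_add[OF z u(2)] by simp
      have "L2_norm (leb_on S) (\<lambda>x. \<phi> n x - u x) \<le> 1 / real (Suc n) + L2_norm (leb_on S) (\<lambda>x. U n x - u x)" for n
        using L2.triangle_mid[OF \<phi>L u(1) UL, of n n] \<phi>(2)[of n] L2_norm_le_H1[of S "\<lambda>x. \<phi> n x - U n x"] by linarith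
      then show "\<forall>\<^sub>F n in sequentially. norm (L2_norm (leb_on S) (\<lambda>x. \<phi> n x - u x)) \<le> 1 / real (Suc n) + L2_norm (leb_on S) (\<lambda>x. U n x - u x)"
        by simp
    qed
    have 2: "(\<lambda>n. L2_norm (leb_on S) (\<lambda>x. dir_deriv b (\<phi> n) x - g b x)) \<longlonglongrightarrow> 0" if b: "b \<in> Basis" for b
    proof (rule Lim_null_comparison)
      let ?D = "\<lambda>n x. weak_deriv S b (U n) x"
      show "(\<lambda>n. 1 / real (Suc n) + L2_norm (leb_on S) (\<lambda>x. ?D n x - g b x)) \<longlonglongrightarrow> 0"
        using tendsto_add[OF z g(2)[OF b]] by simp
      have "L2_norm (leb_on S) (\<lambda>x. dir_deriv b (\<phi> n) x - g b x) \<le> 1 / real (Suc n) + L2_norm (leb_on S) (\<lambda>x. ?D n x - g b x)" for n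
        using L2.triangle_mid[OF test_functions_L2[OF S test_functions_dir_deriv[OF \<phi>(1) b]] g(1)[OF b] H1_spaceD(3)[OF UH b], of n n]
          \<phi>(2)[of n] L2_norm_deriv_le_H1[OF b, of S "\<lambda>x. \<phi> n x - U n x"]
          L2_norm_weak_deriv_diff[OF S b has_weak_deriv_test[OF S b \<phi>(1)] H1_spaceD(2)[OF UH b], of n n] by linarith
      then show "\<forall>\<^sub>F n in sequentially. norm (L2_norm (leb_on S) (\<lambda>x. dir_deriv b (\<phi> n) x - g b x)) \<le> 1 / real (Suc n) + L2_norm (leb_on S) (\<lambda>x. ?D n x - g b x)"
        by simp
    qed
    have uH: "u \<in> H10_space S" and wd: "\<And>b. b \<in> Basis \<Longrightarrow> has_weak_deriv S b u (g b)"
      using H10_limitI[OF S \<phi>(1) u(1) 1 g(1) 2] by auto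
    have "(\<lambda>n. H1_norm S (\<lambda>x. U n x - u x)) \<longlonglongrightarrow> 0"
    proof (rule H1_norm_tendsto_0I[OF u(2)])
      fix b :: 'a assume b: "b \<in> Basis"
      show "(\<lambda>n. L2_norm (leb_on S) (weak_deriv S b (\<lambda>x. U n x - u x))) \<longlonglongrightarrow> 0"
        using g(2)[OF b] L2_norm_weak_deriv_diff[OF S b H1_spaceD(2)[OF UH b] wd[OF b]] by simp
    qed
    then show ?thesis using uH by blast
  qed
  then show ?thesis
    unfolding complete_pos_form_def complete_pos_form_axioms_def H1_norm_eq[OF S]
    using H10_pos_form[OF S] by blast
qed

section \<open>Compactness and the first Dirichlet eigenvalue\<close>

lemma test_functions_L2_lborel: "\<phi> \<in> test_functions S \<Longrightarrow> \<phi> \<in> L2_space lborel"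
  using test_functions_L2[of UNIV \<phi> S] by (simp add: L2_leb_on_iff)

lemma L2_norm_leb_on_test:
  assumes S: "open S" and z: "\<And>x. x \<notin> S \<Longrightarrow> f x = 0"
  shows "L2_norm (leb_on S) f = L2_norm lborel f"
  unfolding L2_norm_def using z by (subst integral_leb_on_test[OF S]) auto

lemma cmod_sum_mult_sq_le:
  fixes f :: "'i \<Rightarrow> complex"
  shows "(cmod (\<Sum>i\<in>I. complex_of_real (a i) * f i))\<^sup>2 \<le> (\<Sum>i\<in>I. (a i)\<^sup>2) * (\<Sum>i\<in>I. (cmod (f i))\<^sup>2)"
proof -
  have "cmod (\<Sum>i\<in>I. complex_of_real (a i) * f i) \<le> (\<Sum>i\<in>I. \<bar>a i\<bar> * cmod (f i))"
    by (rule order_trans[OF norm_sum]) (simp add: norm_mult)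
  then have "(cmod (\<Sum>i\<in>I. complex_of_real (a i) * f i))\<^sup>2 \<le> (\<Sum>i\<in>I. \<bar>a i\<bar> * cmod (f i))\<^sup>2"
    by (intro power_mono) auto
  also have "\<dots> \<le> (\<Sum>i\<in>I. \<bar>a i\<bar>\<^sup>2) * (\<Sum>i\<in>I. (cmod (f i))\<^sup>2)" by (rule Cauchy_Schwarz_ineq_sum)
  finally show ?thesis by simp
qed

lemma cmod_integral_sq_le:
  assumes f: "f \<in> L2_space M" and A: "A \<in> sets M" "emeasure M A < \<infinity>" and z: "\<And>x. x \<in> space M \<Longrightarrow> x \<notin> A \<Longrightarrow> f x = 0"
  shows "(cmod (\<integral>x. f x \<partial>M))\<^sup>2 \<le> measure M A * (\<integral>x. (cmod (f x))\<^sup>2 \<partial>M)"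
proof -
  let ?v = "\<lambda>x. complex_of_real (indicator A x)"
  have sq: "(cmod (?v x))\<^sup>2 = indicator A x" for x by (simp add: indicator_def)
  have v: "?v \<in> L2_space M" unfolding L2_space_def mem_Collect_eq sq
    using A by (auto intro!: borel_measurable_of_real)
  have "L2_inner M f ?v = (\<integral>x. f x \<partial>M)" unfolding L2_inner_def
    by (intro Bochner_Integration.integral_cong) (use z in \<open>auto simp: indicator_def\<close>)
  moreover have "(L2_norm M ?v)\<^sup>2 = measure M A" unfolding L2_norm_sq sq using A by simp
  moreover have "(cmod (L2_inner M f ?v))\<^sup>2 \<le> (L2_norm M f * L2_norm M ?v)\<^sup>2"
    by (intro power_mono L2.CS f v) simp
  ultimately show ?thesis by (simp add: power_mult_distrib L2_norm_sq mult.commute)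
qed

definition grad_sq :: "('a::euclidean_space \<Rightarrow> complex) \<Rightarrow> 'a \<Rightarrow> real" where
  "grad_sq \<phi> x = (\<Sum>b\<in>Basis. (cmod (dir_deriv b \<phi> x))\<^sup>2)"

lemma grad_sq_integrable: "\<phi> \<in> test_functions S \<Longrightarrow> integrable lborel (grad_sq \<phi>)"
  unfolding grad_sq_def
  by (intro Bochner_Integration.integrable_sum L2_spaceD(2) test_functions_L2_lborel test_functions_dir_deriv)

lemma grad_sq_nonneg: "0 \<le> grad_sq \<phi> x"
  by (simp add: grad_sq_def sum_nonneg)

text \<open>The increment is the integral of the derivative in direction z over a unit parameter
  interval. Cauchy-Schwarz moves the square inside, and integration over x removes the segment by
  translation invariance.\<close>

lemma translation_estimate:
  assumes \<phi>: "\<phi> \<in> test_functions S"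
  shows "(\<integral>x. (cmod (\<phi> (x + z) - \<phi> x))\<^sup>2 \<partial>lborel) \<le> (norm z)\<^sup>2 * (\<integral>x. grad_sq \<phi> x \<partial>lborel)"
proof -
  note sm = test_functionsD(1)[OF \<phi>]
  have dd: "continuous_on UNIV (dir_deriv b \<phi>)" if "b \<in> Basis" for b
    by (intro smooth_fun_continuous_on smooth_fun_dir_deriv sm that)
  have dz: "dir_deriv z \<phi> = (\<lambda>x. \<Sum>b\<in>Basis. complex_of_real (z \<bullet> b) * dir_deriv b \<phi> x)"
    using dir_deriv_expand[OF sm, of z] by auto
  have cz: "continuous_on UNIV (dir_deriv z \<phi>)" unfolding dz by (intro continuous_intros dd)
  have cg: "continuous_on UNIV (grad_sq \<phi>)" unfolding grad_sq_def by (intro continuous_intros dd)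
  have le: "(cmod (dir_deriv z \<phi> y))\<^sup>2 \<le> (norm z)\<^sup>2 * grad_sq \<phi> y" for y
  proof -
    have "(cmod (dir_deriv z \<phi> y))\<^sup>2 \<le> (\<Sum>b\<in>Basis. (z \<bullet> b)\<^sup>2) * grad_sq \<phi> y"
      unfolding dz grad_sq_def by (rule cmod_sum_mult_sq_le)
    also have "(\<Sum>b\<in>Basis. (z \<bullet> b)\<^sup>2) = (norm z)\<^sup>2"
      by (simp add: norm_eq_sqrt_inner euclidean_inner[of z z] power2_eq_square sum_nonneg)
    finally show ?thesis .
  qed
  have pt: "(cmod (\<phi> (x + z) - \<phi> x))\<^sup>2 \<le> (norm z)\<^sup>2 * (\<integral>s. indicator {0..1::real} s *\<^sub>R grad_sq \<phi> (x + s *\<^sub>R z) \<partial>lborel)" for x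
  proof -
    let ?h = "\<lambda>s::real. indicator {0..1} s *\<^sub>R dir_deriv z \<phi> (x + s *\<^sub>R z)"
    have c1: "continuous_on {0..1} (\<lambda>s. dir_deriv z \<phi> (x + s *\<^sub>R z))"
      "continuous_on {0..1} (\<lambda>s. grad_sq \<phi> (x + s *\<^sub>R z))"
      by (rule continuous_on_compose2[OF cz] continuous_on_compose2[OF cg]; auto intro!: continuous_intros)+
    have sq: "(cmod (?h s))\<^sup>2 = indicator {0..1} s *\<^sub>R (cmod (dir_deriv z \<phi> (x + s *\<^sub>R z)))\<^sup>2" for s
      by (simp add: indicator_def)
    have i1: "integrable lborel (\<lambda>s. (cmod (?h s))\<^sup>2)"
      unfolding sq by (intro borel_integrable_compact continuous_intros c1) simp
    have i2: "integrable lborel (\<lambda>s::real. indicator {0..1} s *\<^sub>R grad_sq \<phi> (x + s *\<^sub>R z))"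
      by (intro borel_integrable_compact c1) simp
    have i3: "integrable lborel ?h" by (intro borel_integrable_compact c1) simp
    have "?h \<in> L2_space lborel" using i1 i3 by (simp add: L2_space_def)
    then have "(cmod (\<integral>s. ?h s \<partial>lborel))\<^sup>2 \<le> measure lborel {0..1::real} * (\<integral>s. (cmod (?h s))\<^sup>2 \<partial>lborel)"
      by (rule cmod_integral_sq_le) auto
    also have "\<dots> = (\<integral>s. (cmod (?h s))\<^sup>2 \<partial>lborel)" by simp
    also have "\<dots> \<le> (\<integral>s. (norm z)\<^sup>2 * (indicator {0..1} s *\<^sub>R grad_sq \<phi> (x + s *\<^sub>R z)) \<partial>lborel)"
      by (intro integral_mono i1 integrable_mult_right i2) (use le in \<open>auto simp: indicator_def\<close>)
    also have "\<dots> = (norm z)\<^sup>2 * (\<integral>s. indicator {0..1::real} s *\<^sub>R grad_sq \<phi> (x + s *\<^sub>R z) \<partial>lborel)"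
      by (rule Bochner_Integration.integral_mult_right) (rule i2)
    finally show ?thesis unfolding segment_FTC[OF sm, of x z] .
  qed
  note avg = integral_segment_average[OF grad_sq_integrable[OF \<phi>], of z]
  have "(\<integral>x. (cmod (\<phi> (x + z) - \<phi> x))\<^sup>2 \<partial>lborel)
      \<le> (\<integral>x. (norm z)\<^sup>2 * (\<integral>s. indicator {0..1::real} s *\<^sub>R grad_sq \<phi> (x + s *\<^sub>R z) \<partial>lborel) \<partial>lborel)"
  proof (rule integral_mono[OF _ _ pt])
    have L: "\<phi> \<in> L2_space lborel" using test_functions_L2_lborel[OF \<phi>] .
    have "(\<lambda>x. \<phi> (x + z)) \<in> borel_measurable lborel"
      "integrable lborel (\<lambda>x. (cmod (\<phi> (x + z)))\<^sup>2)"
      using integrable_translate(1)[OF L2_spaceD(2)[OF L], of z] integrable_translate(1)[OF test_functions_integrable[OF \<phi>], of z]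
      by auto
    then have "(\<lambda>x. \<phi> (x + z)) \<in> L2_space lborel" by (simp add: L2_space_def)
    from L2_spaceD(2)[OF L2.diff[OF this L]] show "integrable lborel (\<lambda>x. (cmod (\<phi> (x + z) - \<phi> x))\<^sup>2)" .
    show "integrable lborel (\<lambda>x. (norm z)\<^sup>2 * (\<integral>s. indicator {0..1::real} s *\<^sub>R grad_sq \<phi> (x + s *\<^sub>R z) \<partial>lborel))"
      by (intro integrable_mult_right avg(1))
  qed
  also have "\<dots> = (norm z)\<^sup>2 * (\<integral>x. grad_sq \<phi> x \<partial>lborel)"
    using avg by simp
  finally show ?thesis .
qed

text \<open>Half-open at the upper faces, to match the rounding down in
  \<open>cell_index\<close>.\<close>

definition cell :: "real \<Rightarrow> 'a::euclidean_space \<Rightarrow> 'a set" where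
  "cell h p = {x. \<forall>b\<in>Basis. h * (p \<bullet> b) \<le> x \<bullet> b \<and> x \<bullet> b < h * (p \<bullet> b) + h}"

definition cell_index :: "real \<Rightarrow> 'a::euclidean_space \<Rightarrow> 'a" where
  "cell_index h x = (\<Sum>b\<in>Basis. of_int \<lfloor>x \<bullet> b / h\<rfloor> *\<^sub>R b)"

lemma cell_index_inner: "b \<in> Basis \<Longrightarrow> cell_index h x \<bullet> b = of_int \<lfloor>x \<bullet> b / h\<rfloor>"
  by (simp add: cell_index_def)

lemma in_cell_index: "h > 0 \<Longrightarrow> x \<in> cell h (cell_index h x)"
proof -
  assume h: "h > 0"
  have "h * of_int \<lfloor>x \<bullet> b / h\<rfloor> \<le> x \<bullet> b \<and> x \<bullet> b < h * of_int \<lfloor>x \<bullet> b / h\<rfloor> + h" for b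
  proof -
    have "of_int \<lfloor>x \<bullet> b / h\<rfloor> \<le> x \<bullet> b / h" "x \<bullet> b / h < of_int \<lfloor>x \<bullet> b / h\<rfloor> + 1" by linarith+
    then have "of_int \<lfloor>x \<bullet> b / h\<rfloor> * h \<le> x \<bullet> b" "x \<bullet> b < (of_int \<lfloor>x \<bullet> b / h\<rfloor> + 1) * h"
      using pos_le_divide_eq[OF h] pos_divide_less_eq[OF h] by blast+
    then show ?thesis by (simp add: distrib_left mult.commute)
  qed
  then show ?thesis by (simp add: cell_def cell_index_inner)
qed

lemma finite_cell_index:
  fixes S :: "'a::euclidean_space set"
  assumes "bounded S" "h > 0"
  shows "finite (cell_index h ` S)"
proof -
  obtain R where R: "\<And>x. x \<in> S \<Longrightarrow> norm x \<le> R" using assms(1) by (auto simp: bounded_iff)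
  let ?A = "(of_int ` {\<lfloor>- R / h\<rfloor> .. \<lfloor>R / h\<rfloor>}) :: real set"
  have "cell_index h x \<bullet> b \<in> ?A" if "x \<in> S" "b \<in> Basis" for x b
  proof -
    have "\<bar>x \<bullet> b\<bar> \<le> R" using R[OF that(1)] Basis_le_norm[OF that(2), of x] by linarith
    then have "- R \<le> x \<bullet> b" "x \<bullet> b \<le> R" by linarith+
    then have "- R / h \<le> x \<bullet> b / h" "x \<bullet> b / h \<le> R / h"
      using assms(2) by (intro divide_right_mono; simp)+
    then have "\<lfloor>x \<bullet> b / h\<rfloor> \<in> {\<lfloor>- R / h\<rfloor> .. \<lfloor>R / h\<rfloor>}" by (auto intro: floor_mono)
    then show ?thesis unfolding cell_index_inner[OF that(2)] by blast
  qed
  then have sub: "(\<lambda>p. restrict (\<lambda>b. p \<bullet> b) Basis) ` (cell_index h ` S) \<subseteq> Basis \<rightarrow>\<^sub>E ?A"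
    by (auto simp: PiE_def extensional_def Pi_def)
  have "finite (Basis \<rightarrow>\<^sub>E ?A :: ('a \<Rightarrow> real) set)" by (intro finite_PiE) auto
  then have "finite ((\<lambda>p. restrict (\<lambda>b. p \<bullet> b) Basis) ` (cell_index h ` S))" using sub by (rule finite_subset[rotated])
  moreover have "inj_on (\<lambda>p. restrict (\<lambda>b. p \<bullet> b) Basis) (cell_index h ` S)"
  proof (rule inj_onI)
    fix p q assume "restrict (\<lambda>b. p \<bullet> b) Basis = restrict (\<lambda>b. q \<bullet> b) (Basis :: 'a set)"
    then have *: "restrict (\<lambda>b. p \<bullet> b) Basis b = restrict (\<lambda>b. q \<bullet> b) (Basis :: 'a set) b" for b by (rule fun_cong)
    show "p = q"
    proof (rule euclidean_eqI)
      show "p \<bullet> b = q \<bullet> b" if "b \<in> Basis" for b using *[of b] that by simp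
    qed
  qed
  ultimately show ?thesis by (rule finite_imageD)
qed

lemma cell_measure:
  fixes p :: "'a::euclidean_space"
  assumes h: "h > 0"
  shows "cell h p \<in> sets borel" "emeasure lborel (cell h p) = ennreal (h ^ DIM('a))"
proof -
  have "cell h p = (\<Inter>b\<in>Basis. {x. h * (p \<bullet> b) \<le> x \<bullet> b} \<inter> {x. x \<bullet> b < h * (p \<bullet> b) + h})"
    by (auto simp: cell_def)
  also have "\<dots> \<in> sets borel"
    by (intro sets.finite_INT sets.Int borel_closed closed_halfspace_component_ge borel_open open_halfspace_component_lt)
       auto
  finally show m: "cell h p \<in> sets borel" .
  let ?l = "h *\<^sub>R p" and ?u = "h *\<^sub>R p + h *\<^sub>R One"
  have sub: "box ?l ?u \<subseteq> cell h p" "cell h p \<subseteq> cbox ?l ?u"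
    by (auto simp: cell_def mem_box inner_add_left less_imp_le)
  have lu: "?l \<bullet> b \<le> ?u \<bullet> b" "(?u - ?l) \<bullet> b = h" if "b \<in> Basis" for b
    using that h by (auto simp: inner_add_left)
  have "emeasure lborel (box ?l ?u) = ennreal (h ^ DIM('a))" "emeasure lborel (cbox ?l ?u) = ennreal (h ^ DIM('a))"
    using lu by (simp_all add: emeasure_lborel_box emeasure_lborel_cbox)
  moreover have "emeasure lborel (box ?l ?u) \<le> emeasure lborel (cell h p)"
    "emeasure lborel (cell h p) \<le> emeasure lborel (cbox ?l ?u)"
    by (intro emeasure_mono sub; simp add: m)+
  ultimately show "emeasure lborel (cell h p) = ennreal (h ^ DIM('a))" by simp
qed

text \<open>For \<open>x\<close> in a cell \<open>K\<close> of volume \<open>H\<close>, \<open>H \<phi>(x)\<close> is the integral of \<open>\<phi>\<close> over \<open>K\<close> minus that of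
  \<open>\<phi>(y) - \<phi>(x)\<close>, and the latter only involves translations of \<open>\<phi>\<close> by vectors of size \<open>O(h)\<close>.\<close>

lemma Rellich_estimate:
  fixes S :: "'a::euclidean_space set"
  assumes bd: "bounded S" and h: "h > 0" and \<phi>: "\<phi> \<in> test_functions S"
  shows "(\<integral>x. (cmod (\<phi> x))\<^sup>2 \<partial>lborel) \<le>
    2 / h ^ DIM('a) * (\<Sum>p\<in>cell_index h ` S. (cmod (\<integral>x. indicator (cell h p) x *\<^sub>R \<phi> x \<partial>lborel))\<^sup>2)
     + 2 * 2 ^ DIM('a) * (h * DIM('a))\<^sup>2 * (\<integral>x. grad_sq \<phi> x \<partial>lborel)"
proof -
  let ?n = "DIM('a)" and ?I = "cell_index h ` S"
  let ?B = "cbox (- (h *\<^sub>R One)) (h *\<^sub>R One) :: 'a set"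
  define H where "H = h ^ ?n"
  have H: "H > 0" using h by (simp add: H_def)
  define c where "c p = (\<integral>x. indicator (cell h p) x *\<^sub>R \<phi> x \<partial>lborel)" for p
  have L: "\<phi> \<in> L2_space lborel" using test_functions_L2_lborel[OF \<phi>] .
  have [measurable]: "\<phi> \<in> borel_measurable borel" using L2_spaceD(1)[OF L] by simp
  have [measurable]: "cell h p \<in> sets borel" for p :: 'a using cell_measure(1)[OF h] .
  have em: "emeasure lborel (cell h p) = ennreal H" and mc: "measure lborel (cell h p) = H" for p :: 'a
    using cell_measure(2)[OF h, of p] H unfolding H_def[symmetric] by (auto simp: measure_def)
  \<comment> \<open>If x and y share a cell, then y - x lies in the cube \<open>?B\<close>; so
    \<open>E x\<close> dominates the squared increments over the cell of x, whichever cell that is.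
    As a nonnegative integral it allows exchanging the order of integration before finiteness is
    known.\<close>
  define E where "E x = (\<integral>\<^sup>+z. indicator ?B z * ennreal ((cmod (\<phi> (x + z) - \<phi> x))\<^sup>2) \<partial>lborel)" for x
  \<comment> \<open>H \<phi>(x) is split as described above; the square of the sum costs a factor 2,
    Cauchy-Schwarz over a cell of measure H costs a factor H, and dividing by H^2 leaves 2 / H^2 and
    2 / H.\<close>
  have pt: "ennreal ((cmod (\<phi> x))\<^sup>2) \<le> ennreal (\<Sum>p\<in>?I. 2 / H\<^sup>2 * (cmod (c p))\<^sup>2 * indicator (cell h p) x) + ennreal (2 / H) * E x" for x
  proof (cases "x \<in> S")
    case False
    then show ?thesis using test_function_zero[OF \<phi>] by simp
  next
    case True
    define p where "p = cell_index h x"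
    have p: "p \<in> ?I" "x \<in> cell h p" using True in_cell_index[OF h] by (auto simp: p_def)
    let ?f = "\<lambda>y. indicator (cell h p) y *\<^sub>R (\<phi> y - \<phi> x)"
    have i1: "integrable lborel (\<lambda>y. indicator (cell h p) y *\<^sub>R \<phi> y)"
      by (intro integrable_mult_indicator test_functions_integrable[OF \<phi>]) simp
    have i2: "integrable lborel (\<lambda>y. indicator (cell h p) y *\<^sub>R \<phi> x)"
      using em[of p] by (intro integrable_scaleR_left) (auto simp: integrable_indicator_iff)
    have fL: "?f \<in> L2_space lborel"
    proof -
      have "(\<lambda>y. complex_of_real (indicator (cell h p) y) * \<phi> y) \<in> L2_space lborel"
        by (rule L2_mult_bounded(1)[OF L, where K=1]) (auto intro!: borel_measurable_of_real)
      moreover have "(\<lambda>y. complex_of_real (indicator (cell h p) y)) \<in> L2_space lborel"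
      proof -
        have "(cmod (complex_of_real (indicator (cell h p) y)))\<^sup>2 = indicator (cell h p) y" for y by (simp add: indicator_def)
        then show ?thesis using em[of p] by (simp add: L2_space_def integrable_indicator_iff)
      qed
      ultimately have "(\<lambda>y. complex_of_real (indicator (cell h p) y) * \<phi> y + (- \<phi> x) * complex_of_real (indicator (cell h p) y)) \<in> L2_space lborel"
        by (rule L2.lin)
      then show ?thesis by (simp add: scaleR_conv_of_real algebra_simps)
    qed
    have "(\<integral>y. ?f y \<partial>lborel) = c p - H *\<^sub>R \<phi> x"
    proof -
      have "integrable lborel (\<lambda>y. indicator (cell h p) y :: real)"
        using em[of p] by (simp add: integrable_indicator_iff)
      then have "(\<integral>y. indicator (cell h p) y *\<^sub>R \<phi> x \<partial>lborel) = H *\<^sub>R \<phi> x"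
        using mc[of p] by (subst Bochner_Integration.integral_scaleR_left) auto
      then show ?thesis using i1 i2 by (simp add: scaleR_diff_right c_def)
    qed
    then have "H *\<^sub>R \<phi> x = c p - (\<integral>y. ?f y \<partial>lborel)" by simp
    then have "H * cmod (\<phi> x) \<le> cmod (c p) + cmod (\<integral>y. ?f y \<partial>lborel)"
      using H norm_triangle_ineq4[of "c p" "\<integral>y. ?f y \<partial>lborel"] by (metis abs_of_pos norm_scaleR)
    then have "(H * cmod (\<phi> x))\<^sup>2 \<le> (cmod (c p) + cmod (\<integral>y. ?f y \<partial>lborel))\<^sup>2"
      using H by (intro power_mono) auto
    also have "\<dots> \<le> 2 * (cmod (c p))\<^sup>2 + 2 * (cmod (\<integral>y. ?f y \<partial>lborel))\<^sup>2"
      using sum_squares_bound[of "cmod (c p)" "cmod (\<integral>y. ?f y \<partial>lborel)"] by (simp add: power2_sum)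
    also have "(cmod (\<integral>y. ?f y \<partial>lborel))\<^sup>2 \<le> H * (\<integral>y. (cmod (?f y))\<^sup>2 \<partial>lborel)"
      using cmod_integral_sq_le[OF fL, of "cell h p"] mc[of p] em[of p] by simp
    finally have "H\<^sup>2 * (cmod (\<phi> x))\<^sup>2 \<le> 2 * (cmod (c p))\<^sup>2 + 2 * (H * (\<integral>y. (cmod (?f y))\<^sup>2 \<partial>lborel))"
      by (simp add: power_mult_distrib)
    then have "(cmod (\<phi> x))\<^sup>2 \<le> 2 / H\<^sup>2 * (cmod (c p))\<^sup>2 + 2 / H * (\<integral>y. (cmod (?f y))\<^sup>2 \<partial>lborel)"
      using H by (simp add: field_simps power2_eq_square)
    then have 1: "ennreal ((cmod (\<phi> x))\<^sup>2) \<le> ennreal (2 / H\<^sup>2 * (cmod (c p))\<^sup>2) + ennreal (2 / H) * ennreal (\<integral>y. (cmod (?f y))\<^sup>2 \<partial>lborel)"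
      using H by (simp add: ennreal_leI flip: ennreal_plus ennreal_mult)
    have "ennreal (\<integral>y. (cmod (?f y))\<^sup>2 \<partial>lborel) = (\<integral>\<^sup>+y. ennreal ((cmod (?f y))\<^sup>2) \<partial>lborel)"
      using L2_spaceD(2)[OF fL] by (subst nn_integral_eq_integral) auto
    also have "\<dots> = (\<integral>\<^sup>+y. ennreal ((cmod (?f y))\<^sup>2) \<partial>distr lborel borel ((+) x))"
      by (simp add: lborel_distr_plus)
    also have "\<dots> = (\<integral>\<^sup>+z. ennreal ((cmod (?f (x + z)))\<^sup>2) \<partial>lborel)"
      by (rule nn_integral_distr) measurable
    also have "\<dots> \<le> E x"
      unfolding E_def
    proof (rule nn_integral_mono)
      fix z
      show "ennreal ((cmod (?f (x + z)))\<^sup>2) \<le> indicator ?B z * ennreal ((cmod (\<phi> (x + z) - \<phi> x))\<^sup>2)"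
      proof (cases "x + z \<in> cell h p")
        case True
        have "- h \<le> z \<bullet> b \<and> z \<bullet> b \<le> h" if "b \<in> Basis" for b
          using True p(2) that unfolding cell_def by (fastforce simp: inner_add_left)
        then have "z \<in> ?B" by (auto simp: mem_box inner_minus_left)
        then show ?thesis using True by simp
      qed simp
    qed
    finally have 2: "ennreal (2 / H) * ennreal (\<integral>y. (cmod (?f y))\<^sup>2 \<partial>lborel) \<le> ennreal (2 / H) * E x"
      by (rule mult_left_mono) simp
    have "2 / H\<^sup>2 * (cmod (c p))\<^sup>2 * indicator (cell h p) x \<le> (\<Sum>p\<in>?I. 2 / H\<^sup>2 * (cmod (c p))\<^sup>2 * indicator (cell h p) x)"
      using p finite_cell_index[OF bd h] H by (intro member_le_sum) auto
    then have 3: "ennreal (2 / H\<^sup>2 * (cmod (c p))\<^sup>2) \<le> ennreal (\<Sum>p\<in>?I. 2 / H\<^sup>2 * (cmod (c p))\<^sup>2 * indicator (cell h p) x)"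
      using p by (intro ennreal_leI) simp
    from order_trans[OF 1 add_mono[OF 3 2]] show ?thesis .
  qed
  have Em: "E \<in> borel_measurable lborel" unfolding E_def by measurable
  have fin: "finite ?I" by (rule finite_cell_index[OF bd h])
  have g0: "0 \<le> (\<integral>x. grad_sq \<phi> x \<partial>lborel)" by (intro Bochner_Integration.integral_nonneg grad_sq_nonneg)
  \<comment> \<open>For fixed z the x-integral is bounded by \<open>translation_estimate\<close>
    with norm z at most h times the dimension. The volume of \<open>?B\<close> is (2 h)^n; divided
    by H = h^n it becomes the factor 2^n of the final bound.\<close>
  have EI: "(\<integral>\<^sup>+x. E x \<partial>lborel) \<le> ennreal ((2 * h) ^ ?n * ((h * ?n)\<^sup>2 * (\<integral>x. grad_sq \<phi> x \<partial>lborel)))"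
  proof -
    have "(\<integral>\<^sup>+x. E x \<partial>lborel) = (\<integral>\<^sup>+z. (\<integral>\<^sup>+x. indicator ?B z * ennreal ((cmod (\<phi> (x + z) - \<phi> x))\<^sup>2) \<partial>lborel) \<partial>lborel)"
      unfolding E_def by (rule lborel_pair.Fubini'[symmetric]) measurable
    also have "\<dots> \<le> (\<integral>\<^sup>+z. indicator ?B z * ennreal ((h * ?n)\<^sup>2 * (\<integral>x. grad_sq \<phi> x \<partial>lborel)) \<partial>lborel)"
    proof (rule nn_integral_mono)
      fix z :: 'a
      show "(\<integral>\<^sup>+x. indicator ?B z * ennreal ((cmod (\<phi> (x + z) - \<phi> x))\<^sup>2) \<partial>lborel)
         \<le> indicator ?B z * ennreal ((h * ?n)\<^sup>2 * (\<integral>x. grad_sq \<phi> x \<partial>lborel))"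
      proof (cases "z \<in> ?B")
        case True
        then have "\<bar>z \<bullet> b\<bar> \<le> h" if "b \<in> Basis" for b
          using that by (auto simp: mem_box inner_minus_left abs_le_iff)
        then have "norm z \<le> (\<Sum>b\<in>(Basis::'a set). h)"
          by (intro order_trans[OF norm_le_l1] sum_mono) auto
        then have nz: "norm z \<le> h * ?n" by (simp add: mult.commute)
        have "(\<lambda>x. \<phi> (x + z)) \<in> L2_space lborel"
          using integrable_translate(1)[OF L2_spaceD(2)[OF L], of z] by (simp add: L2_space_def)
        then have "integrable lborel (\<lambda>x. (cmod (\<phi> (x + z) - \<phi> x))\<^sup>2)"
          by (intro L2_spaceD(2) L2.diff L)
        then have "(\<integral>\<^sup>+x. ennreal ((cmod (\<phi> (x + z) - \<phi> x))\<^sup>2) \<partial>lborel) = ennreal (\<integral>x. (cmod (\<phi> (x + z) - \<phi> x))\<^sup>2 \<partial>lborel)"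
          by (intro nn_integral_eq_integral) auto
        also have "\<dots> \<le> ennreal ((norm z)\<^sup>2 * (\<integral>x. grad_sq \<phi> x \<partial>lborel))"
          by (intro ennreal_leI translation_estimate[OF \<phi>])
        also have "\<dots> \<le> ennreal ((h * ?n)\<^sup>2 * (\<integral>x. grad_sq \<phi> x \<partial>lborel))"
          by (intro ennreal_leI mult_right_mono power_mono nz g0) simp
        finally show ?thesis using True by simp
      qed simp
    qed
    also have "\<dots> = emeasure lborel ?B * ennreal ((h * ?n)\<^sup>2 * (\<integral>x. grad_sq \<phi> x \<partial>lborel))"
      by (subst nn_integral_multc) auto
    also have "emeasure lborel ?B = ennreal ((2 * h) ^ ?n)"
    proof -
      have "emeasure lborel ?B = ennreal (\<Prod>b\<in>(Basis::'a set). (h *\<^sub>R One - - (h *\<^sub>R One)) \<bullet> b)"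
        by (rule emeasure_lborel_cbox) (use h in \<open>simp add: inner_minus_left\<close>)
      also have "(\<Prod>b\<in>(Basis::'a set). (h *\<^sub>R One - - (h *\<^sub>R One)) \<bullet> b) = (\<Prod>b\<in>(Basis::'a set). 2 * h)"
        by (rule prod.cong) (simp_all add: inner_diff_left inner_minus_left inner_add_left)
      finally show ?thesis by simp
    qed
    finally show ?thesis using h g0 by (simp add: ennreal_mult)
  qed
  have "ennreal (\<integral>x. (cmod (\<phi> x))\<^sup>2 \<partial>lborel) = (\<integral>\<^sup>+x. ennreal ((cmod (\<phi> x))\<^sup>2) \<partial>lborel)"
    using L2_spaceD(2)[OF L] by (subst nn_integral_eq_integral) auto
  also have "\<dots> \<le> (\<integral>\<^sup>+x. ennreal (\<Sum>p\<in>?I. 2 / H\<^sup>2 * (cmod (c p))\<^sup>2 * indicator (cell h p) x) + ennreal (2 / H) * E x \<partial>lborel)"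
    by (rule nn_integral_mono) (rule pt)
  also have "\<dots> = (\<integral>\<^sup>+x. ennreal (\<Sum>p\<in>?I. 2 / H\<^sup>2 * (cmod (c p))\<^sup>2 * indicator (cell h p) x) \<partial>lborel) + ennreal (2 / H) * (\<integral>\<^sup>+x. E x \<partial>lborel)"
    using Em by (subst nn_integral_add) (auto simp: nn_integral_cmult)
  also have "(\<integral>\<^sup>+x. ennreal (\<Sum>p\<in>?I. 2 / H\<^sup>2 * (cmod (c p))\<^sup>2 * indicator (cell h p) x) \<partial>lborel)
      = ennreal (2 / H * (\<Sum>p\<in>?I. (cmod (c p))\<^sup>2))"
  proof -
    have i: "integrable lborel (\<lambda>x. 2 / H\<^sup>2 * (cmod (c p))\<^sup>2 * indicator (cell h p) x)" for p
      using em[of p] by (intro integrable_mult_right) (auto simp: integrable_indicator_iff)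
    have "(\<integral>\<^sup>+x. ennreal (\<Sum>p\<in>?I. 2 / H\<^sup>2 * (cmod (c p))\<^sup>2 * indicator (cell h p) x) \<partial>lborel)
       = ennreal (\<integral>x. (\<Sum>p\<in>?I. 2 / H\<^sup>2 * (cmod (c p))\<^sup>2 * indicator (cell h p) x) \<partial>lborel)"
      using H by (intro nn_integral_eq_integral Bochner_Integration.integrable_sum i) (auto intro!: sum_nonneg)
    also have "(\<integral>x. (\<Sum>p\<in>?I. 2 / H\<^sup>2 * (cmod (c p))\<^sup>2 * indicator (cell h p) x) \<partial>lborel)
       = (\<Sum>p\<in>?I. 2 / H\<^sup>2 * (cmod (c p))\<^sup>2 * H)"
      using i mc by (subst Bochner_Integration.integral_sum) auto
    also have "\<dots> = 2 / H * (\<Sum>p\<in>?I. (cmod (c p))\<^sup>2)"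
      using H by (simp add: sum_distrib_left power2_eq_square)
    finally show ?thesis .
  qed
  also have "ennreal (2 / H * (\<Sum>p\<in>?I. (cmod (c p))\<^sup>2)) + ennreal (2 / H) * (\<integral>\<^sup>+x. E x \<partial>lborel)
     \<le> ennreal (2 / H * (\<Sum>p\<in>?I. (cmod (c p))\<^sup>2)) + ennreal (2 / H) * ennreal ((2 * h) ^ ?n * ((h * ?n)\<^sup>2 * (\<integral>x. grad_sq \<phi> x \<partial>lborel)))"
    by (intro add_left_mono mult_left_mono EI) simp
  also have "\<dots> = ennreal (2 / H * (\<Sum>p\<in>?I. (cmod (c p))\<^sup>2) + 2 / H * ((2 * h) ^ ?n * ((h * ?n)\<^sup>2 * (\<integral>x. grad_sq \<phi> x \<partial>lborel))))"
    using H h g0 by (simp add: ennreal_mult[symmetric] ennreal_plus[symmetric] sum_nonneg del: ennreal_plus)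
  finally have "(\<integral>x. (cmod (\<phi> x))\<^sup>2 \<partial>lborel) \<le> 2 / H * (\<Sum>p\<in>?I. (cmod (c p))\<^sup>2) + 2 / H * ((2 * h) ^ ?n * ((h * ?n)\<^sup>2 * (\<integral>x. grad_sq \<phi> x \<partial>lborel)))"
  proof (subst (asm) ennreal_le_iff)
    have "0 \<le> (\<Sum>p\<in>?I. (cmod (c p))\<^sup>2)" by (rule sum_nonneg) simp
    then show "0 \<le> 2 / H * (\<Sum>p\<in>?I. (cmod (c p))\<^sup>2) + 2 / H * ((2 * h) ^ ?n * ((h * ?n)\<^sup>2 * (\<integral>x. grad_sq \<phi> x \<partial>lborel)))"
      using H h g0 by (intro add_nonneg_nonneg mult_nonneg_nonneg) auto
  qed
  also have "2 / H * ((2 * h) ^ ?n * ((h * ?n)\<^sup>2 * (\<integral>x. grad_sq \<phi> x \<partial>lborel))) = 2 * 2 ^ ?n * (h * ?n)\<^sup>2 * (\<integral>x. grad_sq \<phi> x \<partial>lborel)"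
    using H unfolding H_def power_mult_distrib[of 2 h] by simp
  finally show ?thesis unfolding H_def c_def .
qed


section \<open>The Dirichlet energy and its minimiser\<close>

definition grad_inner :: "'a::euclidean_space set \<Rightarrow> ('a \<Rightarrow> complex) \<Rightarrow> ('a \<Rightarrow> complex) \<Rightarrow> complex" where
  "grad_inner S u v = (\<Sum>b\<in>Basis. L2_inner (leb_on S) (weak_deriv S b u) (weak_deriv S b v))"

lemma H10_L2_pos_form:
  assumes S: "open S"
  shows "pos_form (H10_space S) (L2_inner (leb_on S))"
  by (rule pos_form_subspace[OF L2_pos_form])
     (use H1_spaceD(1) H10_spaceD H10_lin[OF S] test_functions_H10[OF S test_functions_zero] in auto)

lemma H10_grad_pos_form:
  assumes S: "open S"
  shows "pos_form (H10_space S) (grad_inner S)"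
  unfolding grad_inner_def
proof (rule pos_form_sum)
  fix b :: 'a assume b: "b \<in> Basis"
  show "pos_form (H10_space S) (\<lambda>u v. L2_inner (leb_on S) (weak_deriv S b u) (weak_deriv S b v))"
    by (rule pos_form_pullback[OF H10_lin[OF S] test_functions_H10[OF S test_functions_zero]
          H1_spaceD(3)[OF H10_spaceD b] weak_deriv_lin[OF S H10_spaceD H10_spaceD b]])
qed auto

definition grad_norm :: "'a::euclidean_space set \<Rightarrow> ('a \<Rightarrow> complex) \<Rightarrow> real" where
  "grad_norm S u = sqrt (\<Sum>b\<in>Basis. (L2_norm (leb_on S) (weak_deriv S b u))\<^sup>2)"

lemma L2_inner_self: "L2_inner M u u = complex_of_real ((L2_norm M u)\<^sup>2)"
  unfolding L2_inner_def complex_norm_square[symmetric] L2_norm_sq by (rule integral_complex_of_real)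

lemma grad_norm_eq:
  assumes S: "open S"
  shows "pos_form.N (grad_inner S) = grad_norm S"
proof
  fix u
  show "pos_form.N (grad_inner S) u = grad_norm S u"
    unfolding pos_form.N_def[OF H10_grad_pos_form[OF S]] grad_inner_def grad_norm_def L2_inner_self by simp
qed

lemma grad_norm_nonneg [simp]: "0 \<le> grad_norm S u"
  by (simp add: grad_norm_def sum_nonneg)

lemma grad_norm_sq: "(grad_norm S u)\<^sup>2 = (\<Sum>b\<in>Basis. (L2_norm (leb_on S) (weak_deriv S b u))\<^sup>2)"
  by (simp add: grad_norm_def sum_nonneg)

lemma H1_norm_sq_grad: "(H1_norm S u)\<^sup>2 = (L2_norm (leb_on S) u)\<^sup>2 + (grad_norm S u)\<^sup>2"
  by (simp add: H1_norm_sq grad_norm_sq)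

lemma grad_norm_le_H1: "grad_norm S u \<le> H1_norm S u"
  by (rule power2_le_imp_le) (simp_all add: H1_norm_sq_grad)

lemma grad_norm_test:
  assumes S: "open S" and \<phi>: "\<phi> \<in> test_functions S"
  shows "(grad_norm S \<phi>)\<^sup>2 = (\<integral>x. grad_sq \<phi> x \<partial>lborel)"
proof -
  have "(L2_norm (leb_on S) (weak_deriv S b \<phi>))\<^sup>2 = (\<integral>x. (cmod (dir_deriv b \<phi> x))\<^sup>2 \<partial>lborel)" if b: "b \<in> Basis" for b
  proof -
    have t: "dir_deriv b \<phi> \<in> test_functions S" by (rule test_functions_dir_deriv[OF \<phi> b])
    have "L2_norm (leb_on S) (weak_deriv S b \<phi>) = L2_norm (leb_on S) (dir_deriv b \<phi>)"
      by (intro L2_norm_cong_AE weak_deriv_test_AE[OF S b \<phi>] L2_spaceD(1) H1_spaceD(3)[OF test_functions_H1[OF S \<phi>] b]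
          test_functions_L2[OF S t])
    also have "\<dots> = L2_norm lborel (dir_deriv b \<phi>)"
      by (rule L2_norm_leb_on_test[OF S test_function_zero[OF t]])
    finally show ?thesis by (simp add: L2_norm_sq)
  qed
  then have "(grad_norm S \<phi>)\<^sup>2 = (\<Sum>b\<in>Basis. \<integral>x. (cmod (dir_deriv b \<phi> x))\<^sup>2 \<partial>lborel)"
    by (simp add: grad_norm_sq)
  also have "\<dots> = (\<integral>x. grad_sq \<phi> x \<partial>lborel)"
    unfolding grad_sq_def
    by (rule Bochner_Integration.integral_sum[symmetric])
       (intro L2_spaceD(2) test_functions_L2_lborel[OF test_functions_dir_deriv[OF \<phi>]])
  finally show ?thesis .
qed

text \<open>Compactness in finite form: up to e times the energy, the L^2 norm is controlled by
  finitely many bounded functionals, namely the integrals over grid cells. Along a bounded sequence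
  finitely many scalar sequences can be made convergent.\<close>

lemma Rellich_inequality:
  fixes S :: "'a::euclidean_space set"
  assumes S: "open S" "bounded S" and e: "e > 0"
  obtains I :: "'a set" and K C where "finite I" "C \<ge> 0" "\<And>p. p \<in> I \<Longrightarrow> K p \<in> L2_space (leb_on S)"
    "\<And>\<phi>. \<phi> \<in> test_functions S \<Longrightarrow> (L2_norm (leb_on S) \<phi>)\<^sup>2 \<le>
       C * (\<Sum>p\<in>I. (cmod (L2_inner (leb_on S) \<phi> (K p)))\<^sup>2) + e * (grad_norm S \<phi>)\<^sup>2"
proof -
  let ?n = "DIM('a)"
  define k where "k = 2 * 2 ^ ?n * (real ?n)\<^sup>2"
  have k: "k \<ge> 0" by (simp add: k_def)
  \<comment> \<open>The energy term of \<open>Rellich_estimate\<close> has the coefficient k h^2;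
    this mesh size makes it at most e.\<close>
  define h where "h = sqrt (e / (k + 1))"
  have h: "h > 0" and hk: "k * h\<^sup>2 \<le> e"
    using e k by (auto simp: h_def field_simps)
  have fin: "finite (cell_index h ` S)" by (rule finite_cell_index[OF S(2) h])
  show ?thesis
  proof (rule that[of "cell_index h ` S" "2 / h ^ ?n" "\<lambda>p x. complex_of_real (indicator (cell h p) x)"])
    show "finite (cell_index h ` S)" by fact
    show "2 / h ^ ?n \<ge> 0" using h by simp
    show "(\<lambda>x. complex_of_real (indicator (cell h p) x)) \<in> L2_space (leb_on S)" for p
    proof -
      have "(cmod (complex_of_real (indicator (cell h p) y)))\<^sup>2 = indicator (cell h p) y" for y by (simp add: indicator_def)
      then have "(\<lambda>x. complex_of_real (indicator (cell h p) x)) \<in> L2_space lborel"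
        using cell_measure[OF h, of p] by (simp add: L2_space_def integrable_indicator_iff)
      then have "(\<lambda>x. complex_of_real (indicator S x) * complex_of_real (indicator (cell h p) x)) \<in> L2_space lborel"
        by (rule L2_mult_bounded(1)[where K=1]) (use S in \<open>auto intro!: borel_measurable_of_real\<close>)
      then show ?thesis by (simp add: L2_leb_on_iff[OF S(1)] scaleR_conv_of_real)
    qed
    fix \<phi> assume \<phi>: "\<phi> \<in> test_functions S"
    have g0: "0 \<le> (\<integral>x. grad_sq \<phi> x \<partial>lborel)" by (intro Bochner_Integration.integral_nonneg grad_sq_nonneg)
    have "L2_inner (leb_on S) \<phi> (\<lambda>x. complex_of_real (indicator (cell h p) x)) = (\<integral>x. indicator (cell h p) x *\<^sub>R \<phi> x \<partial>lborel)" for p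
      unfolding L2_inner_def using test_function_zero[OF \<phi>]
      by (subst integral_leb_on_test[OF S(1)]) (auto simp: scaleR_conv_of_real mult.commute)
    moreover have "(L2_norm (leb_on S) \<phi>)\<^sup>2 = (\<integral>x. (cmod (\<phi> x))\<^sup>2 \<partial>lborel)"
      using L2_norm_leb_on_test[OF S(1) test_function_zero[OF \<phi>]] by (simp add: L2_norm_sq)
    moreover have "2 * 2 ^ ?n * (h * ?n)\<^sup>2 * (\<integral>x. grad_sq \<phi> x \<partial>lborel) \<le> e * (grad_norm S \<phi>)\<^sup>2"
      unfolding grad_norm_test[OF S(1) \<phi>]
      using hk by (intro mult_right_mono g0) (simp add: k_def power_mult_distrib mult_ac)
    ultimately show "(L2_norm (leb_on S) \<phi>)\<^sup>2 \<le>
       2 / h ^ ?n * (\<Sum>p\<in>cell_index h ` S. (cmod (L2_inner (leb_on S) \<phi> (\<lambda>x. complex_of_real (indicator (cell h p) x))))\<^sup>2) + e * (grad_norm S \<phi>)\<^sup>2"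
      using Rellich_estimate[OF S(2) h \<phi>] by simp
  qed
qed

lemma finite_family_convergent_subsequence:
  fixes c :: "'i \<Rightarrow> nat \<Rightarrow> complex"
  assumes "finite I" "\<And>i. i \<in> I \<Longrightarrow> bounded (range (c i))"
  shows "\<exists>r. strict_mono r \<and> (\<forall>i\<in>I. convergent (\<lambda>n. c i (r n)))"
  using assms
proof (induction I rule: finite_induct)
  case empty
  show ?case by (intro exI[of _ id]) (auto simp: strict_mono_def)
next
  case (insert i I)
  then obtain r where r: "strict_mono r" "\<And>j. j \<in> I \<Longrightarrow> convergent (\<lambda>n. c j (r n))" by auto
  have "bounded (range (c i))" using insert by simp
  then have "bounded (range (\<lambda>n. c i (r n)))" by (rule bounded_subset) auto
  from bounded_imp_convergent_subsequence[OF this]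
  obtain l s where s: "strict_mono s" "((\<lambda>n. c i (r n)) \<circ> s) \<longlonglongrightarrow> l" by auto
  have "convergent (\<lambda>n. c j (r (s n)))" if "j \<in> insert i I" for j
  proof (cases "j = i")
    case True
    then show ?thesis using s by (auto simp: convergent_def o_def)
  next
    case False
    then have "convergent (\<lambda>n. c j (r n))" using r that by simp
    from convergent_subseq_convergent[OF this s(1)] show ?thesis by (simp add: o_def)
  qed
  then show ?case using strict_mono_o[OF r(1) s(1)] by (intro exI[of _ "r \<circ> s"]) (auto simp: o_def)
qed

lemma exists_normalised_test_function:
  fixes S :: "'a::euclidean_space set"
  assumes S: "open S" "S \<noteq> {}"
  shows "\<exists>\<phi>\<in>test_functions S. L2_norm (leb_on S) \<phi> = 1"
proof -
  obtain x where "x \<in> S" using S by blast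
  then obtain a b where ab: "x \<in> box a b" "cbox a b \<subseteq> S" "\<forall>i\<in>Basis. a \<bullet> i < b \<bullet> i"
    by (rule open_contains_cbox[OF S(1)])
  let ?\<phi> = "\<lambda>x. complex_of_real (box_bump a b 1 x)"
  have \<phi>: "?\<phi> \<in> test_functions S" using test_functions_box_bump[OF ab(2), of 1] by simp
  have L: "?\<phi> \<in> L2_space (leb_on S)" by (rule test_functions_L2[OF S(1) \<phi>])
  have "L2_norm (leb_on S) ?\<phi> \<noteq> 0"
  proof
    assume "L2_norm (leb_on S) ?\<phi> = 0"
    then have "AE x in leb_on S. ?\<phi> x = 0" using L2_norm_zero_iff[OF L] by simp
    then have "AE x in lborel. x \<in> S \<longrightarrow> ?\<phi> x = 0" by (simp add: AE_leb_on[OF S(1)])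
    then have "AE x in lborel. x \<notin> box a b"
    proof eventually_elim
      case (elim x)
      then show ?case using box_bump_pos_iff[of 1 a b x] ab(2) box_subset_cbox[of a b] by auto
    qed
    then have "emeasure lborel (box a b) = 0"
      by (subst (asm) AE_iff_null_sets[symmetric]) (auto simp: null_sets_def)
    moreover have "0 < (\<Prod>i\<in>Basis. (b - a) \<bullet> i)"
      using ab(3) by (intro prod_pos) (simp add: inner_diff_left)
    moreover have "emeasure lborel (box a b) = ennreal (\<Prod>i\<in>Basis. (b - a) \<bullet> i)"
      using ab(3) by (intro emeasure_lborel_box) (auto simp: less_imp_le)
    ultimately show False by (simp only: ennreal_eq_0_iff)
  qed
  then have p: "L2_norm (leb_on S) ?\<phi> > 0" using L2_norm_ge_0[of "leb_on S" ?\<phi>] by linarith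
  let ?c = "complex_of_real (1 / L2_norm (leb_on S) ?\<phi>)"
  have "L2_norm (leb_on S) (\<lambda>x. ?c * ?\<phi> x) = cmod ?c * L2_norm (leb_on S) ?\<phi>"
    by (rule L2.N_scale[OF L])
  also have "\<dots> = 1" using p by (simp add: norm_divide)
  finally have 1: "L2_norm (leb_on S) (\<lambda>x. ?c * ?\<phi> x) = 1" .
  have "(\<lambda>x. 0 + ?c * ?\<phi> x) \<in> test_functions S" by (intro test_functions_lin test_functions_zero \<phi>)
  then show ?thesis using 1 by (intro bexI[of _ "\<lambda>x. ?c * ?\<phi> x"]) simp_all
qed

text \<open>Along a minimising sequence the parallelogram law bounds the energy of differences by the
  \<open>L\<^sup>2\<close> norm, and the Rellich inequality bounds the latter by finitely many functionals up to a
  small multiple of the energy, so that the sequence is Cauchy in \<open>H\<^sup>1\<close>.\<close>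

theorem first_eigenfunction:
  fixes S :: "'a::euclidean_space set"
  assumes S: "open S" "bounded S" "S \<noteq> {}"
  obtains \<mu> u where "\<mu> \<ge> 0" "u \<in> H10_space S" "L2_norm (leb_on S) u = 1"
    "\<And>v. v \<in> H10_space S \<Longrightarrow> grad_inner S u v = complex_of_real \<mu> * L2_inner (leb_on S) u v"
    "\<And>v. v \<in> H10_space S \<Longrightarrow> \<mu> * (L2_norm (leb_on S) v)\<^sup>2 \<le> (grad_norm S v)\<^sup>2"
proof -
  interpret H: complete_pos_form "H10_space S" "H1_inner S"
    rewrites "pos_form.N (H1_inner S) = H1_norm S"
    by (rule H10_complete[OF S(1)], rule H1_norm_eq[OF S(1)])
  interpret G: pos_form "H10_space S" "grad_inner S"
    rewrites "pos_form.N (grad_inner S) = grad_norm S"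
    by (rule H10_grad_pos_form[OF S(1)], rule grad_norm_eq[OF S(1)])
  interpret L: pos_form "H10_space S" "L2_inner (leb_on S)"
    rewrites "pos_form.N (L2_inner (leb_on S)) = L2_norm (leb_on S)"
    by (rule H10_L2_pos_form[OF S(1)], rule L2_norm_eq)
  let ?N = "L2_norm (leb_on S)" and ?G = "grad_norm S"
  note tH = test_functions_H10[OF S(1)]
  \<comment> \<open>The infimum is taken over test functions, for which the Rellich inequality is
    stated; density extends the lower bound to the whole space in \<open>le\<close>.\<close>
  define A where "A = {(?G \<phi>)\<^sup>2 | \<phi>. \<phi> \<in> test_functions S \<and> ?N \<phi> = 1}"
  define \<mu> where "\<mu> = Inf A"
  have Ane: "A \<noteq> {}" using exists_normalised_test_function[OF S(1,3)] by (auto simp: A_def)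
  have Abd: "bdd_below A" by (rule bdd_belowI[of _ 0]) (auto simp: A_def)
  have \<mu>0: "\<mu> \<ge> 0" unfolding \<mu>_def by (rule cInf_greatest[OF Ane]) (auto simp: A_def)
  have test_le: "\<mu> * (?N \<phi>)\<^sup>2 \<le> (?G \<phi>)\<^sup>2" if \<phi>: "\<phi> \<in> test_functions S" for \<phi>
  proof (cases "?N \<phi> = 0")
    case False
    then have p: "?N \<phi> > 0" using L2_norm_ge_0[of "leb_on S" \<phi>] by linarith
    let ?c = "complex_of_real (1 / ?N \<phi>)"
    have "(\<lambda>x. 0 + ?c * \<phi> x) \<in> test_functions S" by (intro test_functions_lin test_functions_zero \<phi>)
    moreover have "?N (\<lambda>x. ?c * \<phi> x) = 1" "?G (\<lambda>x. ?c * \<phi> x) = ?G \<phi> / ?N \<phi>"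
    proof -
      have cm: "cmod ?c = 1 / ?N \<phi>" using p by (simp add: norm_divide)
      show "?N (\<lambda>x. ?c * \<phi> x) = 1" "?G (\<lambda>x. ?c * \<phi> x) = ?G \<phi> / ?N \<phi>"
        unfolding L.N_scale[OF tH[OF \<phi>], of ?c] G.N_scale[OF tH[OF \<phi>], of ?c] cm using p by simp_all
    qed
    ultimately have "(?G \<phi> / ?N \<phi>)\<^sup>2 \<in> A"
      unfolding A_def by (intro CollectI exI[of _ "\<lambda>x. ?c * \<phi> x"]) simp
    from cInf_lower[OF this Abd] show ?thesis
      using p unfolding \<mu>_def[symmetric] by (simp add: field_simps)
  qed simp
  have le: "\<mu> * (?N v)\<^sup>2 \<le> (?G v)\<^sup>2" if v: "v \<in> H10_space S" for v
  proof -
    obtain \<phi> where \<phi>: "\<And>n. \<phi> n \<in> test_functions S" "(\<lambda>n. H1_norm S (\<lambda>x. \<phi> n x - v x)) \<longlonglongrightarrow> 0"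
      using v unfolding H10_space_def by blast
    have n1: "(\<lambda>n. ?N (\<lambda>x. \<phi> n x - v x)) \<longlonglongrightarrow> 0"
      by (rule Lim_null_comparison[OF _ \<phi>(2)]) (simp add: L2_norm_le_H1)
    have n2: "(\<lambda>n. ?G (\<lambda>x. \<phi> n x - v x)) \<longlonglongrightarrow> 0"
      by (rule Lim_null_comparison[OF _ \<phi>(2)]) (simp add: grad_norm_le_H1)
    have "(\<lambda>n. \<mu> * (?N (\<phi> n))\<^sup>2) \<longlonglongrightarrow> \<mu> * (?N v)\<^sup>2" "(\<lambda>n. (?G (\<phi> n))\<^sup>2) \<longlonglongrightarrow> (?G v)\<^sup>2"
      by (intro tendsto_intros L.N_tendsto[OF tH[OF \<phi>(1)] v n1] G.N_tendsto[OF tH[OF \<phi>(1)] v n2])+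
    then show ?thesis by (rule LIMSEQ_le) (use test_le[OF \<phi>(1)] in auto)
  qed
  have "\<exists>\<phi>. \<phi> \<in> test_functions S \<and> ?N \<phi> = 1 \<and> (?G \<phi>)\<^sup>2 < \<mu> + 1 / real (Suc n)" for n
  proof -
    have "\<exists>x\<in>A. x < \<mu> + 1 / real (Suc n)" by (rule cInf_lessD[OF Ane]) (simp add: \<mu>_def)
    then obtain x where "x \<in> A" "x < \<mu> + 1 / real (Suc n)" by (rule bexE)
    then show ?thesis unfolding A_def by auto
  qed
  then have "\<forall>n. \<exists>\<phi>. \<phi> \<in> test_functions S \<and> ?N \<phi> = 1 \<and> (?G \<phi>)\<^sup>2 < \<mu> + 1 / real (Suc n)" by (rule allI)
  from choice[OF this] obtain \<phi> where \<phi>0: "\<forall>n. \<phi> n \<in> test_functions S \<and> ?N (\<phi> n) = 1 \<and> (?G (\<phi> n))\<^sup>2 < \<mu> + 1 / real (Suc n)"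
    by (rule exE)
  then have \<phi>: "\<phi> n \<in> test_functions S" "?N (\<phi> n) = 1" "(?G (\<phi> n))\<^sup>2 < \<mu> + 1 / real (Suc n)" for n by simp_all
  \<comment> \<open>With e \<mu> at most 1/2 the L^2 part of the energy of a difference can be
    absorbed on the left of the Rellich inequality.\<close>
  define e where "e = 1 / (2 * (\<mu> + 1))"
  have e: "e > 0" "e * \<mu> \<le> 1/2" using \<mu>0 by (auto simp: e_def field_simps)
  obtain I :: "'a set" and K C where I: "finite I" "C \<ge> 0" "\<And>p. p \<in> I \<Longrightarrow> K p \<in> L2_space (leb_on S)"
    and R: "\<And>\<phi>. \<phi> \<in> test_functions S \<Longrightarrow> (?N \<phi>)\<^sup>2 \<le>
       C * (\<Sum>p\<in>I. (cmod (L2_inner (leb_on S) \<phi> (K p)))\<^sup>2) + e * (?G \<phi>)\<^sup>2"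
    by (rule Rellich_inequality[OF S(1,2) e(1)]) (rule that)
  define c where "c p n = L2_inner (leb_on S) (\<phi> n) (K p)" for p n
  have bdc: "bounded (range (c p))" if "p \<in> I" for p
  proof -
    have "cmod (c p n) \<le> ?N (K p)" for n
      using L2.CS[OF test_functions_L2[OF S(1) \<phi>(1)] I(3)[OF that], of n] \<phi>(2)[of n] by (simp add: c_def)
    then show ?thesis by (auto simp: bounded_iff)
  qed
  have "\<exists>r. strict_mono r \<and> (\<forall>p\<in>I. convergent (\<lambda>n. c p (r n)))"
    by (rule finite_family_convergent_subsequence[OF I(1)]) (rule bdc)
  then obtain r where r: "strict_mono r" "\<forall>p\<in>I. convergent (\<lambda>n. c p (r n))" by blast
  define U where "U n = \<phi> (r n)" for n
  have UH: "U n \<in> H10_space S" for n unfolding U_def by (intro tH \<phi>)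
  have Un: "?N (U n) = 1" for n by (simp add: U_def \<phi>)
  have Ug: "(?G (U n))\<^sup>2 < \<mu> + 1 / real (Suc n)" for n
  proof -
    have "1 / real (Suc (r n)) \<le> 1 / real (Suc n)"
      using seq_suble[OF r(1), of n] by (intro divide_left_mono) auto
    then show ?thesis using \<phi>(3)[of "r n"] by (simp add: U_def)
  qed
  have par: "(?G (\<lambda>x. U m x - U n x))\<^sup>2 \<le> \<mu> * (?N (\<lambda>x. U m x - U n x))\<^sup>2 + 2 / real (Suc m) + 2 / real (Suc n)" for m n
  proof -
    have "(?G (\<lambda>x. U m x + (-1) * U n x))\<^sup>2 + (?G (\<lambda>x. U m x + 1 * U n x))\<^sup>2 = 2 * (?G (U m))\<^sup>2 + 2 * (?G (U n))\<^sup>2"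
      unfolding G.N_lin_sq[OF UH UH] by simp
    moreover have "(?N (\<lambda>x. U m x + (-1) * U n x))\<^sup>2 + (?N (\<lambda>x. U m x + 1 * U n x))\<^sup>2 = 4"
      unfolding L.N_lin_sq[OF UH UH] by (simp add: Un)
    then have "\<mu> * (?N (\<lambda>x. U m x + (-1) * U n x))\<^sup>2 + \<mu> * (?N (\<lambda>x. U m x + 1 * U n x))\<^sup>2 = \<mu> * 4"
      by (simp only: distrib_left[symmetric])
    moreover have "\<mu> * (?N (\<lambda>x. U m x + 1 * U n x))\<^sup>2 \<le> (?G (\<lambda>x. U m x + 1 * U n x))\<^sup>2"
      by (intro le H10_lin[OF S(1)] UH)
    ultimately have "(?G (\<lambda>x. U m x + (-1) * U n x))\<^sup>2 \<le> \<mu> * (?N (\<lambda>x. U m x + (-1) * U n x))\<^sup>2 + 2 * (1 / real (Suc m)) + 2 * (1 / real (Suc n))"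
      using Ug[of m] Ug[of n] by linarith
    then show ?thesis by simp
  qed
  define s where "s m n = 2 * C * (\<Sum>p\<in>I. (cmod (c p (r m) - c p (r n)))\<^sup>2) + 2 * e * (2 / real (Suc m) + 2 / real (Suc n))" for m n
  have Nd: "(?N (\<lambda>x. U m x - U n x))\<^sup>2 \<le> s m n" for m n
  proof -
    let ?d = "\<lambda>x. U m x - U n x"
    have "(\<lambda>x. U m x + (-1) * U n x) \<in> test_functions S" unfolding U_def by (intro test_functions_lin \<phi>)
    then have dt: "?d \<in> test_functions S" by simp
    have "L2_inner (leb_on S) ?d (K p) = c p (r m) - c p (r n)" if "p \<in> I" for p
      unfolding c_def U_def by (intro L2.B_diff test_functions_L2[OF S(1) \<phi>(1)] I that)
    then have "(?N ?d)\<^sup>2 \<le> C * (\<Sum>p\<in>I. (cmod (c p (r m) - c p (r n)))\<^sup>2) + e * (?G ?d)\<^sup>2"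
      using R[OF dt] by simp
    moreover have "e * (?G ?d)\<^sup>2 \<le> e * (\<mu> * (?N ?d)\<^sup>2 + 2 / real (Suc m) + 2 / real (Suc n))"
      using par e by (intro mult_left_mono) auto
    moreover have "e * (\<mu> * (?N ?d)\<^sup>2 + 2 / real (Suc m) + 2 / real (Suc n)) = e * \<mu> * (?N ?d)\<^sup>2 + e * (2 / real (Suc m) + 2 / real (Suc n))"
      by (simp only: distrib_left add.assoc mult.assoc)
    moreover have "e * \<mu> * (?N ?d)\<^sup>2 \<le> 1/2 * (?N ?d)\<^sup>2" using e by (intro mult_right_mono) auto
    ultimately have "(?N ?d)\<^sup>2 \<le> C * (\<Sum>p\<in>I. (cmod (c p (r m) - c p (r n)))\<^sup>2) + (1/2 * (?N ?d)\<^sup>2 + e * (2 / real (Suc m) + 2 / real (Suc n)))"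
      by linarith
    then show ?thesis unfolding s_def by linarith
  qed
  have "\<exists>M. \<forall>m\<ge>M. \<forall>n\<ge>M. H1_norm S (\<lambda>x. U m x - U n x) < \<delta>" if \<delta>: "\<delta> > 0" for \<delta>
  proof -
    \<comment> \<open>Once the squared differences of the functionals and the terms 1 / (j + 1) are
      at most \<eta>, \<open>s\<close> is at most Q \<eta>: the first part comes from the
      functionals, the 8 e from the two remainders. The choice of \<eta> then bounds the squared H^1
      distance by \<delta>^2 / 2.\<close>
    define Q where "Q = 2 * C * real (card I) + 8 * e"
    define \<eta> where "\<eta> = \<delta>\<^sup>2 / (2 * ((\<mu> + 1) * (Q + 1) + 4))"
    have Q: "Q \<ge> 0" using I e by (simp add: Q_def)
    have den: "(\<mu> + 1) * (Q + 1) + 4 > 0" using \<mu>0 Q by (intro add_nonneg_pos) auto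
    have \<eta>: "\<eta> > 0" using \<delta> den by (simp add: \<eta>_def)
    have "\<forall>p\<in>I. \<exists>M. \<forall>m\<ge>M. \<forall>n\<ge>M. (cmod (c p (r m) - c p (r n)))\<^sup>2 < \<eta>"
    proof
      fix p assume "p \<in> I"
      then have "Cauchy (\<lambda>n. c p (r n))" using r(2) by (simp add: Cauchy_convergent_iff)
      then obtain M where M: "\<And>m n. m \<ge> M \<Longrightarrow> n \<ge> M \<Longrightarrow> cmod (c p (r m) - c p (r n)) < sqrt \<eta>"
        using CauchyD[of "\<lambda>n. c p (r n)" "sqrt \<eta>"] \<eta> by auto
      have "(cmod (c p (r m) - c p (r n)))\<^sup>2 < \<eta>" if "m \<ge> M" "n \<ge> M" for m n
      proof -
        have "(cmod (c p (r m) - c p (r n)))\<^sup>2 < (sqrt \<eta>)\<^sup>2" by (intro power_strict_mono M that) auto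
        then show ?thesis using \<eta> by simp
      qed
      then show "\<exists>M. \<forall>m\<ge>M. \<forall>n\<ge>M. (cmod (c p (r m) - c p (r n)))\<^sup>2 < \<eta>" by blast
    qed
    from bchoice[OF this] obtain M where M: "\<forall>p\<in>I. \<forall>m\<ge>M p. \<forall>n\<ge>M p. (cmod (c p (r m) - c p (r n)))\<^sup>2 < \<eta>" by (rule exE)
    obtain M2 where M2: "1 / real (Suc M2) < \<eta>" using \<eta> reals_Archimedean[of \<eta>] by (auto simp: inverse_eq_divide)
    define M' where "M' = M2 + (\<Sum>p\<in>I. M p)"
    have MM: "M p \<le> M'" if "p \<in> I" for p
      using that I(1) member_le_sum[of p I M] by (simp add: M'_def)
    have "H1_norm S (\<lambda>x. U m x - U n x) < \<delta>" if mn: "m \<ge> M'" "n \<ge> M'" for m n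
    proof (rule power_less_imp_less_base)
      have inv: "1 / real (Suc j) \<le> \<eta>" if "j \<ge> M'" for j
      proof -
        have "1 / real (Suc j) \<le> 1 / real (Suc M2)" using that by (intro divide_left_mono) (auto simp: M'_def)
        then show ?thesis using M2 by linarith
      qed
      have "(\<Sum>p\<in>I. (cmod (c p (r m) - c p (r n)))\<^sup>2) \<le> (\<Sum>p\<in>I. \<eta>)"
      proof (rule sum_mono)
        fix p assume "p \<in> I"
        then show "(cmod (c p (r m) - c p (r n)))\<^sup>2 \<le> \<eta>"
          using M MM[of p] mn by (meson less_imp_le order_trans)
      qed
      then have "2 * C * (\<Sum>p\<in>I. (cmod (c p (r m) - c p (r n)))\<^sup>2) \<le> 2 * C * (real (card I) * \<eta>)"
        using I(2) by (intro mult_left_mono) auto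
      moreover have "2 * e * (2 / real (Suc m) + 2 / real (Suc n)) \<le> 2 * e * (4 * \<eta>)"
        using inv[OF mn(1)] inv[OF mn(2)] e by (intro mult_left_mono) auto
      ultimately have "s m n \<le> Q * \<eta>" unfolding s_def Q_def by (simp add: algebra_simps)
      then have N2: "(?N (\<lambda>x. U m x - U n x))\<^sup>2 \<le> Q * \<eta>" using Nd order_trans by blast
      have "(H1_norm S (\<lambda>x. U m x - U n x))\<^sup>2 \<le> (\<mu> + 1) * (?N (\<lambda>x. U m x - U n x))\<^sup>2 + 2 / real (Suc m) + 2 / real (Suc n)"
        using par[of m n] unfolding H1_norm_sq_grad by (simp add: algebra_simps)
      also have "\<dots> \<le> (\<mu> + 1) * (Q * \<eta>) + 2 * \<eta> + 2 * \<eta>"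
        using N2 \<mu>0 inv[OF mn(1)] inv[OF mn(2)] by (intro add_mono mult_left_mono) auto
      also have "\<dots> \<le> ((\<mu> + 1) * (Q + 1) + 4) * \<eta>"
        using \<mu>0 \<eta> by (simp add: algebra_simps)
      also have "\<dots> = \<delta>\<^sup>2 / 2"
      proof -
        have "X * (\<delta>\<^sup>2 / (2 * X)) = \<delta>\<^sup>2 / 2" if "X > 0" for X :: real using that by simp
        from this[OF den] show ?thesis unfolding \<eta>_def .
      qed
      also have "\<dots> < \<delta>\<^sup>2" using \<delta> by simp
      finally show "(H1_norm S (\<lambda>x. U m x - U n x))\<^sup>2 < \<delta>\<^sup>2" .
    qed (use \<delta> in auto)
    then show ?thesis by blast
  qed
  from H.complete[OF UH this] obtain u where u: "u \<in> H10_space S" "(\<lambda>n. H1_norm S (\<lambda>x. U n x - u x)) \<longlonglongrightarrow> 0" by blast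
  have n1: "(\<lambda>n. ?N (\<lambda>x. U n x - u x)) \<longlonglongrightarrow> 0"
    by (rule Lim_null_comparison[OF _ u(2)]) (simp add: L2_norm_le_H1)
  have n2: "(\<lambda>n. ?G (\<lambda>x. U n x - u x)) \<longlonglongrightarrow> 0"
    by (rule Lim_null_comparison[OF _ u(2)]) (simp add: grad_norm_le_H1)
  have uN: "?N u = 1"
    using L.N_tendsto[OF UH u(1) n1] by (simp add: Un LIMSEQ_const_iff)
  have uG: "(?G u)\<^sup>2 \<le> \<mu>"
  proof (rule LIMSEQ_le)
    show "(\<lambda>n. (?G (U n))\<^sup>2) \<longlonglongrightarrow> (?G u)\<^sup>2" by (intro tendsto_intros G.N_tendsto[OF UH u(1) n2])
    show "(\<lambda>n. \<mu> + 1 / real (Suc n)) \<longlonglongrightarrow> \<mu>"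
      using tendsto_add[OF tendsto_const[of \<mu>] LIMSEQ_inverse_real_of_nat] by (simp add: inverse_eq_divide)
    show "\<exists>N. \<forall>n\<ge>N. (?G (U n))\<^sup>2 \<le> \<mu> + 1 / real (Suc n)" using Ug less_imp_le by blast
  qed
  \<comment> \<open>By \<open>le\<close> this form is positive semidefinite, and the minimiser is a
    null vector of it; \<open>null_orthogonal\<close> is then the Euler-Lagrange equation.\<close>
  let ?D = "\<lambda>u v. grad_inner S u v - complex_of_real \<mu> * L2_inner (leb_on S) u v"
  have "pos_form (H10_space S) ?D"
  proof
    show "?D (\<lambda>x. u x + c * v x) w = ?D u w + c * ?D v w"
      if "u \<in> H10_space S" "v \<in> H10_space S" "w \<in> H10_space S" for u v w c
      by (simp add: G.B_lin[OF that] L.B_lin[OF that] algebra_simps)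
    show "?D v u = cnj (?D u v)" if "u \<in> H10_space S" "v \<in> H10_space S" for u v
      using G.B_herm[OF that] L.B_herm[OF that] by simp
    show "0 \<le> Re (?D u u)" if "u \<in> H10_space S" for u
      using le[OF that] by (simp add: G.B_self[OF that] L.B_self[OF that])
  qed (rule H10_lin[OF S(1)] G.zero_mem | assumption)+
  then interpret D: pos_form "H10_space S" ?D .
  have "D.N u = 0" unfolding D.N_def
    using uG le[OF u(1)] uN by (simp add: G.B_self[OF u(1)] L.B_self[OF u(1)])
  then have "?D u v = 0" if "v \<in> H10_space S" for v by (rule D.null_orthogonal[OF u(1) that])
  then have "grad_inner S u v = complex_of_real \<mu> * L2_inner (leb_on S) u v" if "v \<in> H10_space S" for v
    using that by simp
  then show ?thesis using that[OF \<mu>0 u(1) uN _ le] by blast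
qed

section \<open>The number \<open>\<mu>\<^sub>1\<close>\<close>

lemma Basis_real2: "(Basis :: (real^2) set) = {axis 1 1, axis 2 1}"
  by (auto simp: Basis_vec_def UNIV_2)

lemma sum_Basis_real2: "(\<Sum>b\<in>(Basis :: (real^2) set). f b) = f (axis 1 1) + f (axis 2 1)"
proof -
  have "axis 1 1 \<noteq> (axis 2 1 :: real^2)" by (simp add: axis_eq_axis)
  then show ?thesis by (simp add: Basis_real2)
qed

lemma dirichlet_form_eq:
  assumes "u \<in> H10_space m"
  shows "dirichlet_form m u = (grad_norm m u)\<^sup>2"
proof -
  have "integrable (leb_on m) (\<lambda>x. (cmod (weak_deriv m b u x))\<^sup>2)" if "b \<in> Basis" for b
    by (intro L2_spaceD(2) H1_spaceD(3)[OF H10_spaceD[OF assms]] that)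
  from this[of "axis 1 1"] this[of "axis 2 1"] show ?thesis
    unfolding dirichlet_form_def grad_norm_sq sum_Basis_real2 L2_norm_sq
    by (simp add: Basis_real2)
qed

lemma polar_form_dirichlet:
  assumes "open m" "u \<in> H10_space m" "v \<in> H10_space m"
  shows "polar_form (dirichlet_form m) u v = grad_inner m u v"
  by (rule pos_form.polar_form_eq[OF H10_grad_pos_form[OF assms(1)] _ assms(2,3)])
     (simp add: grad_norm_eq[OF assms(1)] dirichlet_form_eq)

text \<open>The minimiser shows that the infimum of the Rayleigh quotient is an eigenvalue. Any
  other eigenvalue is the Rayleigh quotient of its own eigenfunction, hence not smaller, so the
  LEAST exists and equals the infimum.\<close>

lemma mu1_eigenfunction:
  assumes m: "open m" "bounded m" "m \<noteq> {}"
  obtains \<psi> where "\<psi> \<in> H10_space m" "L2_norm (leb_on m) \<psi> = 1"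
    "\<And>v. v \<in> H10_space m \<Longrightarrow> grad_inner m \<psi> v = complex_of_real (mu1 m) * L2_inner (leb_on m) \<psi> v"
    "\<And>v. v \<in> H10_space m \<Longrightarrow> mu1 m * (L2_norm (leb_on m) v)\<^sup>2 \<le> (grad_norm m v)\<^sup>2"
    "mu1 m \<ge> 0"
proof -
  interpret L: pos_form "H10_space m" "L2_inner (leb_on m)"
    rewrites "pos_form.N (L2_inner (leb_on m)) = L2_norm (leb_on m)"
    by (rule H10_L2_pos_form[OF m(1)], rule L2_norm_eq)
  interpret G: pos_form "H10_space m" "grad_inner m"
    rewrites "pos_form.N (grad_inner m) = grad_norm m"
    by (rule H10_grad_pos_form[OF m(1)], rule grad_norm_eq[OF m(1)])
  obtain \<mu> \<psi> where \<psi>: "\<mu> \<ge> 0" "\<psi> \<in> H10_space m" "L2_norm (leb_on m) \<psi> = 1"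
    "\<And>v. v \<in> H10_space m \<Longrightarrow> grad_inner m \<psi> v = complex_of_real \<mu> * L2_inner (leb_on m) \<psi> v"
    "\<And>v. v \<in> H10_space m \<Longrightarrow> \<mu> * (L2_norm (leb_on m) v)\<^sup>2 \<le> (grad_norm m v)\<^sup>2"
    by (rule first_eigenfunction[OF m]) (rule that)
  have \<psi>L: "\<psi> \<in> L2_space (leb_on m)" using H1_spaceD(1)[OF H10_spaceD[OF \<psi>(2)]] .
  have "mu1 m = \<mu>"
    unfolding mu1_def
  proof (rule Least_equality)
    let ?g = "\<lambda>x. complex_of_real \<mu> * \<psi> x"
    have g: "?g \<in> L2_space (leb_on m)" by (rule L2.scale[OF \<psi>L])
    have "polar_form (dirichlet_form m) \<psi> v = L2_inner (leb_on m) ?g v" if v: "v \<in> H10_space m" for v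
    proof -
      have vL: "v \<in> L2_space (leb_on m)" using H1_spaceD(1)[OF H10_spaceD[OF v]] .
      have z: "L2_inner (leb_on m) (\<lambda>_. 0) v = 0" by (simp add: L2_inner_def)
      have "L2_inner (leb_on m) ?g v = complex_of_real \<mu> * L2_inner (leb_on m) \<psi> v"
        using L2.B_lin[OF L2.zero_mem \<psi>L vL, of "complex_of_real \<mu>"] z by simp
      then show ?thesis by (simp add: polar_form_dirichlet[OF m(1) \<psi>(2) v] \<psi>(4)[OF v])
    qed
    then have "(\<psi>, ?g) \<in> dirichlet_laplacian m"
      using \<psi>(2) g by (simp add: dirichlet_laplacian_def form_operator_def)
    moreover have "\<not> (AE x in leb_on m. \<psi> x = 0)" using L2_norm_zero_iff[OF \<psi>L] \<psi>(3) by simp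
    ultimately show "op_eigenvalue (leb_on m) (dirichlet_laplacian m) (complex_of_real \<mu>)"
      unfolding op_eigenvalue_def by (intro bexI[of _ "(\<psi>, ?g)"]) auto
  next
    fix y assume "op_eigenvalue (leb_on m) (dirichlet_laplacian m) (complex_of_real y)"
    then obtain u g where ug: "(u, g) \<in> dirichlet_laplacian m" "AE x in leb_on m. g x = complex_of_real y * u x"
      "\<not> (AE x in leb_on m. u x = 0)"
      by (auto simp: op_eigenvalue_def)
    then have u: "u \<in> H10_space m" "g \<in> L2_space (leb_on m)" "polar_form (dirichlet_form m) u u = L2_inner (leb_on m) g u"
      by (auto simp: dirichlet_laplacian_def form_operator_def)
    have uL: "u \<in> L2_space (leb_on m)" using H1_spaceD(1)[OF H10_spaceD[OF u(1)]] .
    have p: "L2_norm (leb_on m) u > 0" using L2_norm_zero_iff[OF uL] ug(3) L2_norm_ge_0[of "leb_on m" u]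
      by (simp add: order_less_le)
    have z: "L2_inner (leb_on m) (\<lambda>_. 0) u = 0" by (simp add: L2_inner_def)
    have "L2_inner (leb_on m) g u = L2_inner (leb_on m) (\<lambda>x. complex_of_real y * u x) u"
      by (intro L2_inner_cong_AE ug(2) L2_spaceD(1) u uL L2.scale) auto
    also have "\<dots> = complex_of_real y * L2_inner (leb_on m) u u"
      using L2.B_lin[OF L2.zero_mem uL uL, of "complex_of_real y"] z by simp
    finally have "grad_inner m u u = complex_of_real y * L2_inner (leb_on m) u u"
      using u(3) polar_form_dirichlet[OF m(1) u(1) u(1)] by simp
    then have "complex_of_real ((grad_norm m u)\<^sup>2) = complex_of_real (y * (L2_norm (leb_on m) u)\<^sup>2)"
      unfolding G.B_self[OF u(1)] L.B_self[OF u(1)] by simp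
    then have "(grad_norm m u)\<^sup>2 = y * (L2_norm (leb_on m) u)\<^sup>2" by (simp only: of_real_eq_iff)
    then show "\<mu> \<le> y" using \<psi>(5)[OF u(1)] p by simp
  qed
  then show ?thesis using that[OF \<psi>(2,3)] \<psi> by simp
qed

section \<open>Functions on the tube\<close>

lemma open_tube: "open m \<Longrightarrow> open (tube m)"
  unfolding tube_def by (intro open_Times) auto

lemma tube_Basis: "b \<in> Basis \<Longrightarrow> (b, 0) \<in> (Basis :: ((real^2) \<times> real) set)" "(0, 1) \<in> (Basis :: ((real^2) \<times> real) set)"
  by (auto simp: Basis_prod_def)

lemma tube_Basis_cases:
  assumes "b \<in> (Basis :: ((real^2) \<times> real) set)"
  obtains b' where "b = (b', 0)" "b' \<in> Basis" | "b = (0, 1)"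
  using assms by (auto simp: Basis_prod_def)

text \<open>The cross-section is the inner integral, so that facts about it can be used at each
  fixed height.\<close>

lemma integral_tube:
  fixes f :: "(real^2) \<times> real \<Rightarrow> 'b::{banach, second_countable_topology}"
  assumes m: "open m" and f: "integrable (leb_on (tube m)) f"
  shows "(\<integral>p. f p \<partial>leb_on (tube m)) = (\<integral>s. (\<integral>x. f (x, s) \<partial>leb_on m) \<partial>lborel)"
proof -
  let ?F = "\<lambda>x s. indicator m x *\<^sub>R f (x, s)"
  have ind: "indicator (tube m) p *\<^sub>R f p = case_prod ?F p" for p
    by (cases p) (simp add: tube_def indicator_def)
  have "integrable lborel (case_prod ?F)"
    using f unfolding integrable_leb_on[OF open_tube[OF m]] ind .
  then have i: "integrable (lborel \<Otimes>\<^sub>M lborel) (case_prod ?F)" by (simp add: lborel_prod)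
  have "(\<integral>p. f p \<partial>leb_on (tube m)) = (\<integral>p. case_prod ?F p \<partial>(lborel \<Otimes>\<^sub>M lborel))"
    unfolding integral_leb_on[OF open_tube[OF m]] ind lborel_prod ..
  also have "\<dots> = (\<integral>s. (\<integral>x. ?F x s \<partial>lborel) \<partial>lborel)"
    using lborel_pair.integral_snd[OF i] by simp
  finally show ?thesis by (simp add: integral_leb_on[OF m])
qed

section \<open>Products of cross-sectional and longitudinal functions, and slices\<close>

definition tensor :: "(real^2 \<Rightarrow> complex) \<Rightarrow> (real \<Rightarrow> complex) \<Rightarrow> (real^2) \<times> real \<Rightarrow> complex" where
  "tensor f g p = f (fst p) * g (snd p)"

lemma tensor_L2:
  assumes m: "open m" and f: "f \<in> L2_space (leb_on m)" and g: "g \<in> L2_space lborel"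
  shows "tensor f g \<in> L2_space (leb_on (tube m))"
    and "L2_norm (leb_on (tube m)) (tensor f g) = L2_norm (leb_on m) f * L2_norm lborel g"
proof -
  define F where "F x = indicator m x *\<^sub>R f x" for x
  have F: "F \<in> L2_space lborel" using f L2_leb_on_iff[OF m] by (simp add: F_def[abs_def])
  have [measurable]: "F \<in> borel_measurable borel" "g \<in> borel_measurable borel"
    using L2_spaceD(1)[OF F] L2_spaceD(1)[OF g] by simp_all
  have ind: "indicator (tube m) p *\<^sub>R tensor f g p = F (fst p) * g (snd p)" for p
    by (cases p) (simp add: tube_def indicator_def F_def tensor_def)
  have meas: "(\<lambda>p. F (fst p) * g (snd p)) \<in> borel_measurable (lborel \<Otimes>\<^sub>M lborel)" by measurable
  have sq: "(cmod (F x * g s))\<^sup>2 = (cmod (F x))\<^sup>2 * (cmod (g s))\<^sup>2" for x s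
    by (simp add: norm_mult power_mult_distrib)
  have I: "integrable (lborel \<Otimes>\<^sub>M lborel) (\<lambda>(x, s). (cmod (F x * g s))\<^sup>2)"
  proof (rule lborel_pair.Fubini_integrable)
    show "(\<lambda>(x, s). (cmod (F x * g s))\<^sup>2) \<in> borel_measurable (lborel \<Otimes>\<^sub>M lborel)" by measurable
    show "integrable lborel (\<lambda>x. \<integral>s. norm (case (x, s) of (x, s) \<Rightarrow> (cmod (F x * g s))\<^sup>2) \<partial>lborel)"
      using L2_spaceD(2)[OF F] by (simp add: sq)
    show "AE x in lborel. integrable lborel (\<lambda>s. case (x, s) of (x, s) \<Rightarrow> (cmod (F x * g s))\<^sup>2)"
      using L2_spaceD(2)[OF g] by (simp add: sq)
  qed
  then have I': "integrable lborel (\<lambda>p. (cmod (F (fst p) * g (snd p)))\<^sup>2)"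
    by (simp add: lborel_prod case_prod_beta')
  show 1: "tensor f g \<in> L2_space (leb_on (tube m))"
    unfolding L2_leb_on_iff[OF open_tube[OF m]] ind
    using meas I' by (simp add: L2_space_def lborel_prod)
  have "(L2_norm (leb_on (tube m)) (tensor f g))\<^sup>2 = (\<integral>s. (\<integral>x. (cmod (tensor f g (x, s)))\<^sup>2 \<partial>leb_on m) \<partial>lborel)"
    unfolding L2_norm_sq by (rule integral_tube[OF m L2_spaceD(2)[OF 1]])
  also have "\<dots> = (\<integral>s. (L2_norm (leb_on m) f)\<^sup>2 * (cmod (g s))\<^sup>2 \<partial>lborel)"
    by (simp add: tensor_def norm_mult power_mult_distrib L2_norm_sq)
  also have "\<dots> = (L2_norm (leb_on m) f * L2_norm lborel g)\<^sup>2"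
    by (simp add: power_mult_distrib L2_norm_sq)
  finally show "L2_norm (leb_on (tube m)) (tensor f g) = L2_norm (leb_on m) f * L2_norm lborel g"
    by (rule power2_eq_imp_eq) simp_all
qed

lemma dir_deriv_zero: "smooth_fun f \<Longrightarrow> dir_deriv 0 f x = 0"
  by (simp add: dir_deriv_expand)

lemma smooth_fun_fst: "smooth_fun f \<Longrightarrow> smooth_fun (\<lambda>p :: 'a::euclidean_space \<times> 'b::euclidean_space. f (fst p))"
  using smooth_fun_affine[OF _ bounded_linear_fst, of f 0] by simp

lemma smooth_fun_snd: "smooth_fun f \<Longrightarrow> smooth_fun (\<lambda>p :: 'a::euclidean_space \<times> 'b::euclidean_space. f (snd p))"
  using smooth_fun_affine[OF _ bounded_linear_snd, of f 0] by simp

lemma dir_deriv_fst: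
  "smooth_fun f \<Longrightarrow> dir_deriv b (\<lambda>p :: 'a::euclidean_space \<times> 'b::euclidean_space. f (fst p)) = (\<lambda>p. dir_deriv (fst b) f (fst p))"
  using dir_deriv_affine[OF _ bounded_linear_fst, of f b 0] by simp

lemma dir_deriv_snd:
  "smooth_fun f \<Longrightarrow> dir_deriv b (\<lambda>p :: 'a::euclidean_space \<times> 'b::euclidean_space. f (snd p)) = (\<lambda>p. dir_deriv (snd b) f (snd p))"
  using dir_deriv_affine[OF _ bounded_linear_snd, of f b 0] by simp

lemma tensor_test:
  assumes \<phi>: "\<phi> \<in> test_functions m" and g: "g \<in> test_functions UNIV"
  shows "tensor \<phi> g \<in> test_functions (tube m)"
    and "dir_deriv (b, 0) (tensor \<phi> g) = tensor (dir_deriv b \<phi>) g"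
    and "dir_deriv (0, 1) (tensor \<phi> g) = tensor \<phi> (dir_deriv 1 g)"
proof -
  note s = test_functionsD(1)[OF \<phi>] test_functionsD(1)[OF g]
  have te: "tensor \<phi> g = (\<lambda>p. \<phi> (fst p) * g (snd p))" by (auto simp: tensor_def)
  show "tensor \<phi> g \<in> test_functions (tube m)"
  proof (rule test_functionsI)
    show "smooth_fun (tensor \<phi> g)" unfolding te by (intro smooth_fun_mult smooth_fun_fst smooth_fun_snd s)
    show "compact (closure {x. \<phi> x \<noteq> 0} \<times> closure {x. g x \<noteq> 0})"
      by (rule compact_Times[OF test_functionsD(2)[OF \<phi>] test_functionsD(2)[OF g]])
    show "closure {x. \<phi> x \<noteq> 0} \<times> closure {x. g x \<noteq> 0} \<subseteq> tube m"
      using test_functionsD(3)[OF \<phi>] unfolding tube_def by (rule Sigma_mono) simp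
    fix p :: "(real^2) \<times> real" assume "p \<notin> closure {x. \<phi> x \<noteq> 0} \<times> closure {x. g x \<noteq> 0}"
    then have "fst p \<notin> closure {x. \<phi> x \<noteq> 0} \<or> snd p \<notin> closure {x. g x \<noteq> 0}" by (cases p) simp
    then show "tensor \<phi> g p = 0"
      using zero_outside_closure[of "fst p" \<phi>] zero_outside_closure[of "snd p" g] by (auto simp: tensor_def)
  qed
  have d: "dir_deriv b (tensor \<phi> g) = (\<lambda>p. \<phi> (fst p) * dir_deriv (snd b) g (snd p) + dir_deriv (fst b) \<phi> (fst p) * g (snd p))" for b
    unfolding te dir_deriv_mult[OF smooth_fun_fst[OF s(1)] smooth_fun_snd[OF s(2)]]
      dir_deriv_fst[OF s(1)] dir_deriv_snd[OF s(2)] ..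
  show "dir_deriv (b, 0) (tensor \<phi> g) = tensor (dir_deriv b \<phi>) g"
    unfolding d by (auto simp: tensor_def dir_deriv_zero[OF s(2)])
  show "dir_deriv (0, 1) (tensor \<phi> g) = tensor \<phi> (dir_deriv 1 g)"
    unfolding d by (auto simp: tensor_def dir_deriv_zero[OF s(1)])
qed

text \<open>The slice of a test function is a test function at every height, so cross-sectional
  facts apply for each s. General elements of the Sobolev space of the tube are then reached by
  density.\<close>

lemma slice_test:
  assumes \<phi>: "\<phi> \<in> test_functions (tube m)"
  shows "(\<lambda>x. \<phi> (x, s)) \<in> test_functions m"
    and "dir_deriv b (\<lambda>x. \<phi> (x, s)) = (\<lambda>x. dir_deriv (b, 0) \<phi> (x, s))"
proof -
  have L: "bounded_linear (\<lambda>x :: real^2. (x, 0 :: real))"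
    by (intro bounded_linear_Pair bounded_linear_ident bounded_linear_zero)
  have e: "(\<lambda>x. \<phi> (x, s)) = (\<lambda>x. \<phi> ((x, 0) + (0, s)))" by simp
  note sm = test_functionsD(1)[OF \<phi>]
  show "dir_deriv b (\<lambda>x. \<phi> (x, s)) = (\<lambda>x. dir_deriv (b, 0) \<phi> (x, s))"
    unfolding e dir_deriv_affine[OF sm L] by simp
  show "(\<lambda>x. \<phi> (x, s)) \<in> test_functions m"
  proof (rule test_functionsI)
    show "smooth_fun (\<lambda>x. \<phi> (x, s))" unfolding e by (rule smooth_fun_affine[OF sm L])
    show "compact (fst ` closure {p. \<phi> p \<noteq> 0})"
      by (intro compact_continuous_image continuous_intros test_functionsD(2)[OF \<phi>])
    show "fst ` closure {p. \<phi> p \<noteq> 0} \<subseteq> m" using test_functionsD(3)[OF \<phi>] by (auto simp: tube_def)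
    fix x assume x: "x \<notin> fst ` closure {p. \<phi> p \<noteq> 0}"
    have "(x, s) \<notin> closure {p. \<phi> p \<noteq> 0}"
    proof
      assume "(x, s) \<in> closure {p. \<phi> p \<noteq> 0}"
      from imageI[OF this, of fst] x show False by simp
    qed
    then show "\<phi> (x, s) = 0" by (rule zero_outside_closure)
  qed
qed

text \<open>The norm of a product function is the product of the norms, so approximating the
  cross-sectional factor by test functions approximates the product together with all its
  derivatives.\<close>

lemma tensor_H10:
  assumes m: "open m" and \<psi>: "\<psi> \<in> H10_space m" and g: "g \<in> test_functions UNIV"
  shows "tensor \<psi> g \<in> H10_space (tube m)"
    and "b \<in> Basis \<Longrightarrow> has_weak_deriv (tube m) (b, 0) (tensor \<psi> g) (tensor (weak_deriv m b \<psi>) g)"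
    and "has_weak_deriv (tube m) (0, 1) (tensor \<psi> g) (tensor \<psi> (dir_deriv 1 g))"
proof -
  obtain \<phi> where \<phi>: "\<And>n. \<phi> n \<in> test_functions m" "(\<lambda>n. H1_norm m (\<lambda>x. \<phi> n x - \<psi> x)) \<longlonglongrightarrow> 0"
    "(\<lambda>n. L2_norm (leb_on m) (\<lambda>x. \<phi> n x - \<psi> x)) \<longlonglongrightarrow> 0"
    "\<And>b. b \<in> Basis \<Longrightarrow> (\<lambda>n. L2_norm (leb_on m) (\<lambda>x. dir_deriv b (\<phi> n) x - weak_deriv m b \<psi> x)) \<longlonglongrightarrow> 0"
    by (rule H10_approx[OF m \<psi>]) (rule that)
  note \<psi>H = H10_spaceD[OF \<psi>]
  define g' where "g' = dir_deriv 1 g"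
  have g': "g' \<in> test_functions UNIV" unfolding g'_def by (rule test_functions_dir_deriv[OF g]) simp
  note gL = test_functions_L2_lborel[OF g] test_functions_L2_lborel[OF g']
  have lim: "(\<lambda>n. L2_norm (leb_on (tube m)) (\<lambda>p. tensor (u n) h p - tensor v h p)) \<longlonglongrightarrow> 0"
    if "\<And>n. u n \<in> L2_space (leb_on m)" "v \<in> L2_space (leb_on m)" "(\<lambda>n. L2_norm (leb_on m) (\<lambda>x. u n x - v x)) \<longlonglongrightarrow> 0"
      "h \<in> L2_space lborel" for u v h
  proof -
    have "(\<lambda>p. tensor (u n) h p - tensor v h p) = tensor (\<lambda>x. u n x - v x) h" for n
      by (auto simp: tensor_def algebra_simps)
    then have "L2_norm (leb_on (tube m)) (\<lambda>p. tensor (u n) h p - tensor v h p) = L2_norm (leb_on m) (\<lambda>x. u n x - v x) * L2_norm lborel h" for n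
      using tensor_L2(2)[OF m L2.diff[OF that(1,2)] that(4)] by simp
    then show ?thesis using tendsto_mult_left_zero[OF that(3)] by simp
  qed
  \<comment> \<open>The candidate derivatives, indexed by the basis of the tube: the longitudinal
    one falls on g, the others on \<psi>.\<close>
  define G where "G b = (if b = (0, 1) then tensor \<psi> g' else tensor (weak_deriv m (fst b) \<psi>) g)" for b :: "(real^2) \<times> real"
  have Ge: "G (b, 0) = tensor (weak_deriv m b \<psi>) g" "G (0, 1) = tensor \<psi> g'" for b
    by (auto simp: G_def)
  have T1: "tensor (\<phi> n) g \<in> test_functions (tube m)" for n by (rule tensor_test[OF \<phi>(1) g])
  have T2: "tensor \<psi> g \<in> L2_space (leb_on (tube m))" by (rule tensor_L2[OF m H1_spaceD(1)[OF \<psi>H] gL(1)])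
  have T3: "(\<lambda>n. L2_norm (leb_on (tube m)) (\<lambda>x. tensor (\<phi> n) g x - tensor \<psi> g x)) \<longlonglongrightarrow> 0"
    by (rule lim[OF test_functions_L2[OF m \<phi>(1)] H1_spaceD(1)[OF \<psi>H] \<phi>(3) gL(1)])
  have T4: "G b \<in> L2_space (leb_on (tube m)) \<and>
      (\<lambda>n. L2_norm (leb_on (tube m)) (\<lambda>x. dir_deriv b (tensor (\<phi> n) g) x - G b x)) \<longlonglongrightarrow> 0"
    if "b \<in> Basis" for b :: "(real^2) \<times> real"
    using that
  proof (cases rule: tube_Basis_cases)
    case (1 b')
    then show ?thesis unfolding 1(1) Ge tensor_test(2)[OF \<phi>(1) g]
      by (intro conjI tensor_L2[OF m H1_spaceD(3)[OF \<psi>H] gL(1)] 1(2)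
        lim[OF test_functions_L2[OF m test_functions_dir_deriv[OF \<phi>(1)]] H1_spaceD(3)[OF \<psi>H] \<phi>(4) gL(1)])
  next
    case 2
    then show ?thesis unfolding 2 Ge tensor_test(3)[OF \<phi>(1) g] g'_def[symmetric]
      by (intro conjI tensor_L2[OF m H1_spaceD(1)[OF \<psi>H] gL(2)]
        lim[OF test_functions_L2[OF m \<phi>(1)] H1_spaceD(1)[OF \<psi>H] \<phi>(3) gL(2)])
  qed
  have H: "has_weak_deriv (tube m) b (tensor \<psi> g) (G b)" if "b \<in> Basis" for b
    by (rule H10_limitI(2)[OF open_tube[OF m] T1 T2 T3 conjunct1[OF T4] conjunct2[OF T4]]; (assumption | rule that))
  show "tensor \<psi> g \<in> H10_space (tube m)"
    by (rule H10_limitI(1)[OF open_tube[OF m] T1 T2 T3 conjunct1[OF T4] conjunct2[OF T4]])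
  show "has_weak_deriv (tube m) (b, 0) (tensor \<psi> g) (tensor (weak_deriv m b \<psi>) g)" if "b \<in> Basis"
    using H[OF tube_Basis(1)[OF that]] by (simp only: Ge)
  show "has_weak_deriv (tube m) (0, 1) (tensor \<psi> g) (tensor \<psi> (dir_deriv 1 g))"
    using H[OF tube_Basis(2)] by (simp only: Ge g'_def)
qed

section \<open>Integration by parts, Poincare inequality and eigenvalue equation on the tube\<close>

lemma L2_inner_tendsto_right:
  assumes "\<And>n. U n \<in> L2_space M" "l \<in> L2_space M" "(\<lambda>n. L2_norm M (\<lambda>x. U n x - l x)) \<longlonglongrightarrow> 0" "v \<in> L2_space M"
  shows "(\<lambda>n. L2_inner M v (U n)) \<longlonglongrightarrow> L2_inner M v l"
proof -
  have "(\<lambda>n. cnj (L2_inner M (U n) v)) \<longlonglongrightarrow> cnj (L2_inner M l v)"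
    by (intro tendsto_cnj L2.B_tendsto assms)
  then show ?thesis using L2.B_herm[OF assms(1,4)] L2.B_herm[OF assms(2,4)] by simp
qed

text \<open>The defining identity is extended from test functions to their closure. It serves to
  move the longitudinal derivative from an arbitrary v to a product function whose second factor is
  smooth.\<close>

lemma weak_deriv_by_parts:
  assumes S: "open S" and b: "b \<in> Basis" and u: "has_weak_deriv S b u g" and v: "v \<in> H10_space S"
  shows "L2_inner (leb_on S) u (weak_deriv S b v) = - L2_inner (leb_on S) g v"
proof -
  obtain \<phi> where \<phi>: "\<And>n. \<phi> n \<in> test_functions S" "(\<lambda>n. H1_norm S (\<lambda>x. \<phi> n x - v x)) \<longlonglongrightarrow> 0"
    "(\<lambda>n. L2_norm (leb_on S) (\<lambda>x. \<phi> n x - v x)) \<longlonglongrightarrow> 0"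
    "\<And>b. b \<in> Basis \<Longrightarrow> (\<lambda>n. L2_norm (leb_on S) (\<lambda>x. dir_deriv b (\<phi> n) x - weak_deriv S b v x)) \<longlonglongrightarrow> 0"
    by (rule H10_approx[OF S v]) (rule that)
  have L: "u \<in> L2_space (leb_on S)" "g \<in> L2_space (leb_on S)" using u by (auto simp: has_weak_deriv_def)
  note vH = H10_spaceD[OF v]
  have "(\<lambda>n. L2_inner (leb_on S) u (dir_deriv b (\<phi> n))) \<longlonglongrightarrow> L2_inner (leb_on S) u (weak_deriv S b v)"
    by (rule L2_inner_tendsto_right[OF test_functions_L2[OF S test_functions_dir_deriv[OF \<phi>(1) b]] H1_spaceD(3)[OF vH b] \<phi>(4)[OF b] L(1)])
  moreover have "(\<lambda>n. - L2_inner (leb_on S) g (\<phi> n)) \<longlonglongrightarrow> - L2_inner (leb_on S) g v"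
    by (rule tendsto_minus[OF L2_inner_tendsto_right[OF test_functions_L2[OF S \<phi>(1)] H1_spaceD(1)[OF vH] \<phi>(3) L(2)]])
  moreover have "L2_inner (leb_on S) u (dir_deriv b (\<phi> n)) = - L2_inner (leb_on S) g (\<phi> n)" for n
    using u \<phi>(1)[of n] unfolding has_weak_deriv_iff[OF S b] by simp
  ultimately show ?thesis by (simp add: LIMSEQ_unique)
qed

text \<open>For test functions the variational bound for \<open>mu1\<close> holds on every slice and
  is integrated over the height; density gives the rest.\<close>

lemma tube_Poincare:
  assumes m: "open m" "bounded m" "m \<noteq> {}" and v: "v \<in> H10_space (tube m)"
  shows "mu1 m * (L2_norm (leb_on (tube m)) v)\<^sup>2 \<le>
    (\<Sum>b\<in>Basis. (L2_norm (leb_on (tube m)) (weak_deriv (tube m) (b, 0) v))\<^sup>2)"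
proof -
  let ?M = "leb_on (tube m)"
  note ot = open_tube[OF m(1)]
  have P: "mu1 m * (L2_norm (leb_on m) v)\<^sup>2 \<le> (grad_norm m v)\<^sup>2" if "v \<in> H10_space m" for v
    by (rule mu1_eigenfunction[OF m]) (use that in blast)
  have test: "mu1 m * (L2_norm ?M \<phi>)\<^sup>2 \<le> (\<Sum>b\<in>Basis. (L2_norm ?M (dir_deriv (b, 0) \<phi>))\<^sup>2)"
    if \<phi>: "\<phi> \<in> test_functions (tube m)" for \<phi>
  proof -
    have dt: "dir_deriv (b, 0) \<phi> \<in> test_functions (tube m)" if "b \<in> Basis" for b
      by (intro test_functions_dir_deriv \<phi> tube_Basis that)
    have i: "integrable ?M (\<lambda>p. (cmod (\<phi> p))\<^sup>2)" "\<And>b. b \<in> Basis \<Longrightarrow> integrable ?M (\<lambda>p. (cmod (dir_deriv (b, 0) \<phi> p))\<^sup>2)"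
      by (intro L2_spaceD(2) test_functions_L2[OF ot \<phi>] test_functions_L2[OF ot dt])+
    let ?F = "\<lambda>p. (\<Sum>b\<in>Basis. (cmod (dir_deriv (b, 0) \<phi> p))\<^sup>2) - mu1 m * (cmod (\<phi> p))\<^sup>2"
    have iF: "integrable ?M ?F"
      by (intro Bochner_Integration.integrable_diff Bochner_Integration.integrable_sum integrable_mult_right i)
    have "0 \<le> (\<integral>x. ?F (x, s) \<partial>leb_on m)" for s
    proof -
      let ?\<phi> = "\<lambda>x. \<phi> (x, s)"
      have t: "?\<phi> \<in> test_functions m" by (rule slice_test(1)[OF \<phi>])
      have t': "dir_deriv b ?\<phi> \<in> test_functions m" if "b \<in> Basis" for b by (rule test_functions_dir_deriv[OF t that])
      have "(\<integral>x. ?F (x, s) \<partial>leb_on m) = (\<Sum>b\<in>Basis. (L2_norm (leb_on m) (dir_deriv b ?\<phi>))\<^sup>2) - mu1 m * (L2_norm (leb_on m) ?\<phi>)\<^sup>2"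
      proof -
        have i: "integrable (leb_on m) (\<lambda>x. (cmod (?\<phi> x))\<^sup>2)"
          "\<And>b. b \<in> Basis \<Longrightarrow> integrable (leb_on m) (\<lambda>x. (cmod (dir_deriv b ?\<phi> x))\<^sup>2)"
          by (intro L2_spaceD(2) test_functions_L2[OF m(1) t] test_functions_L2[OF m(1) t'])+
        have e: "?F (x, s) = (\<Sum>b\<in>Basis. (cmod (dir_deriv b ?\<phi> x))\<^sup>2) - mu1 m * (cmod (?\<phi> x))\<^sup>2" for x
          by (simp add: slice_test(2)[OF \<phi>])
        show ?thesis unfolding e L2_norm_sq using i
          by (subst Bochner_Integration.integral_diff) (auto simp: Bochner_Integration.integral_sum)
      qed
      also have "(\<Sum>b\<in>Basis. (L2_norm (leb_on m) (dir_deriv b ?\<phi>))\<^sup>2) = (grad_norm m ?\<phi>)\<^sup>2"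
        unfolding grad_norm_sq
      proof (intro sum.cong refl arg_cong[where f="\<lambda>x. x\<^sup>2"])
        fix b :: "real^2" assume b: "b \<in> Basis"
        show "L2_norm (leb_on m) (dir_deriv b ?\<phi>) = L2_norm (leb_on m) (weak_deriv m b ?\<phi>)"
          by (intro L2_norm_cong_AE L2_spaceD(1) test_functions_L2[OF m(1) t'[OF b]] H1_spaceD(3)[OF test_functions_H1[OF m(1) t] b]
              eventually_mono[OF weak_deriv_test_AE[OF m(1) b t]]) simp
      qed
      finally show ?thesis using P[OF test_functions_H10[OF m(1) t]] by simp
    qed
    then have "0 \<le> (\<integral>p. ?F p \<partial>?M)"
      unfolding integral_tube[OF m(1) iF] by (rule Bochner_Integration.integral_nonneg)
    also have "\<dots> = (\<Sum>b\<in>Basis. (L2_norm ?M (dir_deriv (b, 0) \<phi>))\<^sup>2) - mu1 m * (L2_norm ?M \<phi>)\<^sup>2"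
      unfolding L2_norm_sq using i
      by (subst Bochner_Integration.integral_diff) (auto simp: Bochner_Integration.integral_sum)
    finally show ?thesis by simp
  qed
  obtain \<phi> where \<phi>: "\<And>n. \<phi> n \<in> test_functions (tube m)" "(\<lambda>n. H1_norm (tube m) (\<lambda>x. \<phi> n x - v x)) \<longlonglongrightarrow> 0"
    "(\<lambda>n. L2_norm ?M (\<lambda>x. \<phi> n x - v x)) \<longlonglongrightarrow> 0"
    "\<And>b. b \<in> Basis \<Longrightarrow> (\<lambda>n. L2_norm ?M (\<lambda>x. dir_deriv b (\<phi> n) x - weak_deriv (tube m) b v x)) \<longlonglongrightarrow> 0"
    by (rule H10_approx[OF ot v]) (rule that)
  note vH = H10_spaceD[OF v]
  have "(\<lambda>n. mu1 m * (L2_norm ?M (\<phi> n))\<^sup>2) \<longlonglongrightarrow> mu1 m * (L2_norm ?M v)\<^sup>2"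
    by (intro tendsto_intros L2.N_tendsto[OF test_functions_L2[OF ot \<phi>(1)] H1_spaceD(1)[OF vH] \<phi>(3)])
  moreover have "(\<lambda>n. \<Sum>b\<in>Basis. (L2_norm ?M (dir_deriv (b, 0) (\<phi> n)))\<^sup>2)
    \<longlonglongrightarrow> (\<Sum>b\<in>Basis. (L2_norm ?M (weak_deriv (tube m) (b, 0) v))\<^sup>2)"
  proof (intro tendsto_sum tendsto_power)
    fix b :: "real^2" assume "b \<in> Basis"
    then have b: "(b, 0) \<in> (Basis :: ((real^2) \<times> real) set)" by (rule tube_Basis)
    show "(\<lambda>n. L2_norm ?M (dir_deriv (b, 0) (\<phi> n))) \<longlonglongrightarrow> L2_norm ?M (weak_deriv (tube m) (b, 0) v)"
      by (rule L2.N_tendsto[OF test_functions_L2[OF ot test_functions_dir_deriv[OF \<phi>(1) b]] H1_spaceD(3)[OF vH b] \<phi>(4)[OF b]])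
  qed
  ultimately show ?thesis by (rule LIMSEQ_le) (use test[OF \<phi>(1)] in blast)
qed

text \<open>On a slice of a test function the factor g(s) comes out of the cross-sectional integral,
  and what remains is the weak eigenvalue equation of \<psi>. Integration over s and density give
  the claim.\<close>

lemma tube_eigenfunction:
  assumes m: "open m" and \<psi>: "\<psi> \<in> H10_space m"
    and eig: "\<And>v. v \<in> H10_space m \<Longrightarrow> grad_inner m \<psi> v = complex_of_real \<mu> * L2_inner (leb_on m) \<psi> v"
    and g: "g \<in> L2_space lborel" and v: "v \<in> H10_space (tube m)"
  shows "(\<Sum>b\<in>Basis. L2_inner (leb_on (tube m)) (tensor (weak_deriv m b \<psi>) g) (weak_deriv (tube m) (b, 0) v))
    = complex_of_real \<mu> * L2_inner (leb_on (tube m)) (tensor \<psi> g) v"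
proof -
  let ?M = "leb_on (tube m)"
  note ot = open_tube[OF m] and \<psi>H = H10_spaceD[OF \<psi>] and vH = H10_spaceD[OF v]
  have TL: "tensor (weak_deriv m b \<psi>) g \<in> L2_space ?M" if "b \<in> Basis" for b
    by (rule tensor_L2[OF m H1_spaceD(3)[OF \<psi>H that] g])
  have TL0: "tensor \<psi> g \<in> L2_space ?M" by (rule tensor_L2[OF m H1_spaceD(1)[OF \<psi>H] g])
  have test: "(\<Sum>b\<in>Basis. L2_inner ?M (tensor (weak_deriv m b \<psi>) g) (dir_deriv (b, 0) \<phi>)) = complex_of_real \<mu> * L2_inner ?M (tensor \<psi> g) \<phi>"
    if \<phi>: "\<phi> \<in> test_functions (tube m)" for \<phi>
  proof -
    have dt: "dir_deriv (b, 0) \<phi> \<in> test_functions (tube m)" if "b \<in> Basis" for b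
      by (intro test_functions_dir_deriv \<phi> tube_Basis that)
    have i: "integrable ?M (\<lambda>p. tensor \<psi> g p * cnj (\<phi> p))"
      "\<And>b. b \<in> Basis \<Longrightarrow> integrable ?M (\<lambda>p. tensor (weak_deriv m b \<psi>) g p * cnj (dir_deriv (b, 0) \<phi> p))"
      by (intro L2_integrable_mult TL TL0 test_functions_L2[OF ot \<phi>] test_functions_L2[OF ot dt]; assumption)+
    let ?F = "\<lambda>p. (\<Sum>b\<in>Basis. tensor (weak_deriv m b \<psi>) g p * cnj (dir_deriv (b, 0) \<phi> p)) - complex_of_real \<mu> * (tensor \<psi> g p * cnj (\<phi> p))"
    have iF: "integrable ?M ?F"
      by (intro Bochner_Integration.integrable_diff Bochner_Integration.integrable_sum integrable_mult_right i)
    have "(\<integral>x. ?F (x, s) \<partial>leb_on m) = 0" for s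
    proof -
      let ?\<phi> = "\<lambda>x. \<phi> (x, s)"
      have t: "?\<phi> \<in> test_functions m" by (rule slice_test(1)[OF \<phi>])
      have t': "dir_deriv b ?\<phi> \<in> test_functions m" if "b \<in> Basis" for b by (rule test_functions_dir_deriv[OF t that])
      have i1: "integrable (leb_on m) (\<lambda>x. \<psi> x * cnj (?\<phi> x))"
        by (intro L2_integrable_mult H1_spaceD(1)[OF \<psi>H] test_functions_L2[OF m t])
      have i2: "integrable (leb_on m) (\<lambda>x. weak_deriv m b \<psi> x * cnj (dir_deriv b ?\<phi> x))" if "b \<in> Basis" for b
        by (intro L2_integrable_mult H1_spaceD(3)[OF \<psi>H that] test_functions_L2[OF m t'[OF that]])
      have "?F (x, s) = g s * ((\<Sum>b\<in>Basis. weak_deriv m b \<psi> x * cnj (dir_deriv b ?\<phi> x)) - complex_of_real \<mu> * (\<psi> x * cnj (?\<phi> x)))" for x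
        unfolding slice_test(2)[OF \<phi>] by (simp add: tensor_def sum_distrib_left algebra_simps)
      then have "(\<integral>x. ?F (x, s) \<partial>leb_on m)
        = g s * (\<integral>x. (\<Sum>b\<in>Basis. weak_deriv m b \<psi> x * cnj (dir_deriv b ?\<phi> x)) - complex_of_real \<mu> * (\<psi> x * cnj (?\<phi> x)) \<partial>leb_on m)"
        by (simp only: Bochner_Integration.integral_mult_right_zero)
      also have "(\<integral>x. (\<Sum>b\<in>Basis. weak_deriv m b \<psi> x * cnj (dir_deriv b ?\<phi> x)) - complex_of_real \<mu> * (\<psi> x * cnj (?\<phi> x)) \<partial>leb_on m)
        = (\<integral>x. (\<Sum>b\<in>Basis. weak_deriv m b \<psi> x * cnj (dir_deriv b ?\<phi> x)) \<partial>leb_on m) - (\<integral>x. complex_of_real \<mu> * (\<psi> x * cnj (?\<phi> x)) \<partial>leb_on m)"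
        by (intro Bochner_Integration.integral_diff Bochner_Integration.integrable_sum integrable_mult_right i1 i2)
      also have "(\<integral>x. (\<Sum>b\<in>Basis. weak_deriv m b \<psi> x * cnj (dir_deriv b ?\<phi> x)) \<partial>leb_on m)
        = (\<Sum>b\<in>Basis. L2_inner (leb_on m) (weak_deriv m b \<psi>) (dir_deriv b ?\<phi>))"
        unfolding L2_inner_def by (intro Bochner_Integration.integral_sum i2)
      also have "\<dots> = grad_inner m \<psi> ?\<phi>"
        unfolding grad_inner_def
      proof (intro sum.cong refl)
        fix b :: "real^2" assume b: "b \<in> Basis"
        show "L2_inner (leb_on m) (weak_deriv m b \<psi>) (dir_deriv b ?\<phi>) = L2_inner (leb_on m) (weak_deriv m b \<psi>) (weak_deriv m b ?\<phi>)"
          by (intro L2_inner_cong_AE L2_spaceD(1) H1_spaceD(3)[OF \<psi>H b] test_functions_L2[OF m t'[OF b]]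
              H1_spaceD(3)[OF test_functions_H1[OF m t] b] AE_I2 refl eventually_mono[OF weak_deriv_test_AE[OF m b t]]) simp
      qed
      also have "\<dots> = complex_of_real \<mu> * L2_inner (leb_on m) \<psi> ?\<phi>" by (rule eig[OF test_functions_H10[OF m t]])
      also have "(\<integral>x. complex_of_real \<mu> * (\<psi> x * cnj (?\<phi> x)) \<partial>leb_on m) = complex_of_real \<mu> * L2_inner (leb_on m) \<psi> ?\<phi>"
        unfolding L2_inner_def by (rule Bochner_Integration.integral_mult_right_zero)
      finally show ?thesis by simp
    qed
    then have "0 = (\<integral>p. ?F p \<partial>?M)"
      unfolding integral_tube[OF m iF] by simp
    also have "\<dots> = (\<integral>p. (\<Sum>b\<in>Basis. tensor (weak_deriv m b \<psi>) g p * cnj (dir_deriv (b, 0) \<phi> p)) \<partial>?M)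
      - (\<integral>p. complex_of_real \<mu> * (tensor \<psi> g p * cnj (\<phi> p)) \<partial>?M)"
      by (intro Bochner_Integration.integral_diff Bochner_Integration.integrable_sum integrable_mult_right i)
    also have "(\<integral>p. (\<Sum>b\<in>Basis. tensor (weak_deriv m b \<psi>) g p * cnj (dir_deriv (b, 0) \<phi> p)) \<partial>?M)
      = (\<Sum>b\<in>Basis. L2_inner ?M (tensor (weak_deriv m b \<psi>) g) (dir_deriv (b, 0) \<phi>))"
      unfolding L2_inner_def by (intro Bochner_Integration.integral_sum i)
    also have "(\<integral>p. complex_of_real \<mu> * (tensor \<psi> g p * cnj (\<phi> p)) \<partial>?M) = complex_of_real \<mu> * L2_inner ?M (tensor \<psi> g) \<phi>"
      unfolding L2_inner_def by (rule Bochner_Integration.integral_mult_right_zero)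
    finally show ?thesis by simp
  qed
  obtain \<phi> where \<phi>: "\<And>n. \<phi> n \<in> test_functions (tube m)" "(\<lambda>n. H1_norm (tube m) (\<lambda>x. \<phi> n x - v x)) \<longlonglongrightarrow> 0"
    "(\<lambda>n. L2_norm ?M (\<lambda>x. \<phi> n x - v x)) \<longlonglongrightarrow> 0"
    "\<And>b. b \<in> Basis \<Longrightarrow> (\<lambda>n. L2_norm ?M (\<lambda>x. dir_deriv b (\<phi> n) x - weak_deriv (tube m) b v x)) \<longlonglongrightarrow> 0"
    by (rule H10_approx[OF ot v]) (rule that)
  have "(\<lambda>n. \<Sum>b\<in>Basis. L2_inner ?M (tensor (weak_deriv m b \<psi>) g) (dir_deriv (b, 0) (\<phi> n)))
    \<longlonglongrightarrow> (\<Sum>b\<in>Basis. L2_inner ?M (tensor (weak_deriv m b \<psi>) g) (weak_deriv (tube m) (b, 0) v))"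
  proof (intro tendsto_sum)
    fix b :: "real^2" assume b': "b \<in> Basis"
    then have b: "(b, 0) \<in> (Basis :: ((real^2) \<times> real) set)" by (rule tube_Basis)
    show "(\<lambda>n. L2_inner ?M (tensor (weak_deriv m b \<psi>) g) (dir_deriv (b, 0) (\<phi> n))) \<longlonglongrightarrow> L2_inner ?M (tensor (weak_deriv m b \<psi>) g) (weak_deriv (tube m) (b, 0) v)"
      by (rule L2_inner_tendsto_right[OF test_functions_L2[OF ot test_functions_dir_deriv[OF \<phi>(1) b]] H1_spaceD(3)[OF vH b] \<phi>(4)[OF b] TL[OF b']])
  qed
  moreover have "(\<lambda>n. complex_of_real \<mu> * L2_inner ?M (tensor \<psi> g) (\<phi> n)) \<longlonglongrightarrow> complex_of_real \<mu> * L2_inner ?M (tensor \<psi> g) v"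
    by (intro tendsto_intros L2_inner_tendsto_right[OF test_functions_L2[OF ot \<phi>(1)] H1_spaceD(1)[OF vH] \<phi>(3) TL0])
  ultimately show ?thesis using test[OF \<phi>(1)] by (simp add: LIMSEQ_unique)
qed

section \<open>Quasi-modes on the line\<close>

lemma L2_norm_lborel_affine:
  fixes f :: "real \<Rightarrow> complex"
  assumes "c > 0"
  shows "L2_norm lborel (\<lambda>s. f (c * s + t)) = L2_norm lborel f / sqrt c"
proof -
  have "(\<integral>s. (cmod (f s))\<^sup>2 \<partial>lborel) = \<bar>c\<bar> *\<^sub>R (\<integral>s. (cmod (f (t + c * s)))\<^sup>2 \<partial>lborel)"
    using assms by (intro lborel_integral_real_affine) auto
  then have "(\<integral>s. (cmod (f (c * s + t)))\<^sup>2 \<partial>lborel) = (\<integral>s. (cmod (f s))\<^sup>2 \<partial>lborel) / c"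
    using assms by (simp add: add.commute)
  then show ?thesis by (simp add: L2_norm_def real_sqrt_divide)
qed

lemma test_functions_affine_line:
  fixes g :: "real \<Rightarrow> complex"
  assumes g: "g \<in> test_functions UNIV" and c: "c \<noteq> 0"
  shows "(\<lambda>s. g (c * s + t)) \<in> test_functions UNIV"
    and "dir_deriv 1 (\<lambda>s. g (c * s + t)) = (\<lambda>s. complex_of_real c * dir_deriv 1 g (c * s + t))"
proof -
  note sm = test_functionsD(1)[OF g]
  have L: "bounded_linear (\<lambda>s::real. c * s)" by (rule bounded_linear_mult_right)
  show "dir_deriv 1 (\<lambda>s. g (c * s + t)) = (\<lambda>s. complex_of_real c * dir_deriv 1 g (c * s + t))"
    unfolding dir_deriv_affine[OF sm L] using dir_deriv_expand[OF sm, of "c * 1"] by auto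
  show "(\<lambda>s. g (c * s + t)) \<in> test_functions UNIV"
  proof (rule test_functionsI[OF smooth_fun_affine[OF sm L]])
    let ?K = "closure {x. g x \<noteq> 0}"
    show "compact ((\<lambda>s. (s - t) / c) ` ?K)"
      by (intro compact_continuous_image continuous_intros test_functionsD(2)[OF g]) (use c in auto)
    fix x assume x: "x \<notin> (\<lambda>s. (s - t) / c) ` ?K"
    have "c * x + t \<notin> ?K"
    proof
      assume "c * x + t \<in> ?K"
      from imageI[OF this, of "\<lambda>s. (s - t) / c"] x c show False by simp
    qed
    then show "g (c * x + t) = 0" by (rule zero_outside_closure)
  qed simp
qed

lemma dir_deriv_exp_ik: "dir_deriv 1 (\<lambda>s::real. exp (\<i> * of_real (k * s))) = (\<lambda>s. \<i> * of_real k * exp (\<i> * of_real (k * s)))"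
proof
  fix s
  show "dir_deriv 1 (\<lambda>s::real. exp (\<i> * of_real (k * s))) s = \<i> * of_real k * exp (\<i> * of_real (k * s))"
    using dir_deriv_eqI_vector[OF exp_ik_derivative[of 1 k s]] by simp
qed

lemma L2_norm_times_phase: "(\<And>x. cmod (e x) = 1) \<Longrightarrow> L2_norm M (\<lambda>x. f x * e x) = L2_norm M f"
  by (simp add: L2_norm_def norm_mult)

text \<open>For g(s) = \<zeta>(c s) exp(i k s) the terms with k^2 cancel in g'' + k^2 g and leave
  c^2 \<zeta>'' + 2 i k c \<zeta>', taken at c s and multiplied by the phase. All norms scale by the
  same factor under dilation, so the relative error tends to 0 with c.\<close>

lemma quasimode:
  fixes k \<delta> :: real
  assumes "\<delta> > 0"
  obtains g :: "real \<Rightarrow> complex" where "g \<in> test_functions UNIV" "L2_norm lborel g > 0"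
    "L2_norm lborel (\<lambda>s. dir_deriv 1 (dir_deriv 1 g) s + complex_of_real (k\<^sup>2) * g s) \<le> \<delta> * L2_norm lborel g"
proof -
  obtain \<zeta> :: "real \<Rightarrow> complex" where \<zeta>: "\<zeta> \<in> test_functions UNIV" "L2_norm (leb_on UNIV) \<zeta> = 1"
    using exists_normalised_test_function[of UNIV] by auto
  have \<zeta>1: "L2_norm lborel \<zeta> = 1" using L2_norm_leb_on_test[of UNIV \<zeta>] \<zeta>(2) by simp
  have b1: "(1::real) \<in> Basis" by simp
  define A where "A = L2_norm lborel (dir_deriv 1 (dir_deriv 1 \<zeta>)) + 2 * \<bar>k\<bar> * L2_norm lborel (dir_deriv 1 \<zeta>)"
  have A: "A \<ge> 0" by (simp add: A_def)
  \<comment> \<open>The bound c <= 1 allows c^2 to be replaced by c, so that the relative error is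
    at most c A; the other bound makes this at most \<delta>.\<close>
  define c where "c = min 1 (\<delta> / (A + 1))"
  have c: "c > 0" "c \<le> 1" "c * A \<le> \<delta>"
  proof -
    show "c > 0" "c \<le> 1" using assms A by (auto simp: c_def)
    have "c * A \<le> \<delta> / (A + 1) * A" using A by (intro mult_right_mono) (auto simp: c_def)
    also have "\<dots> \<le> \<delta>" using A assms by (simp add: field_simps)
    finally show "c * A \<le> \<delta>" .
  qed
  define X where "X = (\<lambda>s. \<zeta> (c * s + 0))"
  define E where "E = (\<lambda>s::real. exp (\<i> * of_real (k * s)))"
  have c0: "c \<noteq> 0" using c by simp
  have X: "X \<in> test_functions UNIV" unfolding X_def by (rule test_functions_affine_line(1)[OF \<zeta>(1) c0])
  have dX: "dir_deriv 1 X = (\<lambda>s. complex_of_real c * dir_deriv 1 \<zeta> (c * s + 0))"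
    unfolding X_def by (rule test_functions_affine_line(2)[OF \<zeta>(1) c0])
  note d\<zeta> = test_functions_dir_deriv[OF \<zeta>(1) b1]
  have ddX: "dir_deriv 1 (dir_deriv 1 X) = (\<lambda>s. complex_of_real (c\<^sup>2) * dir_deriv 1 (dir_deriv 1 \<zeta>) (c * s + 0))"
    unfolding dX using dir_deriv_mult[OF smooth_fun_const[of "complex_of_real c"] test_functionsD(1)[OF test_functions_affine_line(1)[OF d\<zeta> c0, of 0]], of 1]
      test_functions_affine_line(2)[OF d\<zeta> c0, of 0]
    by (simp add: dir_deriv_const power2_eq_square mult.assoc)
  have E: "smooth_fun E" "dir_deriv 1 E = (\<lambda>s. \<i> * of_real k * E s)" "cmod (E s) = 1" for s
    unfolding E_def by (rule smooth_fun_exp_ik dir_deriv_exp_ik | simp)+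
  define g where "g = (\<lambda>s. X s * E s)"
  note sX = test_functionsD(1)[OF X]
  note sX' = smooth_fun_dir_deriv[OF sX b1]
  have g: "g \<in> test_functions UNIV" unfolding g_def by (rule test_functions_mult[OF X E(1)])
  have dg: "dir_deriv 1 g = (\<lambda>s. (\<i> * of_real k * X s + dir_deriv 1 X s) * E s)"
    unfolding g_def dir_deriv_mult[OF sX E(1)] E(2) by (auto simp: algebra_simps)
  have s1: "smooth_fun (\<lambda>s. \<i> * of_real k * X s + dir_deriv 1 X s)"
    by (intro smooth_fun_add smooth_fun_mult smooth_fun_const sX sX')
  have d1: "dir_deriv 1 (\<lambda>s. \<i> * of_real k * X s + dir_deriv 1 X s) = (\<lambda>s. \<i> * of_real k * dir_deriv 1 X s + dir_deriv 1 (dir_deriv 1 X) s)"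
    unfolding dir_deriv_add[OF smooth_fun_mult[OF smooth_fun_const sX] sX'] dir_deriv_mult[OF smooth_fun_const sX] dir_deriv_const
    by simp
  have ddg: "dir_deriv 1 (dir_deriv 1 g) s + complex_of_real (k\<^sup>2) * g s
      = (dir_deriv 1 (dir_deriv 1 X) s + 2 * \<i> * of_real k * dir_deriv 1 X s) * E s" for s
    unfolding dg dir_deriv_mult[OF s1 E(1)] E(2) d1 unfolding g_def
    by (simp add: algebra_simps power2_eq_square)
  have "L2_norm lborel g = L2_norm lborel X" unfolding g_def by (rule L2_norm_times_phase[OF E(3)])
  also have "\<dots> = 1 / sqrt c" unfolding X_def by (simp only: L2_norm_lborel_affine[OF c(1)] \<zeta>1)
  finally have gn: "L2_norm lborel g = 1 / sqrt c" .
  have L: "dir_deriv 1 X \<in> L2_space lborel" "dir_deriv 1 (dir_deriv 1 X) \<in> L2_space lborel"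
    by (rule test_functions_L2_lborel[OF test_functions_dir_deriv[OF X b1]]
        test_functions_L2_lborel[OF test_functions_dir_deriv[OF test_functions_dir_deriv[OF X b1] b1]])+
  have L\<zeta>: "(\<lambda>s. dir_deriv 1 \<zeta> (c * s + 0)) \<in> L2_space lborel" "(\<lambda>s. dir_deriv 1 (dir_deriv 1 \<zeta>) (c * s + 0)) \<in> L2_space lborel"
    by (rule test_functions_L2_lborel[OF test_functions_affine_line(1)[OF d\<zeta> c0]]
        test_functions_L2_lborel[OF test_functions_affine_line(1)[OF test_functions_dir_deriv[OF d\<zeta> b1] c0]])+
  have "L2_norm lborel (\<lambda>s. dir_deriv 1 (dir_deriv 1 g) s + complex_of_real (k\<^sup>2) * g s)
     = L2_norm lborel (\<lambda>s. dir_deriv 1 (dir_deriv 1 X) s + (2 * \<i> * of_real k) * dir_deriv 1 X s)"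
    unfolding ddg by (rule L2_norm_times_phase[OF E(3)])
  also have "\<dots> \<le> L2_norm lborel (dir_deriv 1 (dir_deriv 1 X)) + cmod (2 * \<i> * of_real k) * L2_norm lborel (dir_deriv 1 X)"
    by (rule L2.triangle[OF L(2,1)])
  also have "\<dots> = c\<^sup>2 * (L2_norm lborel (dir_deriv 1 (dir_deriv 1 \<zeta>)) / sqrt c) + 2 * \<bar>k\<bar> * (c * (L2_norm lborel (dir_deriv 1 \<zeta>) / sqrt c))"
    unfolding ddX unfolding dX L2.N_scale[OF L\<zeta>(1)] L2.N_scale[OF L\<zeta>(2)] L2_norm_lborel_affine[OF c(1)]
    using c by (simp add: norm_mult norm_power)
  also have "\<dots> \<le> c * (L2_norm lborel (dir_deriv 1 (dir_deriv 1 \<zeta>)) / sqrt c) + 2 * \<bar>k\<bar> * (c * (L2_norm lborel (dir_deriv 1 \<zeta>) / sqrt c))"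
  proof (intro add_mono mult_right_mono order_refl)
    show "c\<^sup>2 \<le> c" using c by (simp add: power2_eq_square mult_left_le)
  qed (use c in auto)
  also have "\<dots> = (c * A) * (1 / sqrt c)" by (simp add: A_def algebra_simps add_divide_distrib)
  also have "\<dots> \<le> \<delta> * (1 / sqrt c)" using c by (intro mult_right_mono) auto
  finally show ?thesis using that[OF g] gn c(1) by simp
qed

section \<open>The operator \<open>H\<^sub>\<gamma>\<close> for a fixed bounded twist\<close>

text \<open>The deterministic part of the argument: one realisation of the twist with bound
  \<Gamma>, and a radius R of the cross-section. Randomness will enter only through this bound and
  the long intervals of small twist assumed in \<open>spectrumI\<close>.\<close>

locale twisted_tube =
  fixes m :: "(real^2) set" and \<gamma> :: "real \<Rightarrow> real" and \<Gamma> R :: real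
  assumes m: "open m" "bounded m" "m \<noteq> {}"
    and \<gamma>_meas: "\<gamma> \<in> borel_measurable borel" and \<gamma>_bound: "\<And>s. \<bar>\<gamma> s\<bar> \<le> \<Gamma>"
    and R: "\<And>x. x \<in> m \<Longrightarrow> norm x \<le> R"
begin

abbreviation "M \<equiv> leb_on (tube m)"
abbreviation "V \<equiv> H10_space (tube m)"
abbreviation "D1 \<equiv> tube_d1 m"
abbreviation "D2 \<equiv> tube_d2 m"
abbreviation "D3 \<equiv> tube_d3 m"
abbreviation "D\<tau> \<equiv> tube_dtau m"

definition T :: "((real^2) \<times> real \<Rightarrow> complex) \<Rightarrow> (real^2) \<times> real \<Rightarrow> complex" where
  "T u p = complex_of_real (\<gamma> (snd p)) * D\<tau> u p + D3 u p"

lemmas ot = open_tube[OF m(1)]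

lemma R0: "R \<ge> 0"
  using R m(3) norm_ge_zero order_trans by blast

lemma \<Gamma>0: "\<Gamma> \<ge> 0"
  using \<gamma>_bound[of 0] by linarith

lemma space_M: "space M = tube m"
  using ot by (simp add: space_restrict_space)

lemma ax_Basis: "(axis 1 1, 0) \<in> (Basis :: ((real^2) \<times> real) set)" "(axis 2 1, 0) \<in> (Basis :: ((real^2) \<times> real) set)"
  by (auto simp: tube_Basis Basis_real2)

lemma D_L2:
  assumes "u \<in> V"
  shows "u \<in> L2_space M" "D1 u \<in> L2_space M" "D2 u \<in> L2_space M" "D3 u \<in> L2_space M"
  unfolding tube_d1_def tube_d2_def tube_d3_def
  by (intro H1_spaceD H10_spaceD[OF assms] ax_Basis tube_Basis(2))+

lemma D_lin:
  assumes "u \<in> V" "v \<in> V"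
  shows "AE p in M. D1 (\<lambda>x. u x + c * v x) p = D1 u p + c * D1 v p"
    "AE p in M. D2 (\<lambda>x. u x + c * v x) p = D2 u p + c * D2 v p"
    "AE p in M. D3 (\<lambda>x. u x + c * v x) p = D3 u p + c * D3 v p"
  unfolding tube_d1_def tube_d2_def tube_d3_def
  by (intro weak_deriv_lin[OF ot] H10_spaceD assms ax_Basis tube_Basis(2))+

lemma sum_Basis_tube:
  "(\<Sum>b\<in>(Basis :: ((real^2) \<times> real) set). f b) = f (axis 1 1, 0) + f (axis 2 1, 0) + f (0, 1)"
proof -
  have "axis 1 1 \<noteq> (axis 2 1 :: real^2)" by (simp add: axis_eq_axis)
  then have ne: "(axis 1 1 :: real^2, 0::real) \<noteq> (axis 2 1, 0)" by simp
  have B: "(Basis :: ((real^2) \<times> real) set) = {(axis 1 1, 0), (axis 2 1, 0), (0, 1)}"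
    by (auto simp: Basis_prod_def Basis_real2)
  show ?thesis unfolding B using ne by (simp add: add.assoc)
qed

lemma H1_norm_sq_tube:
  "(H1_norm (tube m) u)\<^sup>2 = (L2_norm M u)\<^sup>2 + (L2_norm M (D1 u))\<^sup>2 + (L2_norm M (D2 u))\<^sup>2 + (L2_norm M (D3 u))\<^sup>2"
  unfolding H1_norm_sq sum_Basis_tube tube_d1_def tube_d2_def tube_d3_def by simp

lemma D_norm_le:
  "L2_norm M u \<le> H1_norm (tube m) u" "L2_norm M (D1 u) \<le> H1_norm (tube m) u"
  "L2_norm M (D2 u) \<le> H1_norm (tube m) u" "L2_norm M (D3 u) \<le> H1_norm (tube m) u"
  by (rule power2_le_imp_le; simp add: H1_norm_sq_tube)+

lemma coord_mult:
  assumes "f \<in> L2_space M"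
  shows "(\<lambda>p. complex_of_real (fst p $ i) * f p) \<in> L2_space M"
    "L2_norm M (\<lambda>p. complex_of_real (fst p $ i) * f p) \<le> R * L2_norm M f"
proof -
  have "(\<lambda>p :: (real^2) \<times> real. complex_of_real (fst p $ i)) \<in> borel_measurable borel"
    by (intro borel_measurable_continuous_onI continuous_intros)
  then have 1: "(\<lambda>p. complex_of_real (fst p $ i)) \<in> borel_measurable M"
    by (intro measurable_restrict_space1) simp
  have 2: "cmod (complex_of_real (fst p $ i)) \<le> R" if "p \<in> space M" for p
  proof -
    have "p \<in> tube m" using that unfolding space_M .
    then have "fst p \<in> m" by (auto simp: tube_def)
    then show ?thesis using R[of "fst p"] component_le_norm_cart[of "fst p" i] by simp
  qed
  show "(\<lambda>p. complex_of_real (fst p $ i) * f p) \<in> L2_space M"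
    "L2_norm M (\<lambda>p. complex_of_real (fst p $ i) * f p) \<le> R * L2_norm M f"
    using L2_mult_bounded[OF assms 1 2] R0 by simp_all
qed

lemma height_mult:
  assumes "f \<in> L2_space M" "h \<in> borel_measurable borel" "\<And>s. \<bar>h s\<bar> \<le> K"
  shows "(\<lambda>p. complex_of_real (h (snd p)) * f p) \<in> L2_space M"
    "L2_norm M (\<lambda>p. complex_of_real (h (snd p)) * f p) \<le> K * L2_norm M f"
proof -
  have "(\<lambda>p :: (real^2) \<times> real. h (snd p)) \<in> borel_measurable borel"
    using assms(2) by (intro measurable_compose[OF _ assms(2)] borel_measurable_continuous_onI continuous_intros)
  then have 1: "(\<lambda>p. complex_of_real (h (snd p))) \<in> borel_measurable M"
    by (intro measurable_restrict_space1 borel_measurable_of_real) simp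
  have 2: "cmod (complex_of_real (h (snd p))) \<le> K" for p :: "(real^2) \<times> real" using assms(3) by simp
  have "K \<ge> 0" using assms(3)[of 0] by linarith
  then show "(\<lambda>p. complex_of_real (h (snd p)) * f p) \<in> L2_space M"
    "L2_norm M (\<lambda>p. complex_of_real (h (snd p)) * f p) \<le> K * L2_norm M f"
    using L2_mult_bounded[OF assms(1) 1 2] by simp_all
qed

lemma dtau_L2:
  assumes "u \<in> V"
  shows "D\<tau> u \<in> L2_space M" "L2_norm M (D\<tau> u) \<le> R * (L2_norm M (D1 u) + L2_norm M (D2 u))"
proof -
  have e: "D\<tau> u = (\<lambda>p. complex_of_real (fst p $ 1) * D2 u p - complex_of_real (fst p $ 2) * D1 u p)"
    by (auto simp: tube_dtau_def)
  note c = coord_mult[OF D_L2(3)[OF assms], of 1] coord_mult[OF D_L2(2)[OF assms], of 2]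
  show "D\<tau> u \<in> L2_space M" unfolding e by (intro L2.diff c)
  show "L2_norm M (D\<tau> u) \<le> R * (L2_norm M (D1 u) + L2_norm M (D2 u))"
    using L2.triangle_diff[OF c(1,3)] c(2,4) unfolding e by (simp add: distrib_left)
qed

lemma \<gamma>_mult:
  assumes "f \<in> L2_space M"
  shows "(\<lambda>p. complex_of_real (\<gamma> (snd p)) * f p) \<in> L2_space M"
    "L2_norm M (\<lambda>p. complex_of_real (\<gamma> (snd p)) * f p) \<le> \<Gamma> * L2_norm M f"
  using height_mult[OF assms \<gamma>_meas \<gamma>_bound] .

lemma T_L2: "u \<in> V \<Longrightarrow> T u \<in> L2_space M"
  unfolding T_def[abs_def] by (intro L2.add \<gamma>_mult dtau_L2 D_L2)

lemma T_lin:
  assumes "u \<in> V" "v \<in> V"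
  shows "AE p in M. T (\<lambda>x. u x + c * v x) p = T u p + c * T v p"
  using D_lin[OF assms, of c] by eventually_elim (simp add: T_def tube_dtau_def algebra_simps)

section \<open>The sesquilinear form of the twisted operator and its comparison with the H^1
  norm\<close>

definition Qi :: "((real^2) \<times> real \<Rightarrow> complex) \<Rightarrow> ((real^2) \<times> real \<Rightarrow> complex) \<Rightarrow> complex" where
  "Qi u v = L2_inner M (D1 u) (D1 v) + L2_inner M (D2 u) (D2 v) + L2_inner M (T u) (T v)"

lemma zero_V: "(\<lambda>_. 0) \<in> V"
  by (rule test_functions_H10[OF ot test_functions_zero])

lemma Qi_pos_form: "pos_form V Qi"
  unfolding Qi_def
  by (intro pos_form_add pos_form_pullback H10_lin[OF ot] zero_V D_L2 D_lin T_L2 T_lin)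

sublocale Q: pos_form V Qi
  by (rule Qi_pos_form)

sublocale H: complete_pos_form V "H1_inner (tube m)"
  rewrites "pos_form.N (H1_inner (tube m)) = H1_norm (tube m)"
  by (rule H10_complete[OF ot], rule H1_norm_eq[OF ot])

sublocale L: pos_form V "L2_inner M"
  rewrites "pos_form.N (L2_inner M) = L2_norm M"
  by (rule H10_L2_pos_form[OF ot], rule L2_norm_eq)

lemma QN_sq: "(Q.N u)\<^sup>2 = (L2_norm M (D1 u))\<^sup>2 + (L2_norm M (D2 u))\<^sup>2 + (L2_norm M (T u))\<^sup>2"
  by (simp add: Q.N_def Qi_def L2_inner_self)

lemma Q_form_eq:
  assumes u: "u \<in> V"
  shows "Q_form m \<gamma> u = (Q.N u)\<^sup>2"
proof -
  have "Q_form m \<gamma> u = (\<integral>x. (cmod (D1 u x))\<^sup>2 + (cmod (D2 u x))\<^sup>2 + (cmod (T u x))\<^sup>2 \<partial>M)"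
    by (simp add: Q_form_def T_def)
  also have "\<dots> = (Q.N u)\<^sup>2"
    unfolding QN_sq L2_norm_sq using L2_spaceD(2)[OF D_L2(2)[OF u]] L2_spaceD(2)[OF D_L2(3)[OF u]] L2_spaceD(2)[OF T_L2[OF u]]
    by simp
  finally show ?thesis .
qed

lemma polar_Q: "u \<in> V \<Longrightarrow> v \<in> V \<Longrightarrow> polar_form (Q_form m \<gamma>) u v = Qi u v"
  by (rule Q.polar_form_eq[OF Q_form_eq])

text \<open>With x and y the norms of \<open>D1 u\<close> and \<open>D2 u\<close>, the constant
  comes from (b + \<Gamma> R (x + y))^2 <= 2 b^2 + 4 \<Gamma>^2 R^2 (x^2 + y^2); the summand 2 also
  leaves room for x^2 + y^2 themselves.\<close>

definition K1 :: real where "K1 = 2 + 4 * \<Gamma>\<^sup>2 * R\<^sup>2"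

lemma K1: "K1 > 0"
  by (simp add: K1_def add_pos_nonneg)

lemma K1_ge_1: "K1 \<ge> 1"
  by (simp add: K1_def)

text \<open>\<open>T u\<close> and \<open>D3 u\<close> differ by the twist term, whose norm is
  controlled by the transversal derivatives. The lemma is symmetric in these two roles and gives
  both comparisons, with a and b their norms in either order.\<close>

lemma norm_exchange:
  assumes u: "u \<in> V" and a: "a \<le> b + \<Gamma> * L2_norm M (D\<tau> u)" "a \<ge> 0"
  shows "a\<^sup>2 + (L2_norm M (D1 u))\<^sup>2 + (L2_norm M (D2 u))\<^sup>2 \<le> K1 * (b\<^sup>2 + (L2_norm M (D1 u))\<^sup>2 + (L2_norm M (D2 u))\<^sup>2)"
proof -
  define x y where "x = L2_norm M (D1 u)" and "y = L2_norm M (D2 u)"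
  have sq: "(p + q)\<^sup>2 \<le> 2 * p\<^sup>2 + 2 * q\<^sup>2" for p q :: real
    using sum_squares_bound[of p q] by (simp add: power2_sum)
  have "\<Gamma> * L2_norm M (D\<tau> u) \<le> \<Gamma> * (R * (x + y))"
    unfolding x_def y_def by (intro mult_left_mono dtau_L2 u \<Gamma>0)
  then have "a \<le> b + \<Gamma> * R * (x + y)" using a(1) by (simp add: mult.assoc)
  then have "a\<^sup>2 \<le> (b + \<Gamma> * R * (x + y))\<^sup>2" using a(2) by (intro power_mono)
  also have "\<dots> \<le> 2 * b\<^sup>2 + 2 * (\<Gamma> * R * (x + y))\<^sup>2" by (rule sq)
  also have "(\<Gamma> * R * (x + y))\<^sup>2 = \<Gamma>\<^sup>2 * R\<^sup>2 * (x + y)\<^sup>2" by (simp add: power_mult_distrib)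
  also have "\<Gamma>\<^sup>2 * R\<^sup>2 * (x + y)\<^sup>2 \<le> \<Gamma>\<^sup>2 * R\<^sup>2 * (2 * x\<^sup>2 + 2 * y\<^sup>2)" by (intro mult_left_mono sq) simp
  finally have "a\<^sup>2 \<le> 2 * b\<^sup>2 + 2 * (\<Gamma>\<^sup>2 * R\<^sup>2 * (2 * x\<^sup>2 + 2 * y\<^sup>2))" by simp
  moreover have "K1 * (b\<^sup>2 + x\<^sup>2 + y\<^sup>2) = 2 * b\<^sup>2 + 2 * (\<Gamma>\<^sup>2 * R\<^sup>2 * (2 * x\<^sup>2 + 2 * y\<^sup>2)) + 4 * \<Gamma>\<^sup>2 * R\<^sup>2 * b\<^sup>2 + 2 * x\<^sup>2 + 2 * y\<^sup>2"
    by (simp add: K1_def algebra_simps)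
  moreover have "0 \<le> 4 * \<Gamma>\<^sup>2 * R\<^sup>2 * b\<^sup>2" "0 \<le> x\<^sup>2" "0 \<le> y\<^sup>2" by simp_all
  ultimately show ?thesis unfolding x_def[symmetric] y_def[symmetric] by linarith
qed

lemma T_norm_le: "u \<in> V \<Longrightarrow> L2_norm M (T u) \<le> L2_norm M (D3 u) + \<Gamma> * L2_norm M (D\<tau> u)"
  using L2.triangle_add[OF \<gamma>_mult(1)[OF dtau_L2(1)] D_L2(4), of u u] \<gamma>_mult(2)[OF dtau_L2(1), of u]
  unfolding T_def[abs_def] by simp

lemma D3_norm_le: "u \<in> V \<Longrightarrow> L2_norm M (D3 u) \<le> L2_norm M (T u) + \<Gamma> * L2_norm M (D\<tau> u)"
proof -
  assume u: "u \<in> V"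
  have "D3 u = (\<lambda>p. T u p - complex_of_real (\<gamma> (snd p)) * D\<tau> u p)" by (auto simp: T_def)
  then show ?thesis
    using L2.triangle_diff[OF T_L2[OF u] \<gamma>_mult(1)[OF dtau_L2(1)[OF u]]] \<gamma>_mult(2)[OF dtau_L2(1)[OF u]] by simp
qed

lemma Q_le_H1:
  assumes u: "u \<in> V"
  shows "(Q.N u)\<^sup>2 \<le> K1 * (H1_norm (tube m) u)\<^sup>2"
proof -
  have "(Q.N u)\<^sup>2 \<le> K1 * ((L2_norm M (D3 u))\<^sup>2 + (L2_norm M (D1 u))\<^sup>2 + (L2_norm M (D2 u))\<^sup>2)"
    using norm_exchange[OF u T_norm_le[OF u]] by (simp add: QN_sq)
  also have "\<dots> \<le> K1 * (H1_norm (tube m) u)\<^sup>2"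
    using K1 by (intro mult_left_mono) (simp_all add: H1_norm_sq_tube)
  finally show ?thesis .
qed

lemma H1_le_Q:
  assumes u: "u \<in> V"
  shows "(H1_norm (tube m) u)\<^sup>2 \<le> K1 * ((Q.N u)\<^sup>2 + (L2_norm M u)\<^sup>2)"
proof -
  have "(L2_norm M (D3 u))\<^sup>2 + (L2_norm M (D1 u))\<^sup>2 + (L2_norm M (D2 u))\<^sup>2 \<le> K1 * (Q.N u)\<^sup>2"
    using norm_exchange[OF u D3_norm_le[OF u]] by (simp add: QN_sq add_ac)
  moreover have "(L2_norm M u)\<^sup>2 \<le> K1 * (L2_norm M u)\<^sup>2"
    using mult_right_mono[OF K1_ge_1, of "(L2_norm M u)\<^sup>2"] by simp
  ultimately show ?thesis unfolding H1_norm_sq_tube distrib_left by linarith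
qed

lemma QN_le_H1: "u \<in> V \<Longrightarrow> Q.N u \<le> sqrt K1 * H1_norm (tube m) u"
  by (rule power2_le_imp_le) (use Q_le_H1[of u] K1 in \<open>simp_all add: power_mult_distrib\<close>)

section \<open>The complement of the half line belongs to the resolvent set\<close>

lemma Q_ge_mu1: "u \<in> V \<Longrightarrow> mu1 m * (L2_norm M u)\<^sup>2 \<le> (Q.N u)\<^sup>2"
  using tube_Poincare[OF m, of u] zero_le_power2[of "L2_norm M (T u)"]
  unfolding sum_Basis_real2 QN_sq tube_d1_def tube_d2_def by linarith

lemma mu1_nonneg: "mu1 m \<ge> 0"
  by (rule mu1_eigenfunction[OF m])

text \<open>Rotating \<open>[\<mu>, \<infinity>) - z\<close> into a right half plane makes \<open>H - z\<close> coercive; \<open>q\<close> and \<open>n\<close> stand for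
  the values of the form and of the squared norm.\<close>

lemma coercive_rotation:
  fixes z :: complex and \<mu> :: real
  assumes \<mu>: "\<mu> \<ge> 0" and z: "z \<notin> complex_of_real ` {\<mu>..}"
  obtains \<theta> :: complex and k :: real where "k > 0"
    "\<And>q n. n \<ge> 0 \<Longrightarrow> \<mu> * n \<le> q \<Longrightarrow> k * (q + n) \<le> Re \<theta> * q - n * Re (\<theta> * z)"
proof (cases "Im z = 0")
  case False
  define a b where "a = Re z" and "b = Im z"
  have b: "\<bar>b\<bar> > 0" using False by (simp add: b_def)
  \<comment> \<open>With \<theta> = \<alpha> + i sgn b the expression to be bounded is \<alpha> q +
    n (|b| - \<alpha> a). This \<alpha> keeps \<alpha> |a| below |b| / 2, so at least half of the
    imaginary part remains.\<close>
  define \<alpha> where "\<alpha> = \<bar>b\<bar> / (2 * (\<bar>a\<bar> + 1))"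
  have \<alpha>: "\<alpha> > 0" using b by (simp add: \<alpha>_def)
  have "\<alpha> * \<bar>a\<bar> \<le> \<alpha> * (\<bar>a\<bar> + 1)" using \<alpha> by simp
  also have "\<dots> = \<bar>b\<bar> / 2"
  proof -
    have "\<bar>b\<bar> / (2 * X) * X = \<bar>b\<bar> / 2" if "X > 0" for X :: real using that by simp
    from this[of "\<bar>a\<bar> + 1"] show ?thesis unfolding \<alpha>_def by linarith
  qed
  finally have "\<alpha> * \<bar>a\<bar> \<le> \<bar>b\<bar> / 2" .
  moreover have "\<alpha> * a \<le> \<alpha> * \<bar>a\<bar>" using \<alpha> by (intro mult_left_mono) auto
  ultimately have \<alpha>a: "\<alpha> * a \<le> \<bar>b\<bar> / 2" by linarith
  show ?thesis
  proof (rule that[of "min \<alpha> (\<bar>b\<bar> / 2)" "Complex \<alpha> (sgn b)"])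
    show "min \<alpha> (\<bar>b\<bar> / 2) > 0" using \<alpha> b by simp
    fix q n :: real assume n: "n \<ge> 0" and q: "\<mu> * n \<le> q"
    have q0: "q \<ge> 0" using q mult_nonneg_nonneg[OF \<mu> n] by linarith
    have "sgn b * b = \<bar>b\<bar>" by (simp add: abs_sgn)
    then have e: "Re (Complex \<alpha> (sgn b)) * q - n * Re (Complex \<alpha> (sgn b) * z) = \<alpha> * q + n * (\<bar>b\<bar> - \<alpha> * a)"
      by (simp add: a_def b_def algebra_simps)
    have "min \<alpha> (\<bar>b\<bar> / 2) * (q + n) = min \<alpha> (\<bar>b\<bar> / 2) * q + min \<alpha> (\<bar>b\<bar> / 2) * n" by (rule distrib_left)
    also have "\<dots> \<le> \<alpha> * q + (\<bar>b\<bar> / 2) * n" using q0 n by (intro add_mono mult_right_mono) auto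
    also have "\<dots> \<le> \<alpha> * q + (\<bar>b\<bar> - \<alpha> * a) * n" using \<alpha>a n by (intro add_left_mono mult_right_mono) linarith+
    finally show "min \<alpha> (\<bar>b\<bar> / 2) * (q + n) \<le> Re (Complex \<alpha> (sgn b)) * q - n * Re (Complex \<alpha> (sgn b) * z)"
      unfolding e by (simp add: mult.commute)
  qed
next
  case True
  define a where "a = Re z"
  have za: "z = complex_of_real a" using True by (simp add: a_def complex_eq_iff)
  then have a: "a < \<mu>" using z by (auto simp: not_le[symmetric])
  \<comment> \<open>A part k of q is spent on coercivity and the rest is estimated by (1 - k) \<mu>
    n; the inequality then reduces to k (1 + \<mu>) <= \<mu> - a.\<close>
  define k where "k = min 1 ((\<mu> - a) / (1 + \<mu>))"
  have k: "k > 0" "k \<le> 1" using a \<mu> by (auto simp: k_def)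
  have "k * (1 + \<mu>) \<le> (\<mu> - a) / (1 + \<mu>) * (1 + \<mu>)" using \<mu> by (intro mult_right_mono) (auto simp: k_def)
  then have k2: "k * (1 + \<mu>) \<le> \<mu> - a" using \<mu> by simp
  show ?thesis
  proof (rule that[of k 1])
    show "k > 0" by (rule k)
    fix q n :: real assume n: "n \<ge> 0" and q: "\<mu> * n \<le> q"
    have "(1 - k) * (\<mu> * n) \<le> (1 - k) * q" using k q by (intro mult_left_mono) auto
    moreover have "k * (1 + \<mu>) * n \<le> (\<mu> - a) * n" using k2 n by (rule mult_right_mono)
    ultimately show "k * (q + n) \<le> Re 1 * q - n * Re (1 * z)"
      unfolding za by (simp add: algebra_simps)
  qed
qed

text \<open>The rotated form of H - z is coercive for the form norm, hence for the H^1 norm by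
  \<open>H1_le_Q\<close>, and Lax-Milgram gives surjectivity. Testing the equation with u itself
  gives the norm bound, and with it injectivity.\<close>

lemma resolventI:
  assumes z: "z \<notin> complex_of_real ` {mu1 m..}"
  shows "z \<in> resolvent_set M (H_op m \<gamma>)"
proof -
  obtain \<theta> :: complex and k :: real where k: "k > 0"
    and co: "\<And>q n. n \<ge> 0 \<Longrightarrow> mu1 m * n \<le> q \<Longrightarrow> k * (q + n) \<le> Re \<theta> * q - n * Re (\<theta> * z)"
    by (rule coercive_rotation[OF mu1_nonneg z]) (rule that)
  define a where "a u v = \<theta> * (Qi u v - z * L2_inner M u v)" for u v
  have auu: "k * ((Q.N u)\<^sup>2 + (L2_norm M u)\<^sup>2) \<le> Re (a u u)" if u: "u \<in> V" for u
  proof -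
    have "a u u = \<theta> * complex_of_real ((Q.N u)\<^sup>2) - \<theta> * z * complex_of_real ((L2_norm M u)\<^sup>2)"
      unfolding a_def Q.B_self[OF u] L2_inner_self by (simp add: algebra_simps)
    moreover have "Re (w * complex_of_real x) = Re w * x" for w x by simp
    ultimately have "Re (a u u) = Re \<theta> * (Q.N u)\<^sup>2 - (L2_norm M u)\<^sup>2 * Re (\<theta> * z)"
      by (simp only: minus_complex.sel mult.commute[of "(L2_norm M u)\<^sup>2"])
    then show ?thesis using co[OF _ Q_ge_mu1[OF u]] by simp
  qed
  have solve: "\<exists>u\<in>V. \<forall>v\<in>V. a u v = \<theta> * L2_inner M f v" if f: "f \<in> L2_space M" for f
  proof (rule H.Lax_Milgram)
    show "a (\<lambda>x. u x + c * v x) w = a u w + c * a v w" if "u \<in> V" "v \<in> V" "w \<in> V" for u v w c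
      unfolding a_def Q.B_lin[OF that] L.B_lin[OF that] by (simp add: algebra_simps)
    show "a w (\<lambda>x. u x + c * v x) = a w u + cnj c * a w v" if "u \<in> V" "v \<in> V" "w \<in> V" for u v w c
      unfolding a_def Q.B_lin2[OF that] L.B_lin2[OF that] by (simp add: algebra_simps)
    show "cmod (a u v) \<le> cmod \<theta> * (K1 + cmod z) * H1_norm (tube m) u * H1_norm (tube m) v"
      if uv: "u \<in> V" "v \<in> V" for u v
    proof -
      let ?u = "H1_norm (tube m) u" and ?v = "H1_norm (tube m) v"
      have "cmod (Qi u v) \<le> Q.N u * Q.N v" by (rule Q.CS[OF uv])
      also have "\<dots> \<le> (sqrt K1 * ?u) * (sqrt K1 * ?v)"
        using K1 by (intro mult_mono QN_le_H1 uv Q.N_nonneg) simp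
      also have "\<dots> = K1 * (?u * ?v)" using K1 by simp
      finally have 1: "cmod (Qi u v) \<le> K1 * (?u * ?v)" .
      have "cmod (L2_inner M u v) \<le> L2_norm M u * L2_norm M v" by (rule L.CS[OF uv])
      also have "\<dots> \<le> ?u * ?v" by (intro mult_mono D_norm_le) simp_all
      finally have 2: "cmod z * cmod (L2_inner M u v) \<le> cmod z * (?u * ?v)" by (rule mult_left_mono) simp
      have "cmod (Qi u v - z * L2_inner M u v) \<le> cmod (Qi u v) + cmod z * cmod (L2_inner M u v)"
        by (rule order_trans[OF norm_triangle_ineq4]) (simp add: norm_mult)
      also have "\<dots> \<le> (K1 + cmod z) * (?u * ?v)" using 1 2 by (simp add: distrib_right)
      finally have "cmod \<theta> * cmod (Qi u v - z * L2_inner M u v) \<le> cmod \<theta> * ((K1 + cmod z) * (?u * ?v))"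
        by (rule mult_left_mono) simp
      then show ?thesis by (simp add: a_def norm_mult mult.assoc)
    qed
    show "k / K1 * (H1_norm (tube m) u)\<^sup>2 \<le> Re (a u u)" if "u \<in> V" for u
    proof -
      have "k / K1 * (H1_norm (tube m) u)\<^sup>2 \<le> k / K1 * (K1 * ((Q.N u)\<^sup>2 + (L2_norm M u)\<^sup>2))"
        using k K1 by (intro mult_left_mono H1_le_Q that) simp
      also have "\<dots> = k * ((Q.N u)\<^sup>2 + (L2_norm M u)\<^sup>2)" using K1 by simp
      finally show ?thesis using auu[OF that] by linarith
    qed
    show "k / K1 > 0" using k K1 by simp
    show "\<theta> * L2_inner M f (\<lambda>x. u x + c * v x) = \<theta> * L2_inner M f u + cnj c * (\<theta> * L2_inner M f v)"
      if "u \<in> V" "v \<in> V" for u v c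
      unfolding L2.B_lin2[OF D_L2(1)[OF that(1)] D_L2(1)[OF that(2)] f] by (simp add: algebra_simps)
    show "cmod (\<theta> * L2_inner M f v) \<le> (cmod \<theta> * L2_norm M f) * H1_norm (tube m) v" if v: "v \<in> V" for v
    proof -
      have "cmod (L2_inner M f v) \<le> L2_norm M f * L2_norm M v" by (rule L2.CS[OF f D_L2(1)[OF v]])
      also have "\<dots> \<le> L2_norm M f * H1_norm (tube m) v" by (intro mult_left_mono D_norm_le) simp
      finally have "cmod \<theta> * cmod (L2_inner M f v) \<le> cmod \<theta> * (L2_norm M f * H1_norm (tube m) v)"
        by (rule mult_left_mono) simp
      then show ?thesis by (simp add: norm_mult mult.assoc)
    qed
  qed
  \<comment> \<open>At n = 0, q = 1 coercivity says that Re \<theta> is at least k > 0, so the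
    factor \<theta> can be cancelled in the equation.\<close>
  have \<theta>0: "\<theta> \<noteq> 0"
  proof
    assume "\<theta> = 0"
    then show False using co[of 0 1] k by simp
  qed
  have A: "\<exists>(u, g)\<in>H_op m \<gamma>. AE x in M. g x - z * u x = f x" if f: "f \<in> L2_space M" for f
  proof -
    obtain u where u: "u \<in> V" "\<forall>v\<in>V. a u v = \<theta> * L2_inner M f v" using solve[OF f] by (rule bexE)
    \<comment> \<open>If (H - z) u = f, then the value of H at u is f + z u.\<close>
    let ?g = "\<lambda>x. f x + z * u x"
    have g: "?g \<in> L2_space M" by (intro L2.lin f D_L2(1) u)
    have "polar_form (Q_form m \<gamma>) u v = L2_inner M ?g v" if v: "v \<in> V" for v
    proof -
      have "Qi u v - z * L2_inner M u v = L2_inner M f v" using bspec[OF u(2) v] \<theta>0 by (simp add: a_def)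
      then show ?thesis
        unfolding polar_Q[OF u(1) v] L2.B_lin[OF f D_L2(1)[OF u(1)] D_L2(1)[OF v]] by (simp add: algebra_simps)
    qed
    then have "(u, ?g) \<in> H_op m \<gamma>" using u g by (simp add: H_op_def form_operator_def)
    then show ?thesis by (intro bexI[of _ "(u, ?g)"]) simp_all
  qed
  have B: "L2_norm M u \<le> cmod \<theta> / k * L2_norm M (\<lambda>x. g x - z * u x)" if ug: "(u, g) \<in> H_op m \<gamma>" for u g
  proof (cases "L2_norm M u = 0")
    case True
    then show ?thesis using k by simp
  next
    case False
    then have p: "L2_norm M u > 0" using L2_norm_ge_0[of M u] by linarith
    have u: "u \<in> V" "g \<in> L2_space M" "polar_form (Q_form m \<gamma>) u u = L2_inner M g u"
      using ug by (auto simp: H_op_def form_operator_def)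
    let ?f = "\<lambda>x. g x + (- z) * u x"
    have f: "?f \<in> L2_space M" by (intro L2.lin u D_L2(1))
    have "L2_inner M ?f u = Qi u u - z * L2_inner M u u"
      unfolding L2.B_lin[OF u(2) D_L2(1)[OF u(1)] D_L2(1)[OF u(1)]] u(3)[symmetric] polar_Q[OF u(1,1)] by simp
    then have "a u u = \<theta> * L2_inner M ?f u" by (simp add: a_def)
    then have "k * ((Q.N u)\<^sup>2 + (L2_norm M u)\<^sup>2) \<le> cmod \<theta> * cmod (L2_inner M ?f u)"
      using auu[OF u(1)] complex_Re_le_cmod[of "a u u"] by (simp add: norm_mult)
    also have "\<dots> \<le> cmod \<theta> * (L2_norm M ?f * L2_norm M u)"
      by (intro mult_left_mono L2.CS f D_L2(1) u) simp
    finally have "k * ((Q.N u)\<^sup>2 + (L2_norm M u)\<^sup>2) \<le> cmod \<theta> * (L2_norm M ?f * L2_norm M u)" .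
    moreover have "k * (L2_norm M u)\<^sup>2 \<le> k * ((Q.N u)\<^sup>2 + (L2_norm M u)\<^sup>2)" using k by (intro mult_left_mono) auto
    ultimately have "(k * L2_norm M u) * L2_norm M u \<le> (cmod \<theta> * L2_norm M ?f) * L2_norm M u"
      by (simp add: power2_eq_square mult.assoc)
    then have "k * L2_norm M u \<le> cmod \<theta> * L2_norm M ?f" using p by simp
    then show ?thesis using k by (simp add: field_simps)
  qed
  show ?thesis unfolding resolvent_set_def using A B by blast
qed


section \<open>Approximate eigenfunctions and the inclusion of the half line in the spectrum\<close>

lemma support_derivative:
  fixes g :: "real \<Rightarrow> complex"
  assumes g: "g \<in> test_functions UNIV" and x: "x \<notin> closure {x. g x \<noteq> 0}"
  shows "dir_deriv 1 g x = 0"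
proof -
  \<comment> \<open>Test functions may be taken over any set; over the closed support of g itself,
    their closure under derivatives says that differentiation does not enlarge the support.\<close>
  have "g \<in> test_functions (closure {x. g x \<noteq> 0})"
    using g by (simp add: test_functions_def)
  from test_function_zero[OF test_functions_dir_deriv[OF this] x] show ?thesis by simp
qed

text \<open>The twist only enters through its restriction to the support of \<open>g\<close>, where it is small.\<close>

lemma approximate_eigenfunction:
  assumes long: "\<And>L \<epsilon>. \<epsilon> > 0 \<Longrightarrow> \<exists>j. \<forall>s. \<bar>s - j\<bar> \<le> L \<longrightarrow> \<bar>\<gamma> s\<bar> \<le> \<epsilon>"
    and \<eta>: "\<eta> > 0"
  obtains u where "u \<in> V" "L2_norm M u > 0"
    "\<And>v. v \<in> V \<Longrightarrow> cmod (Qi u v - complex_of_real (mu1 m + k\<^sup>2) * L2_inner M u v) \<le> \<eta> * L2_norm M u * H1_norm (tube m) v"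
proof -
  obtain \<psi> where \<psi>: "\<psi> \<in> H10_space m" "L2_norm (leb_on m) \<psi> = 1"
    "\<And>v. v \<in> H10_space m \<Longrightarrow> grad_inner m \<psi> v = complex_of_real (mu1 m) * L2_inner (leb_on m) \<psi> v"
    by (rule mu1_eigenfunction[OF m]) (rule that)
  note \<psi>H = H10_spaceD[OF \<psi>(1)]
  have ax: "axis 1 1 \<in> (Basis :: (real^2) set)" "axis 2 1 \<in> (Basis :: (real^2) set)"
    by (simp_all add: Basis_real2)
  define \<psi>1 \<psi>2 where "\<psi>1 = weak_deriv m (axis 1 1) \<psi>" and "\<psi>2 = weak_deriv m (axis 2 1) \<psi>"
  have \<psi>L: "\<psi> \<in> L2_space (leb_on m)" "\<psi>1 \<in> L2_space (leb_on m)" "\<psi>2 \<in> L2_space (leb_on m)"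
    unfolding \<psi>1_def \<psi>2_def by (rule H1_spaceD(1)[OF \<psi>H] H1_spaceD(3)[OF \<psi>H ax(1)] H1_spaceD(3)[OF \<psi>H ax(2)])+
  define G1 where "G1 = L2_norm (leb_on m) \<psi>1 + L2_norm (leb_on m) \<psi>2"
  have \<eta>2: "\<eta> / 2 > 0" using \<eta> by simp
  obtain g0 :: "real \<Rightarrow> complex" where g0: "g0 \<in> test_functions UNIV" "L2_norm lborel g0 > 0"
    "L2_norm lborel (\<lambda>s. dir_deriv 1 (dir_deriv 1 g0) s + complex_of_real (k\<^sup>2) * g0 s) \<le> \<eta> / 2 * L2_norm lborel g0"
    by (rule quasimode[OF \<eta>2, of k]) (rule that)
  have b1: "(1::real) \<in> Basis" by simp
  define N0 N1 where "N0 = L2_norm lborel g0" and "N1 = L2_norm lborel (dir_deriv 1 g0)"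
  define K2 where "K2 = 1 + 2 * \<Gamma> * R"
  \<comment> \<open>\<open>W\<close> gathers the factors that multiply \<epsilon> in the final
    estimate: \<open>K2\<close> bounds T v and 2 R bounds the angular derivative of v, both relative
    to the H^1 norm of v. The choice of \<epsilon> spends half of \<eta> on the twist; the other
    half goes to the longitudinal quasi-mode.\<close>
  define W where "W = R * (N0 * G1) * K2 + N1 * (2 * R)"
  have W: "W \<ge> 0" using R0 \<Gamma>0 by (simp add: W_def K2_def N0_def N1_def G1_def)
  define \<epsilon> where "\<epsilon> = \<eta> / 2 * N0 / (W + 1)"
  have \<epsilon>: "\<epsilon> > 0" using \<eta> g0(2) W by (simp add: \<epsilon>_def N0_def)
  have "\<epsilon> * W \<le> \<epsilon> * (W + 1)" using \<epsilon> by simp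
  also have "\<dots> = \<eta> / 2 * N0"
    using W unfolding \<epsilon>_def by (intro nonzero_eq_divide_eq[THEN iffD1, OF _ refl]) linarith
  finally have \<epsilon>W: "\<epsilon> * W \<le> \<eta> / 2 * N0" .
  obtain L where L: "\<And>s. s \<in> closure {x. g0 x \<noteq> 0} \<Longrightarrow> \<bar>s\<bar> \<le> L"
    using compact_imp_bounded[OF test_functionsD(2)[OF g0(1)]] by (auto simp: bounded_iff)
  obtain j where j: "\<And>s. \<bar>s - j\<bar> \<le> L \<Longrightarrow> \<bar>\<gamma> s\<bar> \<le> \<epsilon>" using long[OF \<epsilon>, of L] by blast
  define g where "g = (\<lambda>s. g0 (1 * s + - j))"
  have one: "(1::real) \<noteq> 0" by simp
  note dg0 = test_functions_dir_deriv[OF g0(1) b1]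
  have g: "g \<in> test_functions UNIV" unfolding g_def by (rule test_functions_affine_line(1)[OF g0(1) one])
  have dg: "dir_deriv 1 g = (\<lambda>s. dir_deriv 1 g0 (1 * s + - j))"
    unfolding g_def test_functions_affine_line(2)[OF g0(1) one] by simp
  have ddg: "dir_deriv 1 (dir_deriv 1 g) = (\<lambda>s. dir_deriv 1 (dir_deriv 1 g0) (1 * s + - j))"
    unfolding dg test_functions_affine_line(2)[OF dg0 one] by simp
  have shift: "L2_norm lborel (\<lambda>s. f (1 * s + - j)) = L2_norm lborel f" for f :: "real \<Rightarrow> complex"
    using L2_norm_lborel_affine[of 1 f "- j"] by simp
  have gN: "L2_norm lborel g = N0" "L2_norm lborel (dir_deriv 1 g) = N1"
    unfolding N0_def N1_def dg unfolding g_def by (rule shift)+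
  define r where "r = (\<lambda>s. dir_deriv 1 (dir_deriv 1 g) s + complex_of_real (k\<^sup>2) * g s)"
  have rN: "L2_norm lborel r \<le> \<eta> / 2 * N0"
    using g0(3) shift[of "\<lambda>s. dir_deriv 1 (dir_deriv 1 g0) s + complex_of_real (k\<^sup>2) * g0 s"]
    unfolding r_def ddg N0_def by (simp add: g_def)
  have far: "g s = 0" "dir_deriv 1 g s = 0" if "\<bar>s - j\<bar> > L" for s
  proof -
    have "1 * s + - j \<notin> closure {x. g0 x \<noteq> 0}" using L[of "1 * s + - j"] that by auto
    then show "g s = 0" "dir_deriv 1 g s = 0"
      unfolding dg unfolding g_def by (rule zero_outside_closure, rule support_derivative[OF g0(1)])
  qed
  have gt: "dir_deriv 1 g \<in> test_functions UNIV" "dir_deriv 1 (dir_deriv 1 g) \<in> test_functions UNIV"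
    by (rule test_functions_dir_deriv[OF g b1] test_functions_dir_deriv[OF test_functions_dir_deriv[OF g b1] b1])+
  note gL = test_functions_L2_lborel[OF g] test_functions_L2_lborel[OF gt(1)] test_functions_L2_lborel[OF gt(2)]
  have rL: "r \<in> L2_space lborel" unfolding r_def by (rule L2.lin[OF gL(3,1)])
  \<comment> \<open>The twist cut off to the window around j: bounded by \<epsilon> everywhere and
    equal to \<gamma> on the support of g, so it may replace \<gamma> in all terms that contain
    u.\<close>
  define h where "h s = \<gamma> s * indicator {j - L..j + L} s" for s
  have hm: "h \<in> borel_measurable borel" unfolding h_def using \<gamma>_meas by measurable
  have hb: "\<bar>h s\<bar> \<le> \<epsilon>" for s
  proof (cases "s \<in> {j - L..j + L}")
    case True
    then have "\<bar>s - j\<bar> \<le> L" by auto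
    then show ?thesis using j[of s] True by (simp add: h_def)
  qed (use \<epsilon> in \<open>simp add: h_def\<close>)
  have h\<gamma>: "\<gamma> s = h s" if "\<bar>s - j\<bar> \<le> L" for s
    using that by (auto simp: h_def indicator_def abs_le_iff)
  define u where "u = tensor \<psi> g"
  note tH = tensor_H10[OF m(1) \<psi>(1) g]
  have u: "u \<in> V" unfolding u_def by (rule tH(1))
  have uN: "L2_norm M u = N0" unfolding u_def tensor_L2(2)[OF m(1) \<psi>L(1) gL(1)] by (simp add: \<psi>(2) gN)
  have a1: "AE p in M. D1 u p = tensor \<psi>1 g p" and a2: "AE p in M. D2 u p = tensor \<psi>2 g p"
    and a3: "AE p in M. D3 u p = tensor \<psi> (dir_deriv 1 g) p"
    unfolding u_def \<psi>1_def \<psi>2_def tube_d1_def tube_d2_def tube_d3_def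
    by (rule weak_deriv_AE[OF ot ax_Basis(1) tH(2)[OF ax(1)]] weak_deriv_AE[OF ot ax_Basis(2) tH(2)[OF ax(2)]]
        weak_deriv_AE[OF ot tube_Basis(2) tH(3)])+
  note tL = tensor_L2(1)[OF m(1) \<psi>L(2) gL(1)] tensor_L2(1)[OF m(1) \<psi>L(3) gL(1)] tensor_L2(1)[OF m(1) \<psi>L(1) gL(2)]
    tensor_L2(1)[OF m(1) \<psi>L(1) gL(3)] tensor_L2(1)[OF m(1) \<psi>L(1) gL(1)] tensor_L2(1)[OF m(1) \<psi>L(1) rL]
  have nD: "L2_norm M (D1 u) = L2_norm (leb_on m) \<psi>1 * N0" "L2_norm M (D2 u) = L2_norm (leb_on m) \<psi>2 * N0"
    "L2_norm M (D3 u) = N1"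
  proof -
    show "L2_norm M (D1 u) = L2_norm (leb_on m) \<psi>1 * N0"
      using L2_norm_cong_AE[OF L2_spaceD(1)[OF D_L2(2)[OF u]] L2_spaceD(1)[OF tL(1)] a1]
      by (simp add: tensor_L2(2)[OF m(1) \<psi>L(2) gL(1)] gN)
    show "L2_norm M (D2 u) = L2_norm (leb_on m) \<psi>2 * N0"
      using L2_norm_cong_AE[OF L2_spaceD(1)[OF D_L2(3)[OF u]] L2_spaceD(1)[OF tL(2)] a2]
      by (simp add: tensor_L2(2)[OF m(1) \<psi>L(3) gL(1)] gN)
    show "L2_norm M (D3 u) = N1"
      using L2_norm_cong_AE[OF L2_spaceD(1)[OF D_L2(4)[OF u]] L2_spaceD(1)[OF tL(3)] a3]
      by (simp add: tensor_L2(2)[OF m(1) \<psi>L(1) gL(2)] gN \<psi>(2))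
  qed
  define A where "A = (\<lambda>p. complex_of_real (h (snd p)) * D\<tau> u p)"
  define B where "B = (\<lambda>p. complex_of_real (h (snd p)) * D3 u p)"
  have AL: "A \<in> L2_space M" "L2_norm M A \<le> \<epsilon> * L2_norm M (D\<tau> u)"
    unfolding A_def by (rule height_mult[OF dtau_L2(1)[OF u] hm hb])+
  have BL: "B \<in> L2_space M" "L2_norm M B \<le> \<epsilon> * N1"
    unfolding B_def nD(3)[symmetric] by (rule height_mult[OF D_L2(4)[OF u] hm hb])+
  have AN: "L2_norm M A \<le> \<epsilon> * (R * (N0 * G1))"
  proof -
    have "L2_norm M (D\<tau> u) \<le> R * (N0 * G1)"
      using dtau_L2(2)[OF u] unfolding nD by (simp add: G1_def algebra_simps)
    then show ?thesis using AL(2) \<epsilon> by (meson less_imp_le mult_left_mono order_trans)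
  qed
  have Tu: "AE p in M. T u p = A p + 1 * D3 u p"
    using a1 a2
  proof eventually_elim
    case (elim p)
    show ?case
    proof (cases "\<bar>snd p - j\<bar> \<le> L")
      case True
      then show ?thesis by (simp add: T_def A_def h\<gamma>)
    next
      case False
      then have "D\<tau> u p = 0" using elim far(1)[of "snd p"] by (simp add: tube_dtau_def tensor_def)
      then show ?thesis by (simp add: T_def A_def)
    qed
  qed
  have \<gamma>B: "AE p in M. complex_of_real (\<gamma> (snd p)) * D3 u p = B p"
    using a3
  proof eventually_elim
    case (elim p)
    show ?case
    proof (cases "\<bar>snd p - j\<bar> \<le> L")
      case True
      then show ?thesis by (simp add: B_def h\<gamma>)
    next
      case False
      then have "D3 u p = 0" using elim far(2)[of "snd p"] by (simp add: tensor_def)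
      then show ?thesis by (simp add: B_def)
    qed
  qed
  have main: "cmod (Qi u v - complex_of_real (mu1 m + k\<^sup>2) * L2_inner M u v) \<le> \<eta> * L2_norm M u * H1_norm (tube m) v"
    if v: "v \<in> V" for v
  proof -
    let ?H = "H1_norm (tube m) v"
    note vL = D_L2[OF v] and TvL = T_L2[OF v] and \<tau>L = dtau_L2(1)[OF v]
    have sm: "f \<in> borel_measurable M" if "f \<in> L2_space M" for f using L2_spaceD(1)[OF that] .
    have e1: "L2_inner M (D1 u) (D1 v) + L2_inner M (D2 u) (D2 v) = complex_of_real (mu1 m) * L2_inner M u v"
    proof -
      have "L2_inner M (D1 u) (D1 v) = L2_inner M (tensor \<psi>1 g) (D1 v)"
        by (rule L2_inner_cong_AE[OF sm[OF D_L2(2)[OF u]] sm[OF tL(1)] a1 sm[OF vL(2)] sm[OF vL(2)]]) simp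
      moreover have "L2_inner M (D2 u) (D2 v) = L2_inner M (tensor \<psi>2 g) (D2 v)"
        by (rule L2_inner_cong_AE[OF sm[OF D_L2(3)[OF u]] sm[OF tL(2)] a2 sm[OF vL(3)] sm[OF vL(3)]]) simp
      ultimately show ?thesis
        using tube_eigenfunction[OF m(1) \<psi>(1) \<psi>(3) gL(1) v]
        unfolding sum_Basis_real2 u_def \<psi>1_def \<psi>2_def tube_d1_def tube_d2_def by simp
    qed
    have e2: "L2_inner M (T u) (T v) = L2_inner M A (T v) + L2_inner M (D3 u) (T v)"
    proof -
      have "L2_inner M (T u) (T v) = L2_inner M (\<lambda>p. A p + 1 * D3 u p) (T v)"
        by (rule L2_inner_cong_AE[OF sm[OF T_L2[OF u]] sm[OF L2.lin[OF AL(1) D_L2(4)[OF u]]] Tu sm[OF TvL] sm[OF TvL]]) simp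
      also have "\<dots> = L2_inner M A (T v) + 1 * L2_inner M (D3 u) (T v)"
        by (rule L2.B_lin[OF AL(1) D_L2(4)[OF u] TvL])
      finally show ?thesis by simp
    qed
    \<comment> \<open>The real factor \<gamma> is moved from the derivative of v, where it need not
      be small, to that of u, which is supported in the window. No derivative falls on
      \<gamma>.\<close>
    have e3: "L2_inner M (D3 u) (T v) = L2_inner M (D3 u) (D3 v) + L2_inner M B (D\<tau> v)"
    proof -
      have "T v = (\<lambda>p. D3 v p + 1 * (complex_of_real (\<gamma> (snd p)) * D\<tau> v p))" by (auto simp: T_def)
      then have "L2_inner M (D3 u) (T v) = L2_inner M (D3 u) (D3 v) + cnj 1 * L2_inner M (D3 u) (\<lambda>p. complex_of_real (\<gamma> (snd p)) * D\<tau> v p)"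
        using L2.B_lin2[OF vL(4) \<gamma>_mult(1)[OF \<tau>L] D_L2(4)[OF u], of 1] by simp
      moreover have "L2_inner M (D3 u) (\<lambda>p. complex_of_real (\<gamma> (snd p)) * D\<tau> v p) = L2_inner M (\<lambda>p. complex_of_real (\<gamma> (snd p)) * D3 u p) (D\<tau> v)"
        unfolding L2_inner_def by (intro Bochner_Integration.integral_cong) simp_all
      moreover have "\<dots> = L2_inner M B (D\<tau> v)"
        by (rule L2_inner_cong_AE[OF sm[OF \<gamma>_mult(1)[OF D_L2(4)[OF u]]] sm[OF BL(1)] \<gamma>B sm[OF \<tau>L] sm[OF \<tau>L]]) simp
      ultimately show ?thesis by simp
    qed
    \<comment> \<open>The longitudinal derivative of v is integrated onto g' alone, which yields g''
      and, with the k^2 term, the error r of the quasi-mode.\<close>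
    have e4: "L2_inner M (D3 u) (D3 v) = - L2_inner M (tensor \<psi> (dir_deriv 1 (dir_deriv 1 g))) v"
    proof -
      have "L2_inner M (D3 u) (D3 v) = L2_inner M (tensor \<psi> (dir_deriv 1 g)) (D3 v)"
        by (rule L2_inner_cong_AE[OF sm[OF D_L2(4)[OF u]] sm[OF tL(3)] a3 sm[OF vL(4)] sm[OF vL(4)]]) simp
      also have "\<dots> = - L2_inner M (tensor \<psi> (dir_deriv 1 (dir_deriv 1 g))) v"
        unfolding tube_d3_def by (rule weak_deriv_by_parts[OF ot tube_Basis(2) tensor_H10(3)[OF m(1) \<psi>(1) gt(1)] v])
      finally show ?thesis .
    qed
    have e5: "L2_inner M (tensor \<psi> r) v = L2_inner M (tensor \<psi> (dir_deriv 1 (dir_deriv 1 g))) v + complex_of_real (k\<^sup>2) * L2_inner M u v"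
    proof -
      have "tensor \<psi> r = (\<lambda>p. tensor \<psi> (dir_deriv 1 (dir_deriv 1 g)) p + complex_of_real (k\<^sup>2) * tensor \<psi> g p)"
        by (auto simp: tensor_def r_def algebra_simps)
      then show ?thesis unfolding u_def using L2.B_lin[OF tL(4,5) vL(1)] by simp
    qed
    have "Qi u v - complex_of_real (mu1 m + k\<^sup>2) * L2_inner M u v
      = L2_inner M A (T v) + L2_inner M B (D\<tau> v) - L2_inner M (tensor \<psi> r) v"
      unfolding Qi_def e1 e2 e3 e4 e5 by (simp add: algebra_simps)
    also have "cmod \<dots> \<le> cmod (L2_inner M A (T v)) + cmod (L2_inner M B (D\<tau> v)) + cmod (L2_inner M (tensor \<psi> r) v)"
      by (rule order_trans[OF norm_triangle_ineq4]) (intro add_mono norm_triangle_ineq order_refl)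
    also have "\<dots> \<le> \<epsilon> * (R * (N0 * G1)) * (K2 * ?H) + \<epsilon> * N1 * (2 * R * ?H) + \<eta> / 2 * N0 * ?H"
    proof (intro add_mono)
      have d\<tau>: "L2_norm M (D\<tau> v) \<le> 2 * R * ?H"
      proof -
        have "R * (L2_norm M (D1 v) + L2_norm M (D2 v)) \<le> R * (?H + ?H)"
          by (intro mult_left_mono add_mono D_norm_le R0)
        then show ?thesis using dtau_L2(2)[OF v] by simp
      qed
      have "\<Gamma> * L2_norm M (D\<tau> v) \<le> \<Gamma> * (2 * R * ?H)" by (intro mult_left_mono d\<tau> \<Gamma>0)
      then have Tn: "L2_norm M (T v) \<le> K2 * ?H"
        using T_norm_le[OF v] D_norm_le(4)[of v] by (simp add: K2_def algebra_simps)
      have "cmod (L2_inner M A (T v)) \<le> L2_norm M A * L2_norm M (T v)" by (rule L2.CS[OF AL(1) TvL])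
      also have "\<dots> \<le> \<epsilon> * (R * (N0 * G1)) * (K2 * ?H)"
        using AN order_trans[OF L2_norm_ge_0 AN] by (intro mult_mono Tn) simp_all
      finally show "cmod (L2_inner M A (T v)) \<le> \<epsilon> * (R * (N0 * G1)) * (K2 * ?H)" .
      have "cmod (L2_inner M B (D\<tau> v)) \<le> L2_norm M B * L2_norm M (D\<tau> v)" by (rule L2.CS[OF BL(1) \<tau>L])
      also have "\<dots> \<le> \<epsilon> * N1 * (2 * R * ?H)"
        using BL(2) order_trans[OF L2_norm_ge_0 BL(2)] by (intro mult_mono d\<tau>) simp_all
      finally show "cmod (L2_inner M B (D\<tau> v)) \<le> \<epsilon> * N1 * (2 * R * ?H)" .
      have "cmod (L2_inner M (tensor \<psi> r) v) \<le> L2_norm M (tensor \<psi> r) * L2_norm M v" by (rule L2.CS[OF tL(6) vL(1)])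
      also have "\<dots> \<le> \<eta> / 2 * N0 * ?H"
      proof (intro mult_mono D_norm_le)
        show "L2_norm M (tensor \<psi> r) \<le> \<eta> / 2 * N0"
          unfolding tensor_L2(2)[OF m(1) \<psi>L(1) rL] \<psi>(2) using rN by simp
        show "0 \<le> \<eta> / 2 * N0" using \<eta> by (simp add: N0_def)
      qed simp
      finally show "cmod (L2_inner M (tensor \<psi> r) v) \<le> \<eta> / 2 * N0 * ?H" .
    qed
    also have "\<dots> = (\<epsilon> * W + \<eta> / 2 * N0) * ?H" by (simp add: W_def algebra_simps)
    also have "\<dots> \<le> (\<eta> / 2 * N0 + \<eta> / 2 * N0) * ?H" by (intro mult_right_mono add_right_mono \<epsilon>W) simp
    also have "\<dots> = \<eta> * L2_norm M u * ?H" by (simp add: uN)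
    finally show ?thesis .
  qed
  have "L2_norm M u > 0" using g0(2) by (simp add: uN N0_def)
  from that[OF u this main] show ?thesis .
qed

text \<open>If t were in the resolvent set, some v would satisfy (H - t) v = u for the approximate
  eigenfunction u, with the H^1 norm of v bounded by \<open>C'\<close> times the norm of u. Testing
  the approximate equation of u with this v gives the squared norm of u on one side and at most
  \<eta> \<open>C'\<close> times it on the other.\<close>

lemma spectrumI:
  assumes long: "\<And>L \<epsilon>. \<epsilon> > 0 \<Longrightarrow> \<exists>j. \<forall>s. \<bar>s - j\<bar> \<le> L \<longrightarrow> \<bar>\<gamma> s\<bar> \<le> \<epsilon>"
    and t: "t \<ge> mu1 m"
  shows "complex_of_real t \<notin> resolvent_set M (H_op m \<gamma>)"
proof
  assume "complex_of_real t \<in> resolvent_set M (H_op m \<gamma>)"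
  then obtain C where surj: "\<And>f. f \<in> L2_space M \<Longrightarrow> \<exists>(v, h)\<in>H_op m \<gamma>. AE x in M. h x - complex_of_real t * v x = f x"
    and C: "\<And>v h. (v, h) \<in> H_op m \<gamma> \<Longrightarrow> L2_norm M v \<le> C * L2_norm M (\<lambda>x. h x - complex_of_real t * v x)"
    unfolding resolvent_set_def by blast
  \<comment> \<open>From Q(v, v) = (u, v) + t (v, v) and the resolvent bound on v, converted to the
    H^1 norm by \<open>H1_le_Q\<close>. It does not depend on u, so \<eta> can be fixed before u is
    chosen.\<close>
  define C' where "C' = sqrt (K1 * (\<bar>C\<bar> + (\<bar>t\<bar> + 1) * C\<^sup>2))"
  have C'0: "C' \<ge> 0" using K1 by (simp add: C'_def)
  define \<eta> where "\<eta> = 1 / (2 * (C' + 1))"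
  have \<eta>: "\<eta> > 0" using C'0 by (simp add: \<eta>_def)
  define k where "k = sqrt (t - mu1 m)"
  have k: "mu1 m + k\<^sup>2 = t" using t by (simp add: k_def)
  obtain u where u: "u \<in> V" "L2_norm M u > 0"
    "\<And>v. v \<in> V \<Longrightarrow> cmod (Qi u v - complex_of_real (mu1 m + k\<^sup>2) * L2_inner M u v) \<le> \<eta> * L2_norm M u * H1_norm (tube m) v"
    by (rule approximate_eigenfunction[OF long \<eta>, of k]) (assumption, rule that)
  let ?n = "L2_norm M u"
  obtain v h where vh: "(v, h) \<in> H_op m \<gamma>" "AE x in M. h x - complex_of_real t * v x = u x"
    using surj[OF D_L2(1)[OF u(1)]] by blast
  have v: "v \<in> V" and h: "h \<in> L2_space M" and Qv: "\<And>w. w \<in> V \<Longrightarrow> Qi v w = L2_inner M h w"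
    using vh(1) polar_Q[of v] by (auto simp: H_op_def form_operator_def)
  note vL = D_L2(1)[OF v] and uL = D_L2(1)[OF u(1)]
  have dL: "(\<lambda>x. h x - complex_of_real t * v x) \<in> L2_space M"
    by (rule L2.diff[OF h L2.scale[OF vL]])
  have inner: "L2_inner M h w - complex_of_real t * L2_inner M v w = L2_inner M u w" if w: "w \<in> L2_space M" for w
  proof -
    have "L2_inner M (\<lambda>x. h x - complex_of_real t * v x) w = L2_inner M u w"
      by (rule L2_inner_cong_AE[OF L2_spaceD(1)[OF dL] L2_spaceD(1)[OF uL] vh(2) L2_spaceD(1)[OF w] L2_spaceD(1)[OF w]]) simp
    moreover have "L2_inner M (\<lambda>x. h x - complex_of_real t * v x) w = L2_inner M h w - complex_of_real t * L2_inner M v w"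
      using L2.B_lin[OF h vL w, of "- complex_of_real t"] by simp
    ultimately show ?thesis by simp
  qed
  have vn: "L2_norm M v \<le> \<bar>C\<bar> * ?n"
  proof -
    have "L2_norm M v \<le> C * L2_norm M (\<lambda>x. h x - complex_of_real t * v x)" by (rule C[OF vh(1)])
    also have "L2_norm M (\<lambda>x. h x - complex_of_real t * v x) = ?n"
      by (rule L2_norm_cong_AE[OF L2_spaceD(1)[OF dL] L2_spaceD(1)[OF uL] vh(2)])
    also have "C * ?n \<le> \<bar>C\<bar> * ?n" by (intro mult_right_mono) auto
    finally show ?thesis .
  qed
  have H: "H1_norm (tube m) v \<le> C' * ?n"
  proof (rule power2_le_imp_le)
    have "complex_of_real ((Q.N v)\<^sup>2) = L2_inner M u v + complex_of_real t * complex_of_real ((L2_norm M v)\<^sup>2)"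
      using inner[OF vL] unfolding Q.B_self[OF v, symmetric] Qv[OF v] L2_inner_self[symmetric] by (simp add: algebra_simps)
    then have "(Q.N v)\<^sup>2 = Re (L2_inner M u v) + t * (L2_norm M v)\<^sup>2"
      by (metis Re_complex_of_real of_real_mult plus_complex.sel(1))
    also have "\<dots> \<le> ?n * L2_norm M v + \<bar>t\<bar> * (L2_norm M v)\<^sup>2"
      using L2.CS[OF uL vL] complex_Re_le_cmod[of "L2_inner M u v"] by (intro add_mono mult_right_mono) auto
    finally have "(Q.N v)\<^sup>2 + (L2_norm M v)\<^sup>2 \<le> ?n * L2_norm M v + (\<bar>t\<bar> + 1) * (L2_norm M v)\<^sup>2"
      by (simp add: algebra_simps)
    also have "\<dots> \<le> ?n * (\<bar>C\<bar> * ?n) + (\<bar>t\<bar> + 1) * (\<bar>C\<bar> * ?n)\<^sup>2"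
      using vn by (intro add_mono mult_left_mono power_mono) auto
    also have "\<dots> = (\<bar>C\<bar> + (\<bar>t\<bar> + 1) * C\<^sup>2) * ?n\<^sup>2"
      by (simp add: power_mult_distrib algebra_simps power2_eq_square[of ?n])
    finally have "K1 * ((Q.N v)\<^sup>2 + (L2_norm M v)\<^sup>2) \<le> K1 * ((\<bar>C\<bar> + (\<bar>t\<bar> + 1) * C\<^sup>2) * ?n\<^sup>2)"
      using K1 by (intro mult_left_mono) auto
    also have "\<dots> = (C' * ?n)\<^sup>2" using K1 by (simp add: C'_def power_mult_distrib)
    finally show "(H1_norm (tube m) v)\<^sup>2 \<le> (C' * ?n)\<^sup>2" using H1_le_Q[OF v] by linarith
  qed (use C'0 in simp)
  \<comment> \<open>Hermitian symmetry turns the pairing of u with v into the equation for v tested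
    with u, which holds because u is itself in the form domain.\<close>
  have "Qi u v - complex_of_real t * L2_inner M u v = cnj (L2_inner M h u - complex_of_real t * L2_inner M v u)"
    using Q.B_herm[OF v u(1)] L.B_herm[OF v u(1)] Qv[OF u(1)] by simp
  also have "\<dots> = complex_of_real (?n\<^sup>2)" unfolding inner[OF uL] L2_inner_self by simp
  finally have "?n\<^sup>2 = cmod (Qi u v - complex_of_real t * L2_inner M u v)" by (simp add: norm_power)
  also have "\<dots> \<le> \<eta> * ?n * H1_norm (tube m) v" using u(3)[OF v] unfolding k .
  also have "\<dots> \<le> \<eta> * ?n * (C' * ?n)" using \<eta> by (intro mult_left_mono H) auto
  also have "\<dots> = (\<eta> * C') * ?n\<^sup>2" by (simp add: power2_eq_square)
  finally have "1 \<le> \<eta> * C'" using u(2) by simp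
  moreover have "\<eta> * C' < 1" using C'0 by (simp add: \<eta>_def field_simps)
  ultimately show False by linarith
qed

theorem spectrum_eq:
  assumes long: "\<And>L \<epsilon>. \<epsilon> > 0 \<Longrightarrow> \<exists>j. \<forall>s. \<bar>s - j\<bar> \<le> L \<longrightarrow> \<bar>\<gamma> s\<bar> \<le> \<epsilon>"
  shows "op_spectrum M (H_op m \<gamma>) = complex_of_real ` {mu1 m..}"
  using resolventI spectrumI[OF long] unfolding op_spectrum_def by blast

end

section \<open>Superpositions of translates of a decaying profile\<close>

text \<open>Bounds \<open>(1 + |s - k|) powr (- \<alpha>)\<close> uniformly in \<open>s\<close> when \<open>i = \<lfloor>s\<rfloor> - k\<close>.\<close>

definition lattice_weight :: "real \<Rightarrow> int \<Rightarrow> real" where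
  "lattice_weight \<alpha> i = (max 1 \<bar>real_of_int i\<bar>) powr (- \<alpha>)"

lemma lattice_weight_nonneg: "0 \<le> lattice_weight \<alpha> i"
  by (simp add: lattice_weight_def)

lemma lattice_weight_summable:
  assumes "\<alpha> > 1"
  shows "lattice_weight \<alpha> summable_on UNIV"
proof -
  have "summable (\<lambda>n::nat. lattice_weight \<alpha> (int n))"
  proof (subst summable_cong[where g="\<lambda>n. real n powr (- \<alpha>)"])
    show "\<forall>\<^sub>F n in sequentially. lattice_weight \<alpha> (int n) = real n powr (- \<alpha>)"
      using eventually_ge_at_top[of 1] by eventually_elim (simp add: lattice_weight_def)
    show "summable (\<lambda>n. real n powr (- \<alpha>))" using assms by (simp add: summable_real_powr_iff)
  qed
  then have n: "(\<lambda>n::nat. lattice_weight \<alpha> (int n)) summable_on UNIV"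
    by (subst summable_on_UNIV_nonneg_real_iff) (auto simp: lattice_weight_nonneg)
  have 1: "lattice_weight \<alpha> summable_on range int"
    by (subst summable_on_reindex) (use n in \<open>auto simp: o_def\<close>)
  have 2: "lattice_weight \<alpha> summable_on range (\<lambda>n. - int n)"
    by (subst summable_on_reindex) (use n in \<open>auto simp: o_def inj_def lattice_weight_def\<close>)
  have "UNIV = range int \<union> range (\<lambda>n. - int n)"
  proof -
    have "i \<in> range int \<union> range (\<lambda>n. - int n)" for i
      by (cases i rule: int_cases2) auto
    then show ?thesis by blast
  qed
  then show ?thesis using summable_on_union[OF 1 2] by simp
qed

lemma lattice_weight_tail:
  assumes "\<alpha> > 1" "\<delta> > 0"
  obtains F where "finite F" "infsum (lattice_weight \<alpha>) (- F) \<le> \<delta>"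
proof -
  note s = lattice_weight_summable[OF assms(1)]
  have "(sum (lattice_weight \<alpha>) \<longlongrightarrow> infsum (lattice_weight \<alpha>) UNIV) (finite_subsets_at_top UNIV)"
    using has_sum_infsum[OF s] by (simp add: has_sum_def)
  from tendstoD[OF this assms(2)] obtain F where F: "finite F" "dist (sum (lattice_weight \<alpha>) F) (infsum (lattice_weight \<alpha>) UNIV) < \<delta>"
    unfolding eventually_finite_subsets_at_top by blast
  have sF: "lattice_weight \<alpha> summable_on (- F)" by (rule summable_on_subset_banach[OF s]) simp
  have "infsum (lattice_weight \<alpha>) (F \<union> - F) = infsum (lattice_weight \<alpha>) F + infsum (lattice_weight \<alpha>) (- F)"
    by (rule infsum_Un_disjoint) (use F sF in auto)
  then have "infsum (lattice_weight \<alpha>) (- F) = infsum (lattice_weight \<alpha>) UNIV - sum (lattice_weight \<alpha>) F"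
    using F by simp
  then show ?thesis using that[OF F(1)] F(2) by (simp add: dist_real_def abs_less_iff)
qed

locale decaying_profile =
  fixes w :: "real \<Rightarrow> real" and C \<alpha> :: real
  assumes w_cont: "continuous_on UNIV w" and C: "0 < C" and \<alpha>: "1 < \<alpha>"
    and w_decay: "\<And>s. \<bar>w s\<bar> \<le> C * (1 + \<bar>s\<bar>) powr (- \<alpha>)"
begin

abbreviation "b \<equiv> lattice_weight \<alpha>"

text \<open>Rounding s down changes its distance to k by less than 1, which the summand 1 in the
  decay bound absorbs.\<close>

lemma w_le_weight: "\<bar>w (s - real_of_int k)\<bar> \<le> C * b (\<lfloor>s\<rfloor> - k)"
proof -
  have "max 1 \<bar>real_of_int (\<lfloor>s\<rfloor> - k)\<bar> \<le> 1 + \<bar>s - real_of_int k\<bar>"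
    by (simp add: abs_le_iff) linarith
  then have "(1 + \<bar>s - real_of_int k\<bar>) powr (- \<alpha>) \<le> b (\<lfloor>s\<rfloor> - k)"
    unfolding lattice_weight_def using \<alpha> by (intro powr_mono2') auto
  then have "C * (1 + \<bar>s - real_of_int k\<bar>) powr (- \<alpha>) \<le> C * b (\<lfloor>s\<rfloor> - k)" using C by (intro mult_left_mono) auto
  then show ?thesis using w_decay[of "s - real_of_int k"] by linarith
qed

lemma bij_reflect: "bij_betw (\<lambda>k::int. c - k) UNIV UNIV"
  by (rule bij_betwI[where g="\<lambda>k. c - k"]) auto

text \<open>The majorant is indexed by \<lfloor>s\<rfloor> - k, and k |-> \<lfloor>s\<rfloor> - k
  permutes the integers. Hence the bound is the same for all s.\<close>

lemma superposition_bound: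
  fixes l :: "int \<Rightarrow> real"
  assumes B: "B summable_on UNIV" and le: "\<And>k. \<bar>l k * w (s - real_of_int k)\<bar> \<le> B (\<lfloor>s\<rfloor> - k)"
  shows "(\<lambda>k. norm (l k * w (s - real_of_int k))) summable_on UNIV"
    "\<bar>\<Sum>\<^sub>\<infinity>k\<in>UNIV. l k * w (s - real_of_int k)\<bar> \<le> infsum B UNIV"
proof -
  have B': "(\<lambda>k. B (\<lfloor>s\<rfloor> - k)) summable_on UNIV"
    using summable_on_reindex_bij_betw[OF bij_reflect[of "\<lfloor>s\<rfloor>"], of B] B by simp
  show 1: "(\<lambda>k. norm (l k * w (s - real_of_int k))) summable_on UNIV"
    by (rule summable_on_comparison_test[OF B']) (use le in auto)
  have "\<bar>\<Sum>\<^sub>\<infinity>k\<in>UNIV. l k * w (s - real_of_int k)\<bar> \<le> (\<Sum>\<^sub>\<infinity>k\<in>UNIV. norm (l k * w (s - real_of_int k)))"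
    using norm_infsum_bound[OF 1] by simp
  also have "\<dots> \<le> (\<Sum>\<^sub>\<infinity>k\<in>UNIV. B (\<lfloor>s\<rfloor> - k))"
    by (rule infsum_mono[OF 1 B']) (use le in auto)
  also have "\<dots> = infsum B UNIV" by (rule infsum_reindex_bij_betw[OF bij_reflect])
  finally show "\<bar>\<Sum>\<^sub>\<infinity>k\<in>UNIV. l k * w (s - real_of_int k)\<bar> \<le> infsum B UNIV" .
qed

lemma weight_summable: "(\<lambda>i. c * b i) summable_on UNIV"
  by (intro summable_on_cmult_right lattice_weight_summable[OF \<alpha>])

lemma weight_bound:
  fixes l :: "int \<Rightarrow> real" and k :: int
  assumes "\<bar>l k\<bar> \<le> \<Lambda>"
  shows "\<bar>l k * w (s - real_of_int k)\<bar> \<le> \<Lambda> * C * b (\<lfloor>s\<rfloor> - k)"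
proof -
  have "\<bar>l k\<bar> * \<bar>w (s - real_of_int k)\<bar> \<le> \<Lambda> * (C * b (\<lfloor>s\<rfloor> - k))"
    using assms order_trans[OF abs_ge_zero assms] by (intro mult_mono w_le_weight) auto
  then show ?thesis by (simp add: abs_mult mult.assoc)
qed

lemma superposition_bounded:
  fixes l :: "int \<Rightarrow> real"
  assumes "\<And>k. \<bar>l k\<bar> \<le> \<Lambda>"
  shows "\<bar>\<Sum>\<^sub>\<infinity>k\<in>UNIV. l k * w (s - real_of_int k)\<bar> \<le> infsum (\<lambda>i. \<Lambda> * C * b i) UNIV"
proof (rule superposition_bound(2)[where B="\<lambda>i. \<Lambda> * C * b i" and l=l and s=s, OF weight_summable])
  show "\<bar>l k * w (s - real_of_int k)\<bar> \<le> \<Lambda> * C * b (\<lfloor>s\<rfloor> - k)" for k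
    by (rule weight_bound[OF assms])
qed

text \<open>Absolute summability allows the unordered sum to be rewritten, along an enumeration of
  the integers, as an ordinary series of measurable functions.\<close>

lemma superposition_measurable:
  fixes l :: "int \<Rightarrow> real"
  assumes "\<And>k. \<bar>l k\<bar> \<le> \<Lambda>"
  shows "(\<lambda>s. \<Sum>\<^sub>\<infinity>k\<in>UNIV. l k * w (s - real_of_int k)) \<in> borel_measurable borel"
proof -
  have "(\<Sum>\<^sub>\<infinity>k\<in>UNIV. l k * w (s - real_of_int k)) = (\<Sum>n. l (int_decode n) * w (s - real_of_int (int_decode n)))" for s
  proof -
    let ?f = "\<lambda>k. l k * w (s - real_of_int k)"
    have "(\<lambda>k. norm (?f k)) summable_on UNIV"
    proof (rule superposition_bound(1)[where B="\<lambda>i. \<Lambda> * C * b i" and l=l and s=s, OF weight_summable])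
      show "\<bar>l k * w (s - real_of_int k)\<bar> \<le> \<Lambda> * C * b (\<lfloor>s\<rfloor> - k)" for k
        by (rule weight_bound[OF assms])
    qed
    then have "(?f has_sum infsum ?f UNIV) UNIV" by (rule has_sum_infsum[OF abs_summable_summable])
    then have "((\<lambda>n. ?f (int_decode n)) has_sum infsum ?f UNIV) UNIV"
      using has_sum_reindex_bij_betw[OF bij_int_decode, of ?f] by simp
    then have "(\<lambda>n. ?f (int_decode n)) sums infsum ?f UNIV" by (rule has_sum_imp_sums)
    then show ?thesis by (simp add: sums_iff)
  qed
  moreover have "w \<in> borel_measurable borel" by (intro borel_measurable_continuous_onI w_cont)
  then have "(\<lambda>s. \<Sum>n. l (int_decode n) * w (s - real_of_int (int_decode n))) \<in> borel_measurable borel"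
    by measurable
  ultimately show ?thesis by simp
qed

text \<open>For s near the centre of a run, sites close to s have small coefficients, and the
  remaining ones carry little weight because their offsets \<lfloor>s\<rfloor> - k lie outside a
  large finite set F.\<close>

lemma superposition_small:
  fixes l :: "int \<Rightarrow> real" and L :: real
  assumes l: "\<And>k. \<bar>l k\<bar> \<le> \<Lambda>"
    and run: "\<And>n q. \<exists>j. \<forall>k. \<bar>k - j\<bar> \<le> int n \<longrightarrow> \<bar>l k\<bar> \<le> 1 / real (Suc q)"
    and \<epsilon>: "\<epsilon> > 0"
  shows "\<exists>j. \<forall>s. \<bar>s - j\<bar> \<le> L \<longrightarrow> \<bar>\<Sum>\<^sub>\<infinity>k\<in>UNIV. l k * w (s - real_of_int k)\<bar> \<le> \<epsilon>"
proof -
  have \<Lambda>: "\<Lambda> \<ge> 0" using l[of 0] by linarith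
  note sb = lattice_weight_summable[OF \<alpha>]
  define S where "S = infsum b UNIV"
  have S: "S \<ge> 0" unfolding S_def by (intro infsum_nonneg lattice_weight_nonneg)
  \<comment> \<open>Half of \<epsilon> is reserved for the tail, whose coefficients are only known
    to be at most \<Lambda>; the choice of q below reserves the other half for the run. The summands
    + 1 guard against \<Lambda> = 0 and S = 0.\<close>
  define \<delta> where "\<delta> = \<epsilon> / (2 * C * (\<Lambda> + 1))"
  have \<delta>: "\<delta> > 0" using \<epsilon> C \<Lambda> by (simp add: \<delta>_def)
  obtain F where F: "finite F" "infsum b (- F) \<le> \<delta>" by (rule lattice_weight_tail[OF \<alpha> \<delta>])
  obtain N :: nat where N: "\<And>i. i \<in> F \<Longrightarrow> \<bar>i\<bar> \<le> int N"
  proof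
    fix i assume "i \<in> F"
    then have "nat \<bar>i\<bar> \<le> (\<Sum>i\<in>F. nat \<bar>i\<bar>)" using F(1) by (intro member_le_sum) auto
    then show "\<bar>i\<bar> \<le> int (\<Sum>i\<in>F. nat \<bar>i\<bar>)" by linarith
  qed
  have "\<epsilon> / (2 * C * (S + 1)) > 0" using \<epsilon> C S by simp
  then obtain q where q: "1 / real (Suc q) < \<epsilon> / (2 * C * (S + 1))"
    using reals_Archimedean by (auto simp: inverse_eq_divide)
  define e where "e = 1 / real (Suc q)"
  \<comment> \<open>The distance from k to j is at most that from k to \<lfloor>s\<rfloor>, bounded
    by N on F, plus that from \<lfloor>s\<rfloor> to j, bounded by L plus 1 for the
    rounding.\<close>
  define n where "n = N + nat \<lceil>\<bar>L\<bar>\<rceil> + 1"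
  obtain j where j: "\<And>k. \<bar>k - j\<bar> \<le> int n \<Longrightarrow> \<bar>l k\<bar> \<le> e" using run[of n q] unfolding e_def by blast
  have "\<bar>\<Sum>\<^sub>\<infinity>k\<in>UNIV. l k * w (s - real_of_int k)\<bar> \<le> \<epsilon>" if s: "\<bar>s - real_of_int j\<bar> \<le> L" for s
  proof -
    let ?B1 = "\<lambda>i. e * C * b i" and ?B2 = "\<lambda>i. \<Lambda> * C * (if i \<in> - F then b i else 0)"
    have e0: "e \<ge> 0" by (simp add: e_def)
    have s1: "?B1 summable_on UNIV" by (intro summable_on_cmult_right sb)
    have s2': "(\<lambda>i. if i \<in> - F then b i else 0) summable_on UNIV"
      by (rule summable_on_comparison_test[OF sb]) (auto simp: lattice_weight_nonneg)
    then have s2: "?B2 summable_on UNIV" by (intro summable_on_cmult_right)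
    have le: "\<bar>l k * w (s - real_of_int k)\<bar> \<le> ?B1 (\<lfloor>s\<rfloor> - k) + ?B2 (\<lfloor>s\<rfloor> - k)" for k
    proof (cases "\<lfloor>s\<rfloor> - k \<in> F")
      case True
      have "\<bar>\<lfloor>s\<rfloor> - k\<bar> \<le> int N" by (rule N[OF True])
      moreover have "\<bar>real_of_int (\<lfloor>s\<rfloor> - j)\<bar> \<le> \<bar>L\<bar> + 1" using s by (simp add: abs_le_iff) linarith
      then have "\<bar>\<lfloor>s\<rfloor> - j\<bar> \<le> int (nat \<lceil>\<bar>L\<bar>\<rceil> + 1)" by linarith
      ultimately have "\<bar>k - j\<bar> \<le> int n" unfolding n_def by linarith
      then have "\<bar>l k\<bar> * \<bar>w (s - real_of_int k)\<bar> \<le> e * (C * b (\<lfloor>s\<rfloor> - k))"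
        using e0 by (intro mult_mono j w_le_weight) auto
      then show ?thesis using True by (simp add: abs_mult mult.assoc)
    next
      case False
      have "0 \<le> ?B1 (\<lfloor>s\<rfloor> - k)" using e0 C lattice_weight_nonneg[of \<alpha>] by simp
      then show ?thesis using weight_bound[of l k \<Lambda> s, OF l] False by simp
    qed
    have "\<bar>\<Sum>\<^sub>\<infinity>k\<in>UNIV. l k * w (s - real_of_int k)\<bar> \<le> infsum (\<lambda>i. ?B1 i + ?B2 i) UNIV"
      by (rule superposition_bound(2)[where B="\<lambda>i. ?B1 i + ?B2 i" and l=l and s=s, OF summable_on_add[OF s1 s2] le])
    also have "\<dots> = infsum ?B1 UNIV + infsum ?B2 UNIV" by (rule infsum_add[OF s1 s2])
    also have "infsum ?B1 UNIV = e * C * S" unfolding S_def by (rule infsum_cmult_right) (rule sb)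
    also have "infsum ?B2 UNIV = \<Lambda> * C * infsum (\<lambda>i. if i \<in> - F then b i else 0) UNIV"
      by (rule infsum_cmult_right) (rule s2')
    also have "infsum (\<lambda>i. if i \<in> - F then b i else 0) UNIV = infsum b (- F)"
      by (rule infsum_cong_neutral) auto
    also have "e * C * S + \<Lambda> * C * infsum b (- F) \<le> \<epsilon> / 2 + \<epsilon> / 2"
    proof (rule add_mono)
      have "e * (C * S) \<le> \<epsilon> / (2 * C * (S + 1)) * (C * S)"
        using q C S by (intro mult_right_mono) (auto simp: e_def)
      also have "\<dots> = \<epsilon> / 2 * (S / (S + 1))" using C by simp
      also have "\<dots> \<le> \<epsilon> / 2 * 1" using \<epsilon> S by (intro mult_left_mono) auto
      finally show "e * C * S \<le> \<epsilon> / 2" by (simp add: mult.assoc)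
      have "\<Lambda> * C * infsum b (- F) \<le> \<Lambda> * C * \<delta>" using F(2) \<Lambda> C by (intro mult_left_mono) auto
      also have "\<dots> = \<epsilon> / 2 * (\<Lambda> / (\<Lambda> + 1))" using C by (simp add: \<delta>_def)
      also have "\<dots> \<le> \<epsilon> / 2 * 1" using \<epsilon> \<Lambda> by (intro mult_left_mono) auto
      finally show "\<Lambda> * C * infsum b (- F) \<le> \<epsilon> / 2" by simp
    qed
    finally show ?thesis by simp
  qed
  then show ?thesis by blast
qed

end

section \<open>Long runs of small values\<close>

text \<open>Every block of 2 n + 1 sites is good with the same probability r > 0. By independence
  the first N + 1 blocks all fail with probability (1 - r)^(N + 1), which tends to 0.\<close>

lemma (in prob_space) AE_exists_block:
  fixes lam :: "int \<Rightarrow> 'a \<Rightarrow> real"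
  assumes ind: "indep_vars (\<lambda>_. borel) lam UNIV"
    and p: "\<And>k. prob {\<omega> \<in> space M. \<bar>lam k \<omega>\<bar> < \<epsilon>} = p" and p0: "p > 0"
  shows "AE \<omega> in M. \<exists>j. \<forall>k. \<bar>k - j\<bar> \<le> int n \<longrightarrow> \<bar>lam k \<omega>\<bar> \<le> \<epsilon>"
proof -
  \<comment> \<open>Centres spaced by 2 n + 1, so that the blocks of radius n around them are
    adjacent but disjoint.\<close>
  define c where "c i = int i * (2 * int n + 1)" for i :: nat
  define K where "K i = {c i - int n..c i + int n}" for i
  have fK: "finite (K i)" and neK: "K i \<noteq> {}" and cK: "card (K i) = 2 * n + 1" for i by (auto simp: K_def)
  have rv [measurable]: "lam k \<in> borel_measurable M" for k using ind by (auto simp: indep_vars_def)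
  have disj: "disjoint_family_on K UNIV"
    unfolding disjoint_family_on_def
  proof (intro ballI impI)
    fix i i' :: nat assume "i \<noteq> i'"
    have "K i \<inter> K i' = {}" if "i < i'" for i i'
    proof -
      have "c (Suc i) \<le> c i'" unfolding c_def using that by (intro mult_right_mono) auto
      then have "c i + 2 * int n + 1 \<le> c i'" by (simp add: c_def algebra_simps)
      then show ?thesis by (auto simp: K_def)
    qed
    then show "K i \<inter> K i' = {}" using \<open>i \<noteq> i'\<close> by (metis inf_commute linorder_neqE_nat)
  qed
  define A where "A i = {\<omega> \<in> space M. \<forall>k\<in>K i. \<bar>lam k \<omega>\<bar> < \<epsilon>}" for i
  have A_sets [measurable]: "A i \<in> sets M" for i unfolding A_def using fK by measurable
  have pA: "prob (A i) = p ^ (2 * n + 1)" for i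
  proof -
    have "A i = (\<Inter>k\<in>K i. lam k -` {-\<epsilon><..<\<epsilon>} \<inter> space M)"
      using neK[of i] by (auto simp: A_def abs_less_iff minus_less_iff)
    then have "prob (A i) = (\<Prod>k\<in>K i. prob (lam k -` {-\<epsilon><..<\<epsilon>} \<inter> space M))"
      using indep_varsD[OF ind neK[of i] fK[of i], of "\<lambda>_. {-\<epsilon><..<\<epsilon>}"] by simp
    also have "\<dots> = (\<Prod>k\<in>K i. p)"
    proof (rule prod.cong[OF refl])
      fix k
      have "lam k -` {-\<epsilon><..<\<epsilon>} \<inter> space M = {\<omega> \<in> space M. \<bar>lam k \<omega>\<bar> < \<epsilon>}" by auto
      then show "prob (lam k -` {-\<epsilon><..<\<epsilon>} \<inter> space M) = p" using p by simp
    qed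
    finally show ?thesis by (simp add: cK)
  qed
  define r where "r = p ^ (2 * n + 1)"
  have r: "0 < r" "r \<le> 1" using p0 pA[of 0] prob_le_1[of "A 0"] by (auto simp: r_def)
  have "indep_vars (\<lambda>i. PiM (K i) (\<lambda>_. borel)) (\<lambda>i \<omega>. restrict (\<lambda>k. lam k \<omega>) (K i)) UNIV"
    by (rule indep_vars_restrict[OF ind _ disj]) auto
  then have "indep_events (\<lambda>i. {\<omega> \<in> space M. \<not> (\<forall>k\<in>K i. \<bar>restrict (\<lambda>k. lam k \<omega>) (K i) k\<bar> < \<epsilon>)}) UNIV"
  proof (rule indep_eventsI_indep_vars)
    fix i
    show "{y \<in> space (PiM (K i) (\<lambda>_. borel :: real measure)). \<not> (\<forall>k\<in>K i. \<bar>y k\<bar> < \<epsilon>)} \<in> sets (PiM (K i) (\<lambda>_. borel))"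
      using fK[of i] by measurable
  qed
  moreover have "{\<omega> \<in> space M. \<not> (\<forall>k\<in>K i. \<bar>restrict (\<lambda>k. lam k \<omega>) (K i) k\<bar> < \<epsilon>)} = space M - A i" for i
    by (auto simp: A_def)
  ultimately have ie: "indep_events (\<lambda>i. space M - A i) UNIV" by simp
  have pI: "prob (\<Inter>i\<in>{..N}. space M - A i) = (1 - r) ^ Suc N" for N :: nat
  proof -
    have "prob (\<Inter>i\<in>{..N}. space M - A i) = (\<Prod>i\<in>{..N}. prob (space M - A i))"
      using ie unfolding indep_events_def by auto
    also have "\<dots> = (\<Prod>i\<in>{..N}. 1 - r)" using prob_compl[OF A_sets] pA by (simp add: r_def)
    finally show ?thesis by simp
  qed
  have "prob (\<Inter>i. space M - A i) \<le> 0"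
  proof (rule LIMSEQ_le_const)
    show "(\<lambda>N. (1 - r) ^ Suc N) \<longlonglongrightarrow> 0" using r by (intro LIMSEQ_Suc LIMSEQ_realpow_zero) auto
    have "prob (\<Inter>i. space M - A i) \<le> (1 - r) ^ Suc N" for N
      unfolding pI[symmetric] by (intro finite_measure_mono) auto
    then show "\<exists>N. \<forall>n\<ge>N. prob (\<Inter>i. space M - A i) \<le> (1 - r) ^ Suc n" by blast
  qed
  then have "(\<Inter>i. space M - A i) \<in> null_sets M"
    by (intro null_setsI) (auto simp: emeasure_eq_measure measure_le_0_iff)
  then have "AE \<omega> in M. \<omega> \<notin> (\<Inter>i. space M - A i)" by (rule AE_not_in)
  then show ?thesis
  proof (rule AE_mp, intro AE_I2 impI)
    fix \<omega> assume "\<omega> \<in> space M" "\<omega> \<notin> (\<Inter>i. space M - A i)"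
    then obtain i where "\<omega> \<in> A i" by blast
    have "\<bar>lam k \<omega>\<bar> \<le> \<epsilon>" if "\<bar>k - c i\<bar> \<le> int n" for k
    proof -
      have "k \<in> K i" using that unfolding K_def by (simp add: abs_le_iff)
      then show ?thesis using \<open>\<omega> \<in> A i\<close> by (auto simp: A_def intro: less_imp_le)
    qed
    then show "\<exists>j. \<forall>k. \<bar>k - j\<bar> \<le> int n \<longrightarrow> \<bar>lam k \<omega>\<bar> \<le> \<epsilon>" by blast
  qed
qed

text \<open>\<open>essinf\<close> is a Liminf along the almost-everywhere filter, so any real number
  strictly below it is an almost sure lower bound. The strict choice also turns a bound that might
  be infinite into a real one.\<close>

lemma AE_bounded_of_ess_bounds:
  assumes X: "X \<in> borel_measurable P"
    and lo: "- \<infinity> < essinf P (\<lambda>\<omega>. ereal (X \<omega>))" and hi: "esssup P (\<lambda>\<omega>. ereal (X \<omega>)) < \<infinity>"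
  obtains \<Lambda> where "AE \<omega> in P. \<bar>X \<omega>\<bar> \<le> \<Lambda>"
proof -
  have m: "(\<lambda>\<omega>. ereal (X \<omega>)) \<in> borel_measurable P" using X by simp
  obtain l where l: "- \<infinity> < ereal l" "ereal l < essinf P (\<lambda>\<omega>. ereal (X \<omega>))"
    using ereal_dense2[OF lo] by blast
  obtain h where h: "esssup P (\<lambda>\<omega>. ereal (X \<omega>)) < ereal h" using ereal_dense2[OF hi] by blast
  have "AE \<omega> in P. ereal l < ereal (X \<omega>)"
    using l(2) m unfolding essinf_def by (auto dest: less_LiminfD)
  moreover have "AE \<omega> in P. ereal (X \<omega>) \<le> esssup P (\<lambda>\<omega>. ereal (X \<omega>))" by (rule esssup_AE)
  then have "AE \<omega> in P. ereal (X \<omega>) < ereal h" by eventually_elim (rule order_le_less_trans[OF _ h])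
  ultimately have "AE \<omega> in P. \<bar>X \<omega>\<bar> \<le> max \<bar>l\<bar> \<bar>h\<bar>" by eventually_elim auto
  then show ?thesis by (rule that)
qed

text \<open>If |X| < \<epsilon> had probability zero, then \<epsilon>^2 would be an almost sure
  lower bound of X^2 and its essential infimum would be positive.\<close>

lemma (in prob_space) prob_small_pos:
  assumes X: "X \<in> borel_measurable M" and inf: "essinf M (\<lambda>\<omega>. ereal ((X \<omega>)\<^sup>2)) = 0" and \<epsilon>: "\<epsilon> > 0"
  shows "prob {\<omega> \<in> space M. \<bar>X \<omega>\<bar> < \<epsilon>} > 0"
proof (rule ccontr)
  assume "\<not> ?thesis"
  then have z: "prob {\<omega> \<in> space M. \<bar>X \<omega>\<bar> < \<epsilon>} = 0" using measure_nonneg[of M "{\<omega> \<in> space M. \<bar>X \<omega>\<bar> < \<epsilon>}"] by linarith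
  have s: "{\<omega> \<in> space M. \<bar>X \<omega>\<bar> < \<epsilon>} \<in> sets M" using X by measurable
  have "{\<omega> \<in> space M. \<bar>X \<omega>\<bar> < \<epsilon>} \<in> null_sets M" using z s by (intro null_setsI) (simp add: emeasure_eq_measure)
  then have "AE \<omega> in M. \<omega> \<notin> {\<omega> \<in> space M. \<bar>X \<omega>\<bar> < \<epsilon>}" by (rule AE_not_in)
  then have "AE \<omega> in M. ereal (\<epsilon>\<^sup>2) \<le> ereal ((X \<omega>)\<^sup>2)"
  proof (rule AE_mp, intro AE_I2 impI)
    fix \<omega> assume "\<omega> \<in> space M" "\<omega> \<notin> {\<omega> \<in> space M. \<bar>X \<omega>\<bar> < \<epsilon>}"
    then have "\<epsilon> \<le> \<bar>X \<omega>\<bar>" by auto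
    then have "\<epsilon>\<^sup>2 \<le> \<bar>X \<omega>\<bar>\<^sup>2" using \<epsilon> by (intro power_mono) auto
    then show "ereal (\<epsilon>\<^sup>2) \<le> ereal ((X \<omega>)\<^sup>2)" by simp
  qed
  then have "ereal (\<epsilon>\<^sup>2) \<le> Liminf (ae_filter M) (\<lambda>\<omega>. ereal ((X \<omega>)\<^sup>2))" by (rule Liminf_bounded)
  also have "\<dots> = 0" using inf X by (simp add: essinf_def split: if_splits)
  finally show False using \<epsilon> by simp
qed

theorem proposition3p1:
  fixes m :: "(real^2) set"
    and P :: "'w measure"
    and lam :: "int \<Rightarrow> 'w \<Rightarrow> real"
    and w :: "real \<Rightarrow> real"
    and C \<alpha> :: real
  assumes "open m" and "connected m" and "m \<noteq> {}" and "bounded m"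
    and "prob_space P"
    and "prob_space.indep_vars P (\<lambda>_. borel) lam UNIV"
    and "\<And>k. distr P borel (lam k) = distr P borel (lam 0)"
    and "- \<infinity> < essinf P (\<lambda>\<omega>. ereal (lam 0 \<omega>))"
    and "essinf P (\<lambda>\<omega>. ereal (lam 0 \<omega>)) < esssup P (\<lambda>\<omega>. ereal (lam 0 \<omega>))"
    and "esssup P (\<lambda>\<omega>. ereal (lam 0 \<omega>)) < \<infinity>"
    and "essinf P (\<lambda>\<omega>. ereal ((lam 0 \<omega>)\<^sup>2)) = 0"
    and "continuous_on UNIV w"
    and "0 < C" and "1 < \<alpha>"
    and "\<And>s. \<bar>w s\<bar> \<le> C * (1 + \<bar>s\<bar>) powr (- \<alpha>)"
  shows "AE \<omega> in P.
    op_spectrum (leb_on (tube m)) (H_op m (random_gamma lam w \<omega>)) = complex_of_real ` {mu1 m..}"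
proof -
  interpret P: prob_space P by fact
  interpret decaying_profile w C \<alpha> using assms(12-15) by unfold_locales
  have rv: "lam k \<in> borel_measurable P" for k using assms(6) by (auto simp: P.indep_vars_def)
  \<comment> \<open>The essential bounds are assumed for \<open>lam 0\<close> alone; an almost sure
    property that depends only on the value is a property of the common law.\<close>
  have transfer_AE: "AE \<omega> in P. Q (lam k \<omega>)" if "AE \<omega> in P. Q (lam 0 \<omega>)" "Measurable.pred borel Q" for Q k
  proof -
    have "AE x in distr P borel (lam 0). Q x" using that rv[of 0] by (simp add: AE_distr_iff)
    then have "AE x in distr P borel (lam k). Q x" by (simp only: assms(7)[of k])
    then show ?thesis using that(2) rv[of k] by (simp add: AE_distr_iff)
  qed
  obtain \<Lambda> where "AE \<omega> in P. \<bar>lam 0 \<omega>\<bar> \<le> \<Lambda>"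
    by (rule AE_bounded_of_ess_bounds[OF rv assms(8,10)])
  then have "AE \<omega> in P. \<bar>lam k \<omega>\<bar> \<le> \<Lambda>" for k by (rule transfer_AE) measurable
  then have bounded: "AE \<omega> in P. \<forall>k. \<bar>lam k \<omega>\<bar> \<le> \<Lambda>" by (simp add: AE_all_countable)
  \<comment> \<open>Thresholds 1 / (q + 1) stand for all positive ones, so that countably many
    exceptional null sets, over n and q, can be united before \<omega> is fixed.\<close>
  have "AE \<omega> in P. \<exists>j. \<forall>k. \<bar>k - j\<bar> \<le> int n \<longrightarrow> \<bar>lam k \<omega>\<bar> \<le> 1 / real (Suc q)" for n q
  proof (rule P.AE_exists_block[OF assms(6)])
    let ?\<epsilon> = "1 / real (Suc q)"
    have "P.prob {\<omega> \<in> space P. \<bar>lam k \<omega>\<bar> < ?\<epsilon>} = measure (distr P borel (lam k)) {-?\<epsilon><..<?\<epsilon>}" for k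
    proof -
      have "{\<omega> \<in> space P. \<bar>lam k \<omega>\<bar> < ?\<epsilon>} = lam k -` {-?\<epsilon><..<?\<epsilon>} \<inter> space P" by auto
      then show ?thesis using measure_distr[OF rv[of k], of "{-?\<epsilon><..<?\<epsilon>}"] by simp
    qed
    then show "P.prob {\<omega> \<in> space P. \<bar>lam k \<omega>\<bar> < ?\<epsilon>} = P.prob {\<omega> \<in> space P. \<bar>lam 0 \<omega>\<bar> < ?\<epsilon>}" for k
      by (simp only: assms(7)[of k])
    show "P.prob {\<omega> \<in> space P. \<bar>lam 0 \<omega>\<bar> < ?\<epsilon>} > 0"
      by (rule P.prob_small_pos[OF rv assms(11)]) simp
  qed
  then have runs: "AE \<omega> in P. \<forall>n q. \<exists>j. \<forall>k. \<bar>k - j\<bar> \<le> int n \<longrightarrow> \<bar>lam k \<omega>\<bar> \<le> 1 / real (Suc q)"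
    by (simp add: AE_all_countable)
  obtain R where R: "\<And>x. x \<in> m \<Longrightarrow> norm x \<le> R" using assms(4) by (auto simp: bounded_iff)
  from bounded runs show ?thesis
  proof eventually_elim
    case (elim \<omega>)
    let ?l = "\<lambda>k. lam k \<omega>"
    have l: "\<bar>?l k\<bar> \<le> \<Lambda>" for k using elim(1) by blast
    have run: "\<exists>j. \<forall>k. \<bar>k - j\<bar> \<le> int n \<longrightarrow> \<bar>?l k\<bar> \<le> 1 / real (Suc q)" for n q using elim(2) by blast
    have e: "random_gamma lam w \<omega> = (\<lambda>s. \<Sum>\<^sub>\<infinity>k\<in>UNIV. ?l k * w (s - real_of_int k))"
      by (auto simp: random_gamma_def)
    interpret twisted_tube m "random_gamma lam w \<omega>" "infsum (\<lambda>i. \<Lambda> * C * b i) UNIV" R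
    proof
      show "random_gamma lam w \<omega> \<in> borel_measurable borel"
        unfolding e by (rule superposition_measurable) (rule l)
      show "\<bar>random_gamma lam w \<omega> s\<bar> \<le> infsum (\<lambda>i. \<Lambda> * C * b i) UNIV" for s
        unfolding e by (rule superposition_bounded) (rule l)
    qed (use assms R in auto)
    show ?case
    proof (rule spectrum_eq)
      fix L \<epsilon> :: real assume "\<epsilon> > 0"
      then show "\<exists>j. \<forall>s. \<bar>s - j\<bar> \<le> L \<longrightarrow> \<bar>random_gamma lam w \<omega> s\<bar> \<le> \<epsilon>"
        unfolding e by (rule superposition_small[OF l run])
    qed
  qed
qed

end
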